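(* Let $x,y,z$ be non-negative integers and let $\mathbf a=(a_1,\dots,a_m)$, $\mathbf b=(b_1,\dots,b_n)$ be sequences of non-negative integers. Put $\mu=2\lfloor\frac{m+1}{2}\rfloor$, $\mu'=2\lceil\frac{m-1}{2}\rceil$, $\nu=2\lfloor\frac{n+1}{2}\rfloor$, $\nu'=2\lceil\frac{n-1}{2}\rceil$, and $$\mathbf t^{+}=(a_1,\dots,a_{\mu'},\,a_{\mu'+1}+x+y+b_{\nu},\,b_{\nu-1},\dots,b_1),\qquad \mathbf t^{-}=(0,a_1,\dots,a_{\mu-1},\,a_{\mu}+x+y+b_{\nu'+1},\,b_{\nu'},\dots,b_1,z).$$ Then $$M(RW^{(1)}_{x,y,z}(\mathbf a;\mathbf b))=\frac{M(RW^{(1)}_{x+y,0,z}(\mathbf a;\mathbf b))\,M(RW^{(1)}_{0,y,z}(\mathbf a;\mathbf b))}{M(RW^{(1)}_{y,0,z}(\mathbf a;\mathbf b))}\cdot\frac{T(x+1,2a+b+2y+z-1,y)\,V(2x+2a+1,b+2y+z,y)}{T(1,2a+b+2y+z-1,y)\,V(2a+1,b+2y+z,y)}$$ $$=2^{a_1-2y}\,Q'(\mathbf t^{+})\,Q'(\mathbf t^{-})\cdot\frac{(2a+2y-1)!!}{(2a-1)!!}\cdot\frac{H_2(2e_a+2o_b+1)\,H_2(2o_a+2e_b+2z+1)}{H_2(2e_a+2o_b+2y+1)\,H_2(2o_a+2e_b+2y+2z+1)}\cdot\frac{H(2a+b+2y+z)\,H(b+y+z)}{H(2a+b+y+z)\,H(b+z)}$$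 $$\cdot\frac{T(x+1,2a+b+2y+z-1,y)\,V(2x+2a+1,b+2y+z,y)}{T(1,2a+b+2y+z-1,y)\,V(2a+1,b+2y+z,y)}.$$
   Context: Lattice and tilings. For real $u,k$ let $[u;k]$ be the point of the plane with Cartesian coordinates $(u,\frac{\sqrt3}{2}k)$. The triangular lattice has as vertices all $[u;k]$ with $k\in\mathbb Z$, $u-k/2\in\mathbb Z$; its faces are unit equilateral triangles, up-pointing or down-pointing. A region is a finite union of unit triangles. A lozenge is the union of two unit triangles sharing an edge; it is vertical if that edge is horizontal. A tiling of a region is a covering of it by lozenges contained in it, without gaps or overlaps. $M(R)$ is the sum of the weights of all tilings of $R$, the weight of a tiling being the product of the weights of its lozenges; lozenges have weight $1$ unless stated otherwise; $M(\emptyset)=1$. Sequences. $a=\sum a_i$, $b=\sum b_j$; $o_a,e_a$ are the sums of the $a_i$ with $i$ odd, resp. even; $o_b,e_b$ likewise. $a_i=0$ for $i>m$, $b_j=0$ for $j>n$; an empty sequence is treated as the one-term sequence $(0)$. Functions. $H(n)=\prod_{i=0}^{n-1}i!$; $H_2(n)=\prod_{i=1}^{\lfloor n/2\rfloor}(n-2i)!$; for $n\ge0$, $(x)_n=x(x+1)\cdots(x+n-1)$ and $[x]_n=x(x+2)\cdots(x+2n-2)$ (both $1$ for $n=0$); $T(x,n,m)=\prod_{i=0}^{m-1}(x+i)_{n-2i}$, $V(x,n,m)=\prod_{i=0}^{m-1}[x+2i]_{n-2i}$; $(2n+1)!!=1\cdot3\cdots(2n+1)$, $(-1)!!=1$.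 Empty products are $1$. Quartered hexagons. For a sequence $\mathbf t=(t_1,\dots,t_{2l})$ of non-negative integers let $s_k=t_1+\dots+t_k$, $o_t=\sum_{i\text{ odd}}t_i$, $e_t=\sum_{i\text{ even}}t_i$. Take the region bounded by the base from $[0;0]$ to $[o_t+e_t;0]$, the segment from $[o_t+e_t;0]$ to $[o_t;2e_t]$, the north side from $[o_t;2e_t]$ to $[0;2e_t]$, and the west zigzag through $[0;0],[-\frac12;1],[0;2],[-\frac12;3],\dots,[0;2e_t]$; remove from it, for each $1\le i\le l$, the up-pointing triangle with base from $[s_{2i-1};0]$ to $[s_{2i};0]$. Give weight $\frac12$ to each vertical lozenge whose two western (left) sides both lie on the west zigzag. $Q'(\mathbf t)$ is $M$ of this weighted region. The weighted region $RW^{(1)}_{x,y,z}(\mathbf a;\mathbf b)$. Let $L=x+y+a+b$, $A=2(y+e_a+o_b)$, $B=2(y+z+o_a+e_b)$, and let $\ell$ be the line $k=0$. Upper part: bounded by $\ell$ between $[0;0]$ and $[L;0]$, the segment from $[L;0]$ to $[L-\frac A2;A]$, the horizontal north side at height $k=A$, and the west zigzag through the points $[\alpha(k);k]$, $0\le k\le A$, with $\alpha(k)=0$ for $k$ even and $-\frac12$ for $k$ odd. Lower part: bounded by $\ell$ between $[0;0]$ and $[L;0]$, the segments from $[L;0]$ to $[L+\frac z2;-z]$ and from there to $[L+z-\frac B2;-B]$, the horizontal south side at $k=-B$, and the west zigzag through $[\beta(k);-k]$, $0\le k\le B$, with $\beta(k)=0$ for $k$ even and $-\frac12$ for $k$ odd.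 The region is the union of the two parts (lozenges may cross $\ell$) after removing: (i) from the lower part, everything at points $[u;-k]$ with $u<a_1-k/2$ (a down-pointing half triangle of side $2a_1$); (ii) for $2\le i\le m$, the triangle of side $a_i$ having a side on $\ell$ from $[a_1+\dots+a_{i-1};0]$ to $[a_1+\dots+a_i;0]$, up-pointing (above $\ell$) if $i$ is even, down-pointing (below $\ell$) if $i$ is odd; (iii) for $1\le j\le n$, the triangle of side $b_j$ having a side on $\ell$ from $[L-b_1-\dots-b_j;0]$ to $[L-b_1-\dots-b_{j-1};0]$, up-pointing (above $\ell$) if $j$ is odd, down-pointing (below $\ell$) if $j$ is even. Each vertical lozenge of the region whose two western (left) sides both lie on the west zigzags has weight $\frac12$. *)

theory Defs
  imports Complex_Main "HOL-Library.Disjoint_Sets"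
begin

(* The lattice vertex [u;k] is encoded by the pair (p, k) of integers with p = u - k/2, so that
   every pair of integers is a vertex; "hcoord" recovers u, and "snd" is k. *)

type_synonym vertex = "int \<times> int"

definition hcoord :: "vertex \<Rightarrow> real" where
  "hcoord v = of_int (fst v) + of_int (snd v) / 2"

(* Up p k and Down p k are the up- and the down-pointing unit triangle whose horizontal side goes
   from [u;k] to [u+1;k], where u = p + k/2.  The third vertex is [u+1/2;k+1], resp. [u+1/2;k-1]. *)

datatype face = Up int int | Down int int

fun verts :: "face \<Rightarrow> vertex set" where
  "verts (Up p k) = {(p, k), (p + 1, k), (p, k + 1)}"
| "verts (Down p k) = {(p, k), (p + 1, k), (p + 1, k - 1)}"

(* Regions and lozenges are represented by the set of their unit triangles. *)

definition lozenge :: "face set \<Rightarrow> bool" where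
  "lozenge l \<longleftrightarrow> (\<exists>f g. f \<noteq> g \<and> card (verts f \<inter> verts g) = 2 \<and> l = {f, g})"

definition tilings :: "face set \<Rightarrow> face set set set" where
  "tilings R = {\<T>. partition_on R \<T> \<and> (\<forall>l\<in>\<T>. lozenge l)}"

(* A weighted region consists of a region and the weights of the lozenges. *)

type_synonym weighted_region = "face set \<times> (face set \<Rightarrow> real)"

definition M :: "weighted_region \<Rightarrow> real" where
  "M = (\<lambda>(R, w). \<Sum>\<T>\<in>tilings R. \<Prod>l\<in>\<T>. w l)"

(* Horizontal coordinate at height k of the zigzag through [0;0], [-1/2;1], [0;2], ..., which is
   continued in the same way below the line k = 0. *)

definition zigzag_coord :: "int \<Rightarrow> real" where
  "zigzag_coord k = (if even k then 0 else - 1 / 2)"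

definition zigzag :: "int \<Rightarrow> int \<Rightarrow> vertex set" where
  "zigzag lo hi = {v. lo \<le> snd v \<and> snd v \<le> hi \<and> hcoord v = zigzag_coord (snd v)}"

(* The vertical lozenge {Up p k, Down p k} has the western sides from (p, k) to (p, k + 1) and from
   (p, k) to (p + 1, k - 1).  A unit edge between consecutive heights lies on a zigzag iff both
   of its endpoints do. *)

definition zigzag_weight :: "vertex set \<Rightarrow> face set \<Rightarrow> real" where
  "zigzag_weight Z l =
     (if \<exists>p k. l = {Up p k, Down p k} \<and> {(p, k), (p, k + 1), (p + 1, k - 1)} \<subseteq> Z then 1 / 2 else 1)"

(* Within each horizontal strip between consecutive heights all regions below are convex, so a unit
   triangle is contained in such a region iff its three vertices are. *)

definition upper_part :: "nat \<Rightarrow> nat \<Rightarrow> face set" where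
  "upper_part L A = {f. \<forall>v\<in>verts f. 0 \<le> snd v \<and> snd v \<le> int A \<and>
     zigzag_coord (snd v) \<le> hcoord v \<and> hcoord v \<le> real L - of_int (snd v) / 2}"

definition lower_part :: "nat \<Rightarrow> nat \<Rightarrow> nat \<Rightarrow> face set" where
  "lower_part L z B = {f. \<forall>v\<in>verts f. \<exists>k. snd v = - k \<and> 0 \<le> k \<and> k \<le> int B \<and>
     zigzag_coord k \<le> hcoord v \<and>
     hcoord v \<le> real L + of_int k / 2 \<and> hcoord v \<le> real L + real z - of_int k / 2}"

definition up_triangle :: "real \<Rightarrow> real \<Rightarrow> face set" where
  "up_triangle s t = {f. \<forall>v\<in>verts f. 0 \<le> snd v \<and>
     s + of_int (snd v) / 2 \<le> hcoord v \<and> hcoord v \<le> t - of_int (snd v) / 2}"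

definition down_triangle :: "real \<Rightarrow> real \<Rightarrow> face set" where
  "down_triangle s t = {f. \<forall>v\<in>verts f. \<exists>k. snd v = - k \<and> 0 \<le> k \<and>
     s + of_int k / 2 \<le> hcoord v \<and> hcoord v \<le> t - of_int k / 2}"

(* The unit triangles below the line k = 0 on the western side of the lattice line through [t;0]
   and [t-1/2;-1]. *)

definition below_west :: "real \<Rightarrow> face set" where
  "below_west t = {f. \<forall>v\<in>verts f. \<exists>k. snd v = - k \<and> 0 \<le> k \<and> hcoord v \<le> t - of_int k / 2}"

(* The i-th term of a sequence, counted from 1; it is 0 beyond the end of the sequence. *)

definition entry :: "nat list \<Rightarrow> nat \<Rightarrow> nat" where
  "entry s i = (if 1 \<le> i \<and> i \<le> length s then s ! (i - 1) else 0)"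

definition partial_sum :: "nat list \<Rightarrow> nat \<Rightarrow> nat" where
  "partial_sum s k = (\<Sum>i=1..k. entry s i)"

definition odd_sum :: "nat list \<Rightarrow> nat" where
  "odd_sum s = (\<Sum>i | i \<in> {1..length s} \<and> odd i. entry s i)"

definition even_sum :: "nat list \<Rightarrow> nat" where
  "even_sum s = (\<Sum>i | i \<in> {1..length s} \<and> even i. entry s i)"

definition nonempty_seq :: "nat list \<Rightarrow> nat list" where
  "nonempty_seq s = (if s = [] then [0] else s)"

(* The weighted quartered hexagon of a sequence of even length. *)

definition quartered_hexagon :: "nat list \<Rightarrow> weighted_region" where
  "quartered_hexagon t =
     (upper_part (odd_sum t + even_sum t) (2 * even_sum t)
        - (\<Union>i\<in>{1..length t div 2}.
             up_triangle (real (partial_sum t (2 * i - 1))) (real (partial_sum t (2 * i)))),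
      zigzag_weight (zigzag 0 (int (2 * even_sum t))))"

definition Q' :: "nat list \<Rightarrow> real" where
  "Q' t = M (quartered_hexagon t)"

definition RW1 :: "nat \<Rightarrow> nat \<Rightarrow> nat \<Rightarrow> nat list \<Rightarrow> nat list \<Rightarrow> weighted_region" where
  "RW1 x y z as bs =
     (let L = x + y + sum_list as + sum_list bs;
          A = 2 * (y + even_sum as + odd_sum bs);
          B = 2 * (y + z + odd_sum as + even_sum bs)
      in
        (upper_part L A \<union> lower_part L z B
           - below_west (real (entry as 1))
           - (\<Union>i\<in>{2..length as}.
                (if even i then up_triangle else down_triangle)
                  (real (partial_sum as (i - 1))) (real (partial_sum as i)))
           - (\<Union>j\<in>{1..length bs}.
                (if odd j then up_triangle else down_triangle)
                  (real L - real (partial_sum bs j)) (real L - real (partial_sum bs (j - 1)))),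
         zigzag_weight (zigzag (- int B) (int A))))"

definition H :: "nat \<Rightarrow> real" where
  "H n = (\<Prod>i<n. fact i)"

definition H2 :: "nat \<Rightarrow> real" where
  "H2 n = (\<Prod>i=1..n div 2. fact (n - 2 * i))"

(* [x]_n = x (x + 2) ... (x + 2 n - 2) *)

definition pochhammer2 :: "real \<Rightarrow> nat \<Rightarrow> real" where
  "pochhammer2 x n = (\<Prod>i<n. x + 2 * real i)"

(* T and V are only used with n - 2 i >= 0 for all i < m, so the truncated subtraction is harmless. *)

definition T :: "real \<Rightarrow> nat \<Rightarrow> nat \<Rightarrow> real" where
  "T x n m = (\<Prod>i<m. pochhammer (x + real i) (n - 2 * i))"

definition V :: "real \<Rightarrow> nat \<Rightarrow> nat \<Rightarrow> real" where
  "V x n m = (\<Prod>i<m. pochhammer2 (x + 2 * real i) (n - 2 * i))"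

(* Double factorial of an odd integer n >= -1; the value at -1 is 1. *)

definition odd_dfact :: "int \<Rightarrow> real" where
  "odd_dfact n = (\<Prod>i | i \<in> {1..n} \<and> odd i. of_int i)"

definition t_plus :: "nat \<Rightarrow> nat \<Rightarrow> nat list \<Rightarrow> nat list \<Rightarrow> nat list" where
  "t_plus x y as bs =
     (let m = length (nonempty_seq as); n = length (nonempty_seq bs);
          \<mu>' = nat (2 * \<lceil>(real m - 1) / 2\<rceil>);
          \<nu> = nat (2 * \<lfloor>(real n + 1) / 2\<rfloor>)
      in map (entry as) [1..<\<mu>' + 1] @ [entry as (\<mu>' + 1) + x + y + entry bs \<nu>]
           @ rev (map (entry bs) [1..<\<nu>]))"

definition t_minus :: "nat \<Rightarrow> nat \<Rightarrow> nat \<Rightarrow> nat list \<Rightarrow> nat list \<Rightarrow> nat list" where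
  "t_minus x y z as bs =
     (let m = length (nonempty_seq as); n = length (nonempty_seq bs);
          \<mu> = nat (2 * \<lfloor>(real m + 1) / 2\<rfloor>);
          \<nu>' = nat (2 * \<lceil>(real n - 1) / 2\<rceil>)
      in 0 # map (entry as) [1..<\<mu>] @ [entry as \<mu> + x + y + entry bs (\<nu>' + 1)]
           @ rev (map (entry bs) [1..<\<nu>' + 1]) @ [z])"

end

(* Cut the region along the base line. If S is the set of those of the x + y free segments of this
   line that are crossed by vertical lozenges, then both parts are quartered hexagons whose base has
   unit dents: a removed triangle forces the same lozenges as unit dents along its side. Row by row,
   the dents of a quartered hexagon interlace; summing determinants of central factorials over
   interlacing families shows that its weight is, up to a constant, the product of the v_p and the
   Vandermonde product of the v_p^2, where v_p = p + 1/2 for a dent at p. The dents fixed in the two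
   parts are complementary, so the sum over S becomes a discrete Selberg sum with the squared
   Vandermonde product of S, in which only a, b + z, y and x + y enter. By Andreief's identity this
   sum is a determinant; its entries have a product formula and, after removing row and column
   factors, it is a Hankel determinant that can be evaluated. *)

theory Submission
  imports Defs "Jordan_Normal_Form.Determinant"
begin

section \<open>Determinants of real-valued families\<close>

text \<open>Central factorials occur because the heights alternate by half a unit: in suitable
  coordinates the dents are integers on odd heights and half-integers on even ones. Even polynomials
  on the integers and odd ones on the half-integers are exchanged by central differences. The weight
  1/2 on the zigzag is exactly what lets an even function be summed from 0: half its value at 0 is
  the odd antidifference at 1/2. In the product of the two parts, the distances from S to the fixed
  dents only see the union of these dents, which is everything outside the free segment. So the way
  the triangles are distributed leaves the sum over S. The moments become products because rows use
  Newton polynomials with nodes at the left end and columns use nodes at the right end; each Newton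
  factor just moves a parameter of the weight. The constant of the Selberg sum is not tracked. It is
  independent of the number N of free positions, and for N = y there is a single set S. The power of
  2 has two sources: the half triangle of side 2 a_1 corresponds to a_1 forced lozenges of weight
  1/2, and each of the y dents contributes (p + 1/2)^2 = (2 p + 1)^2 / 4.\<close>

definition fdet :: "nat \<Rightarrow> (nat \<Rightarrow> nat \<Rightarrow> real) \<Rightarrow> real" where
  "fdet n f = det (mat n n (\<lambda>(i, j). f i j))"

lemma fdet_cong:
  assumes "\<And>i j. i < n \<Longrightarrow> j < n \<Longrightarrow> f i j = g i j"
  shows "fdet n f = fdet n g"
proof -
  have "mat n n (\<lambda>(i, j). f i j) = mat n n (\<lambda>(i, j). g i j)"
    by (rule eq_matI) (auto simp: assms)
  then show ?thesis by (simp add: fdet_def)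
qed

lemma fdet_leibniz:
  "fdet n f = (\<Sum>p | p permutes {..<n}. signof p * (\<Prod>i<n. f i (p i)))"
proof -
  have "fdet n f = (\<Sum>p\<in>{p. p permutes {0..<n}}. signof p * (\<Prod>i=0..<n. mat n n (\<lambda>(i, j). f i j)
      $$ (i, p i)))"
    unfolding fdet_def by (rule det_def') simp
  also have "\<dots> = (\<Sum>p | p permutes {..<n}. signof p * (\<Prod>i<n. f i (p i)))"
    unfolding atLeast0LessThan
  proof (intro sum.cong refl arg_cong2[where f="(*)"] prod.cong)
    fix p i assume "p \<in> {p. p permutes {..<n}}" "i \<in> {..<n}"
    then show "mat n n (\<lambda>(i, j). f i j) $$ (i, p i) = f i (p i)"
      using permutes_in_image[of p "{..<n}" i] by simp
  qed
  finally show ?thesis .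
qed

lemma fdet_0 [simp]: "fdet 0 f = 1"
  unfolding fdet_def by (rule det_dim_zero) simp

lemma fdet_transpose: "fdet n (\<lambda>i j. f j i) = fdet n f"
proof -
  have "transpose_mat (mat n n (\<lambda>(i, j). f i j)) = mat n n (\<lambda>(i, j). f j i)"
    by (rule eq_matI) auto
  then show ?thesis
    unfolding fdet_def using det_transpose[of "mat n n (\<lambda>(i, j). f i j)" n] by simp
qed

lemma fdet_mult: "fdet n (\<lambda>i j. \<Sum>k<n. f i k * g k j) = fdet n f * fdet n g"
proof -
  have "mat n n (\<lambda>(i, j). f i j) * mat n n (\<lambda>(i, j). g i j)
      = mat n n (\<lambda>(i, j). \<Sum>k<n. f i k * g k j)"
    by (rule eq_matI) (auto simp: scalar_prod_def atLeast0LessThan intro!: sum.cong)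
  then show ?thesis
    unfolding fdet_def
    using det_mult[of "mat n n (\<lambda>(i, j). f i j)" n "mat n n (\<lambda>(i, j). g i j)"] by simp
qed

lemma fdet_upper:
  assumes "\<And>i j. j < i \<Longrightarrow> i < n \<Longrightarrow> f i j = 0"
  shows "fdet n f = (\<Prod>i<n. f i i)"
proof -
  have "fdet n f = prod_list (diag_mat (mat n n (\<lambda>(i, j). f i j)))"
    unfolding fdet_def by (rule det_upper_triangular) (auto simp: assms)
  also have "\<dots> = (\<Prod>i<n. f i i)"
    unfolding diag_mat_def by (simp add: prod.list_conv_set_nth atLeast0LessThan)
  finally show ?thesis .
qed

lemma fdet_row_factor: "fdet n (\<lambda>i j. c i * f i j) = (\<Prod>i<n. c i) * fdet n f"
  unfolding fdet_leibniz sum_distrib_left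
  by (intro sum.cong refl) (simp add: prod.distrib mult_ac)

lemma fdet_col_factor: "fdet n (\<lambda>i j. c j * f i j) = (\<Prod>i<n. c i) * fdet n f"
  using fdet_row_factor[of n c "\<lambda>i j. f j i"] fdet_transpose[of n f]
    fdet_transpose[of n "\<lambda>i j. c i * f j i"] by simp

lemma fdet_permute_rows:
  assumes "p permutes {..<n}"
  shows "fdet n (\<lambda>i j. f (p i) j) = signof p * fdet n f"
proof -
  have *: "p permutes {0..<n}" using assms by (simp add: atLeast0LessThan)
  have "mat n n (\<lambda>(i, j). mat n n (\<lambda>(i, j). f i j) $$ (p i, j)) = mat n n (\<lambda>(i, j). f (p i) j)"
    using permutes_in_image[OF assms] by (intro eq_matI) auto
  then show ?thesis unfolding fdet_def using det_permute_rows[OF _ *, of "mat n n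
      (\<lambda>(i, j). f i j)"] by simp
qed

text \<open>Left multiplication by a unitriangular matrix with \<open>- r i\<close> just below the
  diagonal. All rows change at once: what is subtracted is the original previous row, so telescoping
  sums can be undone in a single step.\<close>

lemma fdet_row_diff:
  "fdet n (\<lambda>i j. f i j - (if i = 0 then 0 else r i * f (i - 1) j)) = fdet n f"
proof -
  define u where "u = (\<lambda>i k. if k = i then 1 else if Suc k = i then - r i else (0::real))"
  have "fdet n (\<lambda>i j. f i j - (if i = 0 then 0 else r i * f (i - 1) j))
      = fdet n (\<lambda>i j. \<Sum>k<n. u i k * f k j)"
  proof (rule fdet_cong)
    fix i j assume ij: "i < n" "j < n"
    have "(\<Sum>k<n. u i k * f k j) = (\<Sum>k\<in>{i} \<union> {k. Suc k = i}. u i k * f k j)"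
      using ij by (intro sum.mono_neutral_right) (auto simp: u_def)
    also have "\<dots> = f i j - (if i = 0 then 0 else r i * f (i - 1) j)"
    proof (cases i)
      case (Suc i')
      then have "{i} \<union> {k. Suc k = i} = {i, i'}" by auto
      then show ?thesis using Suc by (simp add: u_def)
    qed (auto simp: u_def)
    finally show "f i j - (if i = 0 then 0 else r i * f (i - 1) j) = (\<Sum>k<n. u i k * f k j)" by simp
  qed
  also have "\<dots> = fdet n u * fdet n f" by (rule fdet_mult)
  \<comment> \<open>\<open>u\<close> is lower triangular; the transpose fits
    \<open>fdet_upper\<close>.\<close>
  also have "fdet n u = fdet n (\<lambda>i j. u j i)" by (rule fdet_transpose[symmetric])
  also have "\<dots> = (\<Prod>i<n. u i i)" by (rule fdet_upper) (auto simp: u_def)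
  also have "\<dots> = 1" by (simp add: u_def)
  finally show ?thesis by simp
qed

lemma fdet_col_diff:
  "fdet n (\<lambda>i j. f i j - (if j = 0 then 0 else r j * f i (j - 1))) = fdet n f"
  using fdet_row_diff[of n "\<lambda>i j. f j i" r] fdet_transpose[of n f]
    fdet_transpose[of n "\<lambda>i j. f j i - (if i = 0 then 0 else r i * f j (i - 1))"] by simp

lemma fdet_Suc:
  assumes "\<And>j. 0 < j \<Longrightarrow> j \<le> n \<Longrightarrow> f 0 j = 0"
  shows "fdet (Suc n) f = f 0 0 * fdet n (\<lambda>i j. f (Suc i) (Suc j))"
proof -
  let ?A = "mat (Suc n) (Suc n) (\<lambda>(i, j). f i j)"
  have "fdet (Suc n) f = (\<Sum>j<Suc n. ?A $$ (0, j) * cofactor ?A 0 j)"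
    unfolding fdet_def by (rule laplace_expansion_row) auto
  also have "\<dots> = (\<Sum>j\<in>{0}. ?A $$ (0, j) * cofactor ?A 0 j)"
    by (rule sum.mono_neutral_right) (auto simp: assms)
  also have "\<dots> = f 0 0 * cofactor ?A 0 0" by simp
  also have "mat_delete ?A 0 0 = mat n n (\<lambda>(i, j). f (Suc i) (Suc j))"
    unfolding mat_delete_def by (rule eq_matI) auto
  then have "cofactor ?A 0 0 = fdet n (\<lambda>i j. f (Suc i) (Suc j))"
    unfolding cofactor_def fdet_def by simp
  finally show ?thesis .
qed

lemma fdet_Suc_col:
  assumes "\<And>i. 0 < i \<Longrightarrow> i \<le> n \<Longrightarrow> f i 0 = 0"
  shows "fdet (Suc n) f = f 0 0 * fdet n (\<lambda>i j. f (Suc i) (Suc j))"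
  using fdet_Suc[of n "\<lambda>i j. f j i"] assms fdet_transpose[of "Suc n" f]
    fdet_transpose[of n "\<lambda>i j. f (Suc i) (Suc j)"] by simp

text \<open>Multilinearity in the rows: expanding the product in the Leibniz formula selects one
  summand for every row. It moves sums over tuples and over interlacing families into the
  entries.\<close>

lemma fdet_sum_rows:
  assumes "\<And>i. i < n \<Longrightarrow> finite (A i)"
  shows "fdet n (\<lambda>i j. \<Sum>a\<in>A i. h i a j) = (\<Sum>s\<in>PiE {..<n} A. fdet n (\<lambda>i j. h i (s i) j))"
proof -
  have "fdet n (\<lambda>i j. \<Sum>a\<in>A i. h i a j)
      = (\<Sum>p | p permutes {..<n}. signof p * (\<Sum>s\<in>PiE {..<n} A. \<Prod>i<n. h i (s i) (p i)))"
    unfolding fdet_leibniz using assms by (subst prod_sum_PiE) auto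
  also have "\<dots> = (\<Sum>s\<in>PiE {..<n} A. \<Sum>p | p permutes {..<n}. signof p * (\<Prod>i<n. h i (s i) (p i)))"
    unfolding sum_distrib_left by (rule sum.swap)
  finally show ?thesis unfolding fdet_leibniz .
qed

section \<open>Vandermonde determinants and the Andreief identity for tuples\<close>

definition vand :: "nat \<Rightarrow> (nat \<Rightarrow> real) \<Rightarrow> real" where
  "vand n q = (\<Prod>j<n. \<Prod>i<j. q j - q i)"

lemma vand_Suc_shift: "vand (Suc n) q = (\<Prod>i<n. q (Suc i) - q 0) * vand n (\<lambda>i. q (Suc i))"
proof -
  have "vand (Suc n) q = (\<Prod>j<n. \<Prod>i<Suc j. q (Suc j) - q i)"
    unfolding vand_def by (subst prod.lessThan_Suc_shift) simp
  also have "\<dots> = (\<Prod>j<n. (q (Suc j) - q 0) * (\<Prod>i<j. q (Suc j) - q (Suc i)))"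
    by (subst prod.lessThan_Suc_shift) simp
  finally show ?thesis by (simp add: prod.distrib vand_def)
qed

text \<open>Column j minus \<open>q 0\<close> times column j - 1 clears the first row and leaves the
  factor \<open>q (Suc i) - q 0\<close> in the others.\<close>

lemma fdet_vandermonde: "fdet n (\<lambda>i j. q i ^ j) = vand n q"
proof (induction n arbitrary: q)
  case 0
  then show ?case by (simp add: vand_def)
next
  case (Suc n)
  have "fdet (Suc n) (\<lambda>i j. q i ^ j)
      = fdet (Suc n) (\<lambda>i j. q i ^ j - (if j = 0 then 0 else q 0 * q i ^ (j - 1)))"
    by (rule fdet_col_diff[symmetric])
  also have "\<dots> = fdet n (\<lambda>i j. q (Suc i) ^ Suc j - q 0 * q (Suc i) ^ j)"
    by (subst fdet_Suc) (auto simp: power_eq_if)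
  also have "\<dots> = fdet n (\<lambda>i j. (q (Suc i) - q 0) * q (Suc i) ^ j)"
    by (rule fdet_cong) (simp add: algebra_simps)
  finally show ?case by (simp add: fdet_row_factor Suc.IH vand_Suc_shift)
qed

text \<open>The matrix factors into the Vandermonde matrix and the upper triangular matrix of
  coefficients.\<close>

lemma fdet_poly:
  assumes "\<And>j. j < n \<Longrightarrow> degree (p j) \<le> j"
  shows "fdet n (\<lambda>i j. poly (p j) (q i)) = (\<Prod>j<n. coeff (p j) j) * vand n q"
proof -
  have "fdet n (\<lambda>i j. poly (p j) (q i)) = fdet n (\<lambda>i j. \<Sum>k<n. q i ^ k * coeff (p j) k)"
  proof (rule fdet_cong)
    fix i j assume "i < n" "j < n"
    then have "degree (p j) < n" using assms[of j] by linarith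
    then have "(\<Sum>k<n. q i ^ k * coeff (p j) k) = (\<Sum>k\<le>degree (p j). q i ^ k * coeff (p j) k)"
      by (intro sum.mono_neutral_right) (auto simp: coeff_eq_0)
    then show "poly (p j) (q i) = (\<Sum>k<n. q i ^ k * coeff (p j) k)"
      by (simp add: poly_altdef mult.commute)
  qed
  also have "\<dots> = vand n q * fdet n (\<lambda>k j. coeff (p j) k)"
    by (simp add: fdet_mult fdet_vandermonde)
  also have "fdet n (\<lambda>k j. coeff (p j) k) = (\<Prod>j<n. coeff (p j) j)"
  proof (intro fdet_upper coeff_eq_0)
    fix i j :: nat assume "j < i" "i < n"
    then show "degree (p j) < i" using assms[of j] by linarith
  qed
  finally show ?thesis by simp
qed

text \<open>One determinant is expanded over permutations, and its factors are absorbed, together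
  with the weights, into the rows of the other. Then the sum over the tuple is taken row by
  row.\<close>

lemma andreief_tuples:
  assumes "finite A"
  shows "(\<Sum>s\<in>PiE {..<n} (\<lambda>_. A). (\<Prod>i<n. w (s i)) * fdet n (\<lambda>i j. f j (s i)) * fdet n
      (\<lambda>i j. g j (s i)))
       = fact n * fdet n (\<lambda>i j. \<Sum>a\<in>A. w a * f i a * g j a)"
proof -
  let ?P = "{p. p permutes {..<n}}" and ?S = "PiE {..<n} (\<lambda>_. A)"
  let ?h = "\<lambda>i j. \<Sum>a\<in>A. w a * f i a * g j a"
  have "(\<Sum>s\<in>?S. (\<Prod>i<n. w (s i)) * fdet n (\<lambda>i j. f j (s i)) * fdet n (\<lambda>i j. g j (s i)))
     = (\<Sum>s\<in>?S. \<Sum>p\<in>?P. signof p * fdet n (\<lambda>i j. w (s i) * f (p i) (s i) * g j (s i)))"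
  proof (rule sum.cong[OF refl])
    fix s assume "s \<in> ?S"
    have "(\<Prod>i<n. w (s i)) * fdet n (\<lambda>i j. f j (s i)) * fdet n (\<lambda>i j. g j (s i))
      = (\<Sum>p\<in>?P. signof p * ((\<Prod>i<n. w (s i) * f (p i) (s i)) * fdet n (\<lambda>i j. g j (s i))))"
      unfolding fdet_leibniz[of n "\<lambda>i j. f j (s i)"] sum_distrib_left sum_distrib_right
      by (intro sum.cong refl) (simp add: prod.distrib)
    then show "(\<Prod>i<n. w (s i)) * fdet n (\<lambda>i j. f j (s i)) * fdet n (\<lambda>i j. g j (s i))
      = (\<Sum>p\<in>?P. signof p * fdet n (\<lambda>i j. w (s i) * f (p i) (s i) * g j (s i)))"
      by (simp only: mult.assoc fdet_row_factor prod.distrib)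
  qed
  also have "\<dots> = (\<Sum>p\<in>?P. signof p * (\<Sum>s\<in>?S. fdet n (\<lambda>i j. w (s i) * f (p i) (s i) * g j (s i))))"
    unfolding sum_distrib_left by (rule sum.swap)
  also have "\<dots> = (\<Sum>p\<in>?P. signof p * fdet n (\<lambda>i j. ?h (p i) j))"
    using fdet_sum_rows[of n "\<lambda>_. A" "\<lambda>i a j. w a * f (p i) a * g j a" for p] assms by simp
  \<comment> \<open>Sorting the rows back costs the sign of \<open>p\<close> a second time, so all
    terms agree.\<close>
  also have "\<dots> = (\<Sum>p\<in>?P. fdet n ?h)"
  proof (rule sum.cong[OF refl])
    fix p assume "p \<in> ?P"
    then show "signof p * fdet n (\<lambda>i j. ?h (p i) j) = fdet n ?h"
      using fdet_permute_rows[of p n ?h] by (simp add: sign_def)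
  qed
  also have "\<dots> = fact n * fdet n ?h" by (simp add: card_permutations)
  finally show ?thesis .
qed

section \<open>Discrete Selberg sums\<close>

text \<open>Newton products are monic of degree j for any nodes. This freedom of nodes is what later
  gives the moments a product form.\<close>

lemma fdet_newton: "fdet n (\<lambda>i j. \<Prod>e<j. q i - t e) = vand n q"
proof -
  let ?p = "\<lambda>j. \<Prod>e<j. [:- t e, 1:]"
  have deg: "degree (?p j) = j" for j by (subst degree_prod_eq_sum_degree) auto
  have lc: "coeff (?p j) j = 1" for j
    using lead_coeff_prod[of "\<lambda>e. [:- t e, 1:]" "{..<j}"] by (simp add: deg)
  have "fdet n (\<lambda>i j. poly (?p j) (q i)) = (\<Prod>j<n. coeff (?p j) j) * vand n q"
    by (rule fdet_poly) (simp add: deg)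
  then show ?thesis by (simp add: lc poly_prod)
qed

section \<open>Vandermonde products of finite sets and the Andreief identity for subsets\<close>

definition vset :: "('a :: linorder \<Rightarrow> real) \<Rightarrow> 'a set \<Rightarrow> real" where
  "vset q S = (\<Prod>(a, b) \<in> {(a, b) \<in> S \<times> S. a < b}. q b - q a)"

text \<open>Each unordered pair occurs twice on the right, so the order of the index type
  disappears; this makes the square invariant under arbitrary injective relabelling.\<close>

lemma vset_square:
  assumes "finite S"
  shows "(vset q S)\<^sup>2 = (\<Prod>(a, b) \<in> {(a, b) \<in> S \<times> S. a \<noteq> b}. \<bar>q b - q a\<bar>)"
proof -
  let ?P = "{(a, b) \<in> S \<times> S. a < b}" and ?P' = "{(a, b) \<in> S \<times> S. b < a}"
  have fin: "finite ?P" "finite ?P'"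
    using assms by (auto intro: finite_subset[of _ "S \<times> S"])
  have "{(a, b) \<in> S \<times> S. a \<noteq> b} = ?P \<union> ?P'" by auto
  moreover have "?P \<inter> ?P' = {}" by auto
  ultimately have "(\<Prod>(a, b) \<in> {(a, b) \<in> S \<times> S. a \<noteq> b}. \<bar>q b - q a\<bar>)
      = (\<Prod>(a, b)\<in>?P. \<bar>q b - q a\<bar>) * (\<Prod>(a, b)\<in>?P'. \<bar>q b - q a\<bar>)"
    using fin by (simp add: prod.union_disjoint)
  also have "(\<Prod>(a, b)\<in>?P'. \<bar>q b - q a\<bar>) = (\<Prod>(a, b)\<in>?P. \<bar>q b - q a\<bar>)"
    by (rule prod.reindex_bij_witness[of _ prod.swap prod.swap]) (auto simp: abs_minus_commute)
  also have "(\<Prod>(a, b)\<in>?P. \<bar>q b - q a\<bar>) = \<bar>vset q S\<bar>"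
    by (simp add: vset_def abs_prod case_prod_unfold)
  finally show ?thesis by (simp add: power2_eq_square)
qed

lemma vset_square_image:
  assumes "finite S" "inj_on s S"
  shows "(vset q (s ` S))\<^sup>2 = (vset (q \<circ> s) S)\<^sup>2"
proof -
  have "(\<Prod>(a, b) \<in> {(a, b) \<in> s ` S \<times> s ` S. a \<noteq> b}. \<bar>q b - q a\<bar>)
      = (\<Prod>(a, b) \<in> {(a, b) \<in> S \<times> S. a \<noteq> b}. \<bar>q (s b) - q (s a)\<bar>)"
    by (rule prod.reindex_bij_witness[of _ "map_prod s s" "map_prod (the_inv_into S s)
        (the_inv_into S s)"])
       (use assms(2) in \<open>auto simp: the_inv_into_f_f inj_on_eq_iff\<close>)
  then show ?thesis using assms by (simp add: vset_square)
qed

lemma vset_lessThan: "vset q {..<n} = vand n q"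
proof -
  have "(\<Prod>j<n. \<Prod>i<j. q j - q i) = (\<Prod>(j, i)\<in>(SIGMA j:{..<n}. {..<j}). q j - q i)"
    by (subst prod.Sigma) auto
  also have "\<dots> = vset q {..<n}"
    unfolding vset_def by (rule prod.reindex_bij_witness[of _ prod.swap prod.swap]) auto
  finally show ?thesis by (simp add: vand_def)
qed

lemma vset_image:
  assumes "strict_mono_on S s"
  shows "vset q (s ` S) = vset (q \<circ> s) S"
proof -
  have inj: "inj_on s S" by (rule strict_mono_on_imp_inj_on[OF assms])
  have less: "s a < s b \<longleftrightarrow> a < b" if "a \<in> S" "b \<in> S" for a b
    using that strict_mono_on_less[OF assms] by blast
  show ?thesis unfolding vset_def
    by (rule prod.reindex_bij_witness[of _ "map_prod s s" "map_prod (the_inv_into S s)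
        (the_inv_into S s)"])
       (use inj in \<open>auto simp: the_inv_into_f_f less\<close>)
qed

text \<open>Every n-element subset is the image of exactly n! injective tuples.\<close>

lemma sum_over_inj_images:
  fixes \<Phi> :: "'a set \<Rightarrow> real"
  assumes "finite A"
  shows "(\<Sum>s\<in>{s \<in> PiE {..<n} (\<lambda>_. A). inj_on s {..<n}}. \<Phi> (s ` {..<n}))
       = fact n * (\<Sum>S | S \<subseteq> A \<and> card S = n. \<Phi> S)"
proof -
  let ?I = "\<lambda>B. {s \<in> PiE {..<n} (\<lambda>_. B). inj_on s {..<n}}" and ?\<S> = "{S. S \<subseteq> A \<and> card S = n}"
  have fin: "finite (?I A)" "finite ?\<S>"
    using assms by (auto simp: finite_PiE)
  have "(\<Sum>S\<in>?\<S>. \<Sum>s\<in>{s \<in> ?I A. s ` {..<n} = S}. \<Phi> (s ` {..<n})) = (\<Sum>s\<in>?I A. \<Phi> (s ` {..<n}))"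
    by (rule sum.group[OF fin]) (auto simp: card_image PiE_def)
  also have "(\<Sum>S\<in>?\<S>. \<Sum>s\<in>{s \<in> ?I A. s ` {..<n} = S}. \<Phi> (s ` {..<n})) = (\<Sum>S\<in>?\<S>. fact n * \<Phi> S)"
  proof (rule sum.cong[OF refl])
    fix S assume S: "S \<in> ?\<S>"
    then have finS: "finite S" using assms finite_subset by auto
    have "{s \<in> ?I A. s ` {..<n} = S} = ?I S"
    proof (intro equalityI subsetI)
      fix s assume s: "s \<in> ?I S"
      then have "s ` {..<n} \<subseteq> S" by auto
      then have "s ` {..<n} = S" using s S finS by (intro card_subset_eq) (auto simp: card_image)
      then show "s \<in> {s \<in> ?I A. s ` {..<n} = S}" using s S by (auto simp: PiE_def Pi_def)
    qed (auto simp: PiE_def Pi_def)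
    moreover have "card (?I S) = fact n"
      using card_inj_on_subset_funcset[of "{..<n}" S "{..<n}"] S finS by (simp add: fact_prod_rev)
    moreover have "(\<Sum>s\<in>{s \<in> ?I A. s ` {..<n} = S}. \<Phi> (s ` {..<n}))
        = (\<Sum>s\<in>{s \<in> ?I A. s ` {..<n} = S}. \<Phi> S)"
      by (rule sum.cong) auto
    ultimately show "(\<Sum>s\<in>{s \<in> ?I A. s ` {..<n} = S}. \<Phi> (s ` {..<n})) = fact n * \<Phi> S"
      by (simp only: sum_constant of_nat_fact)
  qed
  finally show ?thesis by (simp add: sum_distrib_left)
qed

text \<open>The two Vandermonde factors of the square are written with independent nodes
  \<open>t\<close> and \<open>u\<close>. Tuples with a repeated entry drop out because their
  Vandermonde product is 0, and the n! of both counts cancels.\<close>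

lemma andreief_subsets:
  fixes q :: "'a :: linorder \<Rightarrow> real"
  assumes "finite A"
  shows "(\<Sum>S | S \<subseteq> A \<and> card S = n. (\<Prod>a\<in>S. w a) * (vset q S)\<^sup>2)
       = fdet n (\<lambda>i j. \<Sum>a\<in>A. w a * (\<Prod>e<i. q a - t e) * (\<Prod>e<j. q a - u e))"
proof -
  let ?S = "PiE {..<n} (\<lambda>_. A)"
  have "fact n * fdet n (\<lambda>i j. \<Sum>a\<in>A. w a * (\<Prod>e<i. q a - t e) * (\<Prod>e<j. q a - u e))
      = (\<Sum>s\<in>?S. (\<Prod>i<n. w (s i)) * vand n (q \<circ> s) * vand n (q \<circ> s))"
    using andreief_tuples[OF assms, of w n "\<lambda>i a. \<Prod>e<i. q a - t e" "\<lambda>i a. \<Prod>e<i. q a - u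
        e", symmetric]
      fdet_newton[of n "q \<circ> s" t for s] fdet_newton[of n "q \<circ> s" u for s] by simp
  also have "\<dots> = (\<Sum>s\<in>{s \<in> ?S. inj_on s {..<n}}. (\<Prod>i<n. w (s i)) * vand n (q \<circ> s) * vand n (q \<circ> s))"
  proof (rule sum.mono_neutral_right)
    show "finite ?S" using assms by (auto intro: finite_PiE)
    show "\<forall>s\<in>?S - {s \<in> ?S. inj_on s {..<n}}. (\<Prod>i<n. w (s i)) * vand n (q \<circ> s) * vand n (q \<circ> s) = 0"
    proof
      fix s assume "s \<in> ?S - {s \<in> ?S. inj_on s {..<n}}"
      then obtain i j where "i < n" "j < n" "i \<noteq> j" "s i = s j" by (auto simp: inj_on_def)
      then obtain i j where ij: "i < j" "j < n" "s i = s j" by (metis linorder_neqE_nat)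
      then have "(\<Prod>i<j. (q \<circ> s) j - (q \<circ> s) i) = 0" by (intro prod_zero bexI[of _ i]) auto
      then have "vand n (q \<circ> s) = 0"
        unfolding vand_def using ij by (intro prod_zero) auto
      then show "(\<Prod>i<n. w (s i)) * vand n (q \<circ> s) * vand n (q \<circ> s) = 0" by simp
    qed
  qed auto
  also have "\<dots> = (\<Sum>s\<in>{s \<in> ?S. inj_on s {..<n}}. (\<Prod>a\<in>s ` {..<n}. w a) * (vset q (s ` {..<n}))\<^sup>2)"
  proof (rule sum.cong[OF refl])
    fix s assume "s \<in> {s \<in> ?S. inj_on s {..<n}}"
    then have inj: "inj_on s {..<n}" by simp
    have "(vset q (s ` {..<n}))\<^sup>2 = vand n (q \<circ> s) * vand n (q \<circ> s)"
      unfolding vset_square_image[OF finite_lessThan inj] vset_lessThan by (rule power2_eq_square)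
    then show "(\<Prod>i<n. w (s i)) * vand n (q \<circ> s) * vand n (q \<circ> s)
        = (\<Prod>a\<in>s ` {..<n}. w a) * (vset q (s ` {..<n}))\<^sup>2"
      by (simp add: prod.reindex[OF inj])
  qed
  also have "\<dots> = fact n * (\<Sum>S | S \<subseteq> A \<and> card S = n. (\<Prod>a\<in>S. w a) * (vset q S)\<^sup>2)"
    by (rule sum_over_inj_images[OF assms])
  finally show ?thesis by simp
qed

text \<open>Subtracting from each column a multiple of its left neighbour clears the first row, and
  what remains is a determinant of the same kind with \<open>M - 1\<close> and \<open>\<beta> + 4\<close>.\<close>

lemma fdet_hankel:
  "\<exists>K. \<forall>M. fdet n (\<lambda>i j. \<Prod>l<i + j. (M - real l) / (\<beta> + 2 * real l))
     = K * (\<Prod>i<n. \<Prod>t<i. (M - real t) * (\<beta> + 2 * M + 2 * real t))" if "\<beta> > 0"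
  using that
proof (induction n arbitrary: \<beta>)
  case 0
  then show ?case by (intro exI[of _ 1]) simp
next
  case (Suc n)
  have "\<beta> + 4 > 0" using Suc.prems by simp
  from Suc.IH[OF this] obtain K where K: "\<And>M. fdet n (\<lambda>i j. \<Prod>l<i + j. (M - real l)
      / (\<beta> + 4 + 2 * real l))
     = K * (\<Prod>i<n. \<Prod>t<i. (M - real t) * (\<beta> + 4 + 2 * M + 2 * real t))"
    by blast
  \<comment> \<open>The factors without \<open>M\<close>: \<open>- (i + 1)\<close> from row i,
    \<open>1 / (\<beta> + 2 j)\<close> from column j, and \<open>1 / (\<beta> (\<beta> + 2))\<close>
    once for each of the n rows.\<close>
  define C where "C = (\<Prod>i<n. - real (Suc i)) * (\<Prod>j<n. 1 / (\<beta> + 2 * real j)) * (1 / (\<beta> * (\<beta> + 2)))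
      ^ n"
  show ?case
  proof (intro exI[of _ "C * K"] allI)
    fix M
    define h where "h = (\<lambda>M \<beta> k. \<Prod>l<k. (M - real l) / (\<beta> + 2 * real l))"
    \<comment> \<open>Splitting off the first numerator factor and the first two denominator factors
      turns (M, \<beta>) into (M - 1, \<beta> + 4).\<close>
    have hS: "h M \<beta> (Suc k) / (\<beta> + 2 * real (Suc k)) = M / (\<beta> * (\<beta> + 2)) * h (M - 1) (\<beta> + 4) k"
        for k
    proof -
      have "(\<Prod>l<k. \<beta> + 2 * real (Suc l)) * (\<beta> + 2 * real (Suc k))
          = (\<Prod>l<Suc k. \<beta> + 2 * real (Suc l))"
        by simp
      also have "\<dots> = (\<beta> + 2) * (\<Prod>l<k. \<beta> + 4 + 2 * real l)"
        by (subst prod.lessThan_Suc_shift) (simp add: algebra_simps)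
      finally have "(\<Prod>l<k. \<beta> + 2 * real (Suc l)) * (\<beta> + 2 * real (Suc k))
          = (\<beta> + 2) * (\<Prod>l<k. \<beta> + 4 + 2 * real l)" .
      moreover have "h M \<beta> (Suc k) = M / \<beta> * ((\<Prod>l<k. M - 1 - real l) / (\<Prod>l<k. \<beta> + 2 * real
          (Suc l)))"
        unfolding h_def by (subst prod.lessThan_Suc_shift) (simp add: prod_dividef algebra_simps)
      ultimately show ?thesis
        by (simp add: h_def prod_dividef divide_divide_eq_left mult.assoc)
    qed
    \<comment> \<open>In the first row, entry j is \<open>?r j\<close> times entry j - 1.\<close>
    let ?r = "\<lambda>j. (M - real (j - 1)) / (\<beta> + 2 * real (j - 1))"
    have "fdet (Suc n) (\<lambda>i j. h M \<beta> (i + j))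
        = fdet (Suc n) (\<lambda>i j. h M \<beta> (i + j) - (if j = 0 then 0 else ?r j * h M \<beta> (i + (j - 1))))"
      by (rule fdet_col_diff[symmetric])
    also have "\<dots> = fdet n (\<lambda>i j. h M \<beta> (Suc i + Suc j) - ?r (Suc j) * h M \<beta> (Suc i + j))"
    proof (subst fdet_Suc)
      fix j assume "0 < j" "j \<le> n"
      then show "h M \<beta> (0 + j) - (if j = 0 then 0 else ?r j * h M \<beta> (0 + (j - 1))) = 0"
        by (cases j) (simp_all add: h_def)
    qed (simp add: h_def)
    also have "\<dots> = fdet n (\<lambda>i j. - real (Suc i) * (1 / (\<beta> + 2 * real j)
        * ((M * (\<beta> + 2 * M)) * (1 / (\<beta> * (\<beta> + 2))) * h (M - 1) (\<beta> + 4) (i + j))))"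
    proof (rule fdet_cong)
      fix i j
      have pos: "\<beta> + 2 * real j > 0" "\<beta> + 2 * real (Suc (i + j)) > 0" using Suc.prems
          by (auto intro: add_pos_nonneg)
      \<comment> \<open>The difference splits into a row factor, a column factor, the global factor
        \<open>\<beta> + 2 M\<close>, and a denominator depending on i + j that \<open>hS\<close>
        absorbs.\<close>
      have "(M - real (Suc (i + j))) / (\<beta> + 2 * real (Suc (i + j))) - ?r (Suc j)
          = - real (Suc i) * (\<beta> + 2 * M) / ((\<beta> + 2 * real (Suc (i + j))) * (\<beta> + 2 * real j))"
        using pos by (simp add: divide_simps) (simp add: algebra_simps)
      moreover have "h M \<beta> (Suc i + Suc j) - ?r (Suc j) * h M \<beta> (Suc i + j)
         = h M \<beta> (Suc (i + j)) * ((M - real (Suc (i + j))) / (\<beta> + 2 * real (Suc (i + j))) - ?r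
             (Suc j))"
      proof -
        have "h M \<beta> (Suc i + Suc j) = h M \<beta> (Suc (i + j)) * ((M - real (Suc (i + j)))
            / (\<beta> + 2 * real (Suc (i + j))))"
          unfolding h_def by simp
        then show ?thesis by (simp only: right_diff_distrib add_Suc mult.commute)
      qed
      ultimately have "h M \<beta> (Suc i + Suc j) - ?r (Suc j) * h M \<beta> (Suc i + j)
        = h M \<beta> (Suc (i + j)) / (\<beta> + 2 * real (Suc (i + j))) * (- real (Suc i) * (\<beta> + 2 * M)
            / (\<beta> + 2 * real j))"
        by simp
      then show "h M \<beta> (Suc i + Suc j) - ?r (Suc j) * h M \<beta> (Suc i + j)
        = - real (Suc i) * (1 / (\<beta> + 2 * real j)
        * ((M * (\<beta> + 2 * M)) * (1 / (\<beta> * (\<beta> + 2))) * h (M - 1) (\<beta> + 4) (i + j)))"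
        unfolding hS by (simp add: mult_ac)
    qed
    also have "\<dots> = C * (M * (\<beta> + 2 * M)) ^ n * fdet n (\<lambda>i j. h (M - 1) (\<beta> + 4) (i + j))"
      unfolding fdet_row_factor fdet_col_factor fdet_row_factor[of n "\<lambda>_. (M * (\<beta> + 2 * M))
          * (1 / (\<beta> * (\<beta> + 2)))"]
      by (simp add: C_def power_mult_distrib power_divide)
    also have "\<dots> = C * (M * (\<beta> + 2 * M)) ^ n * (K * (\<Prod>i<n. \<Prod>t<i. (M - 1 - real t)
        * (\<beta> + 4 + 2 * (M - 1) + 2 * real t)))"
      unfolding h_def K by simp
    also have "\<dots> = C * K * (\<Prod>i<n. M * (\<beta> + 2 * M) * (\<Prod>t<i. (M - 1 - real t) * (\<beta> + 4 + 2 * (M - 1)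
        + 2 * real t)))"
      by (simp add: prod.distrib)
    \<comment> \<open>Under (M, \<beta>) to (M - 1, \<beta> + 4) the quantity \<beta> + 2 M grows by
      2, which is the shift of t by 1.\<close>
    also have "\<dots> = C * K * (\<Prod>i<Suc n. \<Prod>t<i. (M - real t) * (\<beta> + 2 * M + 2 * real t))"
      unfolding prod.lessThan_Suc_shift by (simp add: algebra_simps)
    finally show "fdet (Suc n) (\<lambda>i j. \<Prod>l<i + j. (M - real l) / (\<beta> + 2 * real l))
     = C * K * (\<Prod>i<Suc n. \<Prod>t<i. (M - real t) * (\<beta> + 2 * M + 2 * real t))"
      unfolding h_def .
  qed
qed

section \<open>The one-variable weight, its total mass and its moments\<close>

lemma pochhammer2_Suc: "pochhammer2 x (Suc n) = pochhammer2 x n * (x + 2 * real n)"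
  by (simp add: pochhammer2_def)

lemma pochhammer2_add: "pochhammer2 x (m + n) = pochhammer2 x m * pochhammer2 (x + 2 * real m) n"
  by (induction n) (simp_all add: pochhammer2_Suc pochhammer2_def algebra_simps)

lemma pochhammer2_rec: "pochhammer2 x (Suc n) = x * pochhammer2 (x + 2) n"
  using pochhammer2_add[of x 1 n] by (simp add: pochhammer2_def)

lemma pochhammer2_pos: "x > 0 \<Longrightarrow> pochhammer2 x n > 0"
  unfolding pochhammer2_def by (intro prod_pos) (simp add: add_pos_nonneg)

text \<open>With \<alpha> = 2 a and p = a + s this is 4 v_p^2 times the distances of v_p^2 to all
  fixed dents: the a positions west of the N free ones, and the c = b + z positions east of them
  (see \<open>dist_left_prod\<close> and \<open>dist_right_prod\<close>).\<close>

definition sel_weight :: "nat \<Rightarrow> nat \<Rightarrow> nat \<Rightarrow> nat \<Rightarrow> real" where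
  "sel_weight \<alpha> c N s = (2 * real s + real \<alpha> + 1)\<^sup>2 * pochhammer (real s + 1) \<alpha>
     * pochhammer (real N - real s) c * pochhammer (real N + real \<alpha> + real s + 1) c"

text \<open>The Pochhammer symbol in \<open>s + 1\<close> loses one factor at either end; the other
  factors are unchanged when N and s move together.\<close>

lemma sel_weight_left:
  "sel_weight (\<alpha> + 2) c N s = (real s + 1) * (real s + real \<alpha> + 2) * sel_weight \<alpha> c (Suc N) (Suc s)"
proof -
  have "pochhammer (real s + 1) (Suc (Suc \<alpha>)) = (real s + 1) * pochhammer (real s + 2) \<alpha>
      * (real s + real \<alpha> + 2)"
    by (subst pochhammer_Suc, subst pochhammer_rec) (simp add: algebra_simps)
  then show ?thesis by (simp add: sel_weight_def algebra_simps)
qed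

lemma sel_weight_right:
  "sel_weight \<alpha> (Suc c) N s = (real N - real s) * (real N + real s + real \<alpha> + 1) * sel_weight \<alpha> c
      (Suc N) s"
  by (simp add: sel_weight_def pochhammer_rec algebra_simps)

definition sel_sum :: "nat \<Rightarrow> nat \<Rightarrow> nat \<Rightarrow> real" where
  "sel_sum \<alpha> c N = (\<Sum>s<N. sel_weight \<alpha> c N s)"

text \<open>With \<open>q\<^sub>s = s (s + \<alpha> + 1)\<close>, the factors that raise \<open>\<alpha>\<close> and \<open>c\<close> are \<open>q\<^sub>s\<close> and
  \<open>q\<^sub>N - q\<^sub>s\<close>, whose sum does not depend on \<open>s\<close>.\<close>

lemma sel_sum_rec:
  "sel_sum (\<alpha> + 2) c N + sel_sum \<alpha> (Suc c) N = real N * (real N + real \<alpha> + 1) * sel_sum \<alpha> c (Suc N)"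
proof -
  let ?w = "sel_weight \<alpha> c (Suc N)"
  have "sel_sum (\<alpha> + 2) c N = (\<Sum>s<N. real (Suc s) * (real (Suc s) + real \<alpha> + 1) * ?w (Suc s))"
    unfolding sel_sum_def sel_weight_left by (simp add: algebra_simps)
  also have "\<dots> = (\<Sum>s<Suc N. real s * (real s + real \<alpha> + 1) * ?w s)"
    by (subst sum.lessThan_Suc_shift) simp
  finally have 1: "sel_sum (\<alpha> + 2) c N = (\<Sum>s<Suc N. real s * (real s + real \<alpha> + 1) * ?w s)" .
  have 2: "sel_sum \<alpha> (Suc c) N = (\<Sum>s<Suc N. (real N - real s) * (real N + real s + real \<alpha> + 1)
      * ?w s)"
    unfolding sel_sum_def sel_weight_right by simp
  have 3: "real N * (real N + real \<alpha> + 1) * sel_sum \<alpha> c (Suc N)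
      = (\<Sum>s<Suc N. real N * (real N + real \<alpha> + 1) * ?w s)"
    unfolding sel_sum_def by (rule sum_distrib_left)
  show ?thesis unfolding 1 2 3 sum.distrib[symmetric]
    by (intro sum.cong refl) (simp add: algebra_simps)
qed

text \<open>For c = 0 the right-hand side, divided by \<alpha> + 3, is an antidifference of the
  weight in N that vanishes at N = 0.\<close>

lemma sel_sum_0:
  "(real \<alpha> + 3) * sel_sum \<alpha> 0 N = pochhammer (real N) (Suc \<alpha>) * (2 * real N + real \<alpha> - 1)
      * (2 * real N + real \<alpha> + 1)"
proof (induction N)
  case 0
  then show ?case by (simp add: sel_sum_def pochhammer_rec)
next
  case (Suc N)
  let ?p = "pochhammer (real N + 1) \<alpha>"
  have "pochhammer (real N) (Suc \<alpha>) = real N * ?p" by (rule pochhammer_rec)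
  moreover have "pochhammer (real (Suc N)) (Suc \<alpha>) = ?p * (real N + real \<alpha> + 1)"
    by (simp add: pochhammer_Suc add.commute add.left_commute)
  moreover have "sel_sum \<alpha> 0 (Suc N) = sel_sum \<alpha> 0 N + (2 * real N + real \<alpha> + 1)\<^sup>2 * ?p"
    by (simp add: sel_sum_def sel_weight_def)
  ultimately have "(real \<alpha> + 3) * sel_sum \<alpha> 0 (Suc N)
      = real N * ?p * (2 * real N + real \<alpha> - 1) * (2 * real N + real \<alpha> + 1)
        + (real \<alpha> + 3) * (2 * real N + real \<alpha> + 1)\<^sup>2 * ?p"
    using Suc.IH by (simp add: distrib_left)
  also have "\<dots> = ?p * (real N + real \<alpha> + 1) * (2 * real (Suc N) + real \<alpha> - 1) * (2 * real (Suc N)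
      + real \<alpha> + 1)"
    by (simp add: algebra_simps power2_eq_square)
  also have "?p * (real N + real \<alpha> + 1) = pochhammer (real (Suc N)) (Suc \<alpha>)"
    by (simp add: pochhammer_Suc add.commute add.left_commute)
  finally show ?case .
qed

text \<open>Induction on c with \<alpha> and N free, since \<open>sel_sum_rec\<close> reaches c + 1
  from c at (\<alpha>, N + 1) and at (\<alpha> + 2, N). Both terms share all factors but
  two.\<close>

lemma sel_sum_closed:
  "sel_sum \<alpha> c N = fact c * pochhammer (real N) (\<alpha> + c + 1) * pochhammer2 (2 * real N + real \<alpha>
      - 1) (c + 2)
     / pochhammer2 (real \<alpha> + 3) (c + 1)"
proof (induction c arbitrary: \<alpha> N)
  case 0
  have "pochhammer2 (2 * real N + real \<alpha> - 1) 2 = (2 * real N + real \<alpha> - 1) * (2 * real N + real \<alpha>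
      + 1)"
    by (simp add: pochhammer2_def numeral_2_eq_2)
  moreover have "sel_sum \<alpha> 0 N = pochhammer (real N) (Suc \<alpha>) * (2 * real N + real \<alpha> - 1)
      * (2 * real N + real \<alpha> + 1) / (real \<alpha> + 3)"
    using sel_sum_0[of \<alpha> N] by (simp add: field_simps)
  ultimately show ?case by (simp add: pochhammer2_def)
next
  case (Suc c)
  let ?p = "pochhammer (real N) (\<alpha> + c + 2)" and ?q = "pochhammer2 (2 * real N + real \<alpha> + 1)
      (c + 2)"
    and ?r = "pochhammer2 (real \<alpha> + 3) (c + 1)"
  have pos: "?r > 0" by (rule pochhammer2_pos) simp
  have p1: "pochhammer (real N) (\<alpha> + 2 + c + 1) = ?p * (real N + real \<alpha> + real c + 2)"
    using pochhammer_Suc[of "real N" "\<alpha> + c + 2"] by (simp add: algebra_simps)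
  have p2: "real N * pochhammer (real (Suc N)) (\<alpha> + c + 1) = ?p"
    using pochhammer_rec[of "real N" "\<alpha> + c + 1"] by (simp add: add.commute)
  have q: "pochhammer2 (2 * real N + real \<alpha> - 1) (Suc c + 2) = (2 * real N + real \<alpha> - 1) * ?q"
    using pochhammer2_rec[of "2 * real N + real \<alpha> - 1" "c + 2"] by (simp add: algebra_simps)
  have r1: "pochhammer2 (real \<alpha> + 3) (Suc c + 1) = ?r * (real \<alpha> + 2 * real c + 5)"
    using pochhammer2_Suc[of "real \<alpha> + 3" "c + 1"] by (simp add: algebra_simps)
  have r2: "(real \<alpha> + 3) * pochhammer2 (real (\<alpha> + 2) + 3) (c + 1) = ?r * (real \<alpha> + 2 * real c + 5)"
    using pochhammer2_rec[of "real \<alpha> + 3" "c + 1"] r1 by (simp add: algebra_simps)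
  have r2': "pochhammer2 (real (\<alpha> + 2) + 3) (c + 1) = ?r * (real \<alpha> + 2 * real c + 5) / (real \<alpha> + 3)"
    using r2 by (simp add: field_simps)
  have e1: "sel_sum (\<alpha> + 2) c N = fact c * ?p * ?q / (?r * (real \<alpha> + 2 * real c + 5))
      * ((real N + real \<alpha> + real c + 2) * (real \<alpha> + 3))"
  proof -
    have "2 * real N + real (\<alpha> + 2) - 1 = 2 * real N + real \<alpha> + 1" by simp
    then show ?thesis unfolding Suc.IH p1 r2'
        by (simp only: times_divide_eq_left times_divide_eq_right divide_divide_eq_right mult_ac)
  qed
  have e2: "real N * (real N + real \<alpha> + 1) * sel_sum \<alpha> c (Suc N)
      = fact c * ?p * ?q / (?r * (real \<alpha> + 2 * real c + 5)) * ((real N + real \<alpha> + 1)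
          * (real \<alpha> + 2 * real c + 5))"
  proof -
    have *: "2 * real (Suc N) + real \<alpha> - 1 = 2 * real N + real \<alpha> + 1" by simp
    have nz: "real \<alpha> + 2 * real c + 5 \<noteq> 0" by linarith
    show ?thesis unfolding Suc.IH p2[symmetric] * using pos nz by (simp add: mult_ac)
  qed
  have "sel_sum \<alpha> (Suc c) N = real N * (real N + real \<alpha> + 1) * sel_sum \<alpha> c (Suc N) - sel_sum
      (\<alpha> + 2) c N"
    using sel_sum_rec[of \<alpha> c N] by simp
  also have "\<dots> = fact c * ?p * ?q / (?r * (real \<alpha> + 2 * real c + 5))
      * ((real N + real \<alpha> + 1) * (real \<alpha> + 2 * real c + 5) - (real N + real \<alpha> + real c + 2)
          * (real \<alpha> + 3))"
    unfolding e1 e2 right_diff_distrib ..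
  \<comment> \<open>The bracket factors: c + 1 extends \<open>fact c\<close>, and 2 N + \<alpha> - 1
    is the new first factor of the step-2 product.\<close>
  also have "(real N + real \<alpha> + 1) * (real \<alpha> + 2 * real c + 5) - (real N + real \<alpha> + real c + 2)
      * (real \<alpha> + 3)
      = real (Suc c) * (2 * real N + real \<alpha> - 1)"
    by (simp add: algebra_simps)
  finally have *: "sel_sum \<alpha> (Suc c) N = fact c * ?p * ?q / (?r * (real \<alpha> + 2 * real c + 5))
      * (real (Suc c) * (2 * real N + real \<alpha> - 1))" .
  define P Q R where "P = ?p" and "Q = ?q" and "R = ?r"
  have "fact (Suc c) = real (Suc c) * fact c" by simp
  moreover have e: "\<alpha> + Suc c + 1 = \<alpha> + c + 2" by simp
  ultimately show ?case
    unfolding q r1 * e unfolding P_def[symmetric] Q_def[symmetric] R_def[symmetric]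
    by (simp only: times_divide_eq_left times_divide_eq_right mult_ac)
qed

text \<open>For \<alpha> = 2 a this is v_p^2 at p = a + s. The argument is real so that the nodes N
  - 1 - e used below are not truncated.\<close>

definition sel_pos :: "nat \<Rightarrow> real \<Rightarrow> real" where
  "sel_pos \<alpha> s = (s + (real \<alpha> + 1) / 2)\<^sup>2"

text \<open>In the shifted coordinate s + i, each increase of \<alpha> by 2 costs one Newton factor;
  the nodes are the first i positions.\<close>

lemma sel_weight_left_iter:
  "sel_weight (\<alpha> + 2 * i) c N s
     = (\<Prod>e<i. sel_pos \<alpha> (real (s + i)) - sel_pos \<alpha> (real e)) * sel_weight \<alpha> c (N + i) (s + i)"
proof (induction i arbitrary: N s)
  case (Suc i)
  have "sel_weight (\<alpha> + 2 * Suc i) c N s = sel_weight ((\<alpha> + 2 * i) + 2) c N s" by simp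
  also have "\<dots> = (real s + 1) * (real s + real (\<alpha> + 2 * i) + 2) * sel_weight (\<alpha> + 2 * i) c (Suc N)
      (Suc s)"
    by (rule sel_weight_left)
  also have "\<dots> = (real s + 1) * (real s + real (\<alpha> + 2 * i) + 2) *
     ((\<Prod>e<i. sel_pos \<alpha> (real (Suc s + i)) - sel_pos \<alpha> (real e)) * sel_weight \<alpha> c (Suc N + i)
         (Suc s + i))"
    unfolding Suc.IH ..
  also have "(real s + 1) * (real s + real (\<alpha> + 2 * i) + 2) = sel_pos \<alpha> (real (Suc s + i))
      - sel_pos \<alpha> (real i)"
    unfolding sel_pos_def by (simp add: power2_eq_square field_simps)
  finally show ?case by simp
qed simp

text \<open>Each increase of c by 1 costs one factor; the nodes are the last j of the N + j
  positions.\<close>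

lemma sel_weight_right_iter:
  "sel_weight \<alpha> (c + j) N s
     = (\<Prod>e<j. sel_pos \<alpha> (real (N + j) - 1 - real e) - sel_pos \<alpha> (real s)) * sel_weight \<alpha> c (N + j)
         s"
proof (induction j arbitrary: N)
  case (Suc j)
  have "sel_weight \<alpha> (c + Suc j) N s = (real N - real s) * (real N + real s + real \<alpha> + 1)
      * sel_weight \<alpha> (c + j) (Suc N) s"
    using sel_weight_right[of \<alpha> "c + j" N s] by simp
  also have "\<dots> = (real N - real s) * (real N + real s + real \<alpha> + 1) *
     ((\<Prod>e<j. sel_pos \<alpha> (real (Suc N + j) - 1 - real e) - sel_pos \<alpha> (real s)) * sel_weight \<alpha> c
         (Suc N + j) s)"
    unfolding Suc.IH ..
  also have "(real N - real s) * (real N + real s + real \<alpha> + 1)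
     = sel_pos \<alpha> (real (Suc N + j) - 1 - real j) - sel_pos \<alpha> (real s)"
    unfolding sel_pos_def by (simp add: power2_eq_square field_simps)
  finally show ?case by simp
qed simp

definition sel_moment :: "nat \<Rightarrow> nat \<Rightarrow> nat \<Rightarrow> nat \<Rightarrow> nat \<Rightarrow> real" where
  "sel_moment \<alpha> c N i j = (\<Sum>s<N. sel_weight \<alpha> c N s * (\<Prod>e<i. sel_pos \<alpha> (real s) - sel_pos \<alpha>
      (real e))
     * (\<Prod>e<j. sel_pos \<alpha> (real s) - sel_pos \<alpha> (real N - 1 - real e)))"

text \<open>The Newton factors annihilate the first i and the last j points. On the N' points
  between them, counted from i, they turn the weight into the one for \<alpha> + 2 i and c + j. The
  sign comes from reversing the j differences on the right.\<close>

lemma sel_moment_sum: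
  assumes "N = N' + i + j"
  shows "sel_moment \<alpha> c N i j = (-1) ^ j * sel_sum (\<alpha> + 2 * i) (c + j) N'"
proof -
  let ?l = "\<lambda>s. \<Prod>e<i. sel_pos \<alpha> (real s) - sel_pos \<alpha> (real e)"
  let ?r = "\<lambda>s. \<Prod>e<j. sel_pos \<alpha> (real N - 1 - real e) - sel_pos \<alpha> (real s)"
  have sgn: "(\<Prod>e<j. sel_pos \<alpha> (real s) - sel_pos \<alpha> (real N - 1 - real e)) = (-1) ^ j * ?r s" for s
    using prod.distrib[of "\<lambda>_. -1" "\<lambda>e. sel_pos \<alpha> (real N - 1 - real e) - sel_pos \<alpha> (real s)"
        "{..<j}"] by simp
  have "sel_moment \<alpha> c N i j = (-1) ^ j * (\<Sum>s<N. sel_weight \<alpha> c N s * ?l s * ?r s)"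
    unfolding sel_moment_def sgn sum_distrib_left by (simp add: mult_ac)
  also have "(\<Sum>s<N. sel_weight \<alpha> c N s * ?l s * ?r s) = (\<Sum>s\<in>{i..<i + N'}. sel_weight \<alpha> c N s * ?l
      s * ?r s)"
  proof (rule sum.mono_neutral_right)
    show "\<forall>s\<in>{..<N} - {i..<i + N'}. sel_weight \<alpha> c N s * ?l s * ?r s = 0"
    proof
      fix s assume s: "s \<in> {..<N} - {i..<i + N'}"
      show "sel_weight \<alpha> c N s * ?l s * ?r s = 0"
      proof (cases "s < i")
        case True
        then have "?l s = 0" by (intro prod_zero) auto
        then show ?thesis by simp
      next
        case False
        then have "N - 1 - s < j" "real N - 1 - real (N - 1 - s) = real s" using s assms by auto
        then have "?r s = 0" by (intro prod_zero bexI[of _ "N - 1 - s"]) auto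
        then show ?thesis by simp
      qed
    qed
  qed (use assms in auto)
  also have "\<dots> = (\<Sum>s<N'. sel_weight \<alpha> c N (s + i) * ?l (s + i) * ?r (s + i))"
    by (rule sum.reindex_bij_witness[of _ "\<lambda>s. s + i" "\<lambda>s. s - i"]) auto
  also have "\<dots> = (\<Sum>s<N'. sel_weight (\<alpha> + 2 * i) (c + j) N' s)"
  proof (rule sum.cong[OF refl])
    fix s
    have shift: "sel_pos (\<alpha> + 2 * i) t = sel_pos \<alpha> (t + real i)" for t
      by (simp add: sel_pos_def field_simps)
    have r: "(\<Prod>e<j. sel_pos (\<alpha> + 2 * i) (real (N' + j) - 1 - real e) - sel_pos (\<alpha> + 2 * i)
        (real s)) = ?r (s + i)"
      unfolding shift assms by (intro prod.cong refl arg_cong2[where f = "(-)"] arg_cong[where f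
          = "sel_pos \<alpha>"]) auto
    have "sel_weight (\<alpha> + 2 * i) (c + j) N' s = ?r (s + i) * sel_weight (\<alpha> + 2 * i) c (N' + j) s"
      unfolding sel_weight_right_iter r ..
    also have "sel_weight (\<alpha> + 2 * i) c (N' + j) s = ?l (s + i) * sel_weight \<alpha> c N (s + i)"
      unfolding sel_weight_left_iter assms by (simp add: add_ac)
    finally show "sel_weight \<alpha> c N (s + i) * ?l (s + i) * ?r (s + i) = sel_weight (\<alpha> + 2 * i)
        (c + j) N' s"
      by (simp add: mult_ac)
  qed
  finally show ?thesis unfolding sel_sum_def .
qed

text \<open>Here the nodes from the two ends together cover all N points.\<close>

lemma sel_moment_zero:
  assumes "N < i + j"
  shows "sel_moment \<alpha> c N i j = 0"
  unfolding sel_moment_def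
proof (rule sum.neutral, rule ballI)
  fix s assume s: "s \<in> {..<N}"
  show "sel_weight \<alpha> c N s * (\<Prod>e<i. sel_pos \<alpha> (real s) - sel_pos \<alpha> (real e))
     * (\<Prod>e<j. sel_pos \<alpha> (real s) - sel_pos \<alpha> (real N - 1 - real e)) = 0"
  proof (cases "s < i")
    case True
    then have "(\<Prod>e<i. sel_pos \<alpha> (real s) - sel_pos \<alpha> (real e)) = 0" by (intro prod_zero) auto
    then show ?thesis by simp
  next
    case False
    then have "N - 1 - s < j" "real N - 1 - real (N - 1 - s) = real s" using s assms by auto
    then have "(\<Prod>e<j. sel_pos \<alpha> (real s) - sel_pos \<alpha> (real N - 1 - real e)) = 0"
      by (intro prod_zero bexI[of _ "N - 1 - s"]) auto
    then show ?thesis by simp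
  qed
qed

lemma pochhammer_prod_down: "pochhammer (x - real k) k = (\<Prod>l<k. x - 1 - real l)"
proof (induction k arbitrary: x)
  case (Suc k)
  have "pochhammer (x - real (Suc k)) (Suc k) = (x - real (Suc k)) * pochhammer (x - real k) k"
    unfolding pochhammer_rec by (simp add: algebra_simps)
  then show ?case unfolding Suc.IH by (simp add: algebra_simps)
qed simp

text \<open>A constant, a row factor, a column factor and a term in i + j alone. The last one is the
  entry of \<open>fdet_hankel\<close> with M = N - 1 and \<beta> = \<alpha> + 2 c + 5.\<close>

lemma sel_moment_closed:
  "sel_moment \<alpha> c N i j
     = pochhammer2 (2 * real N + real \<alpha> - 1) (c + 2) / pochhammer2 (real \<alpha> + 3) (c + 1)
       * (pochhammer (real N) (\<alpha> + c + 1 + i) * pochhammer2 (real \<alpha> + 3) i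
       * ((-1) ^ j * fact (c + j) * pochhammer2 (2 * real N + real \<alpha> - 1 - 2 * real j) j
       * (\<Prod>l<i + j. (real N - 1 - real l) / (real \<alpha> + 2 * real c + 5 + 2 * real l))))"
proof (cases "i + j \<le> N")
  case True
  then obtain N' where N: "N = N' + i + j" by (metis add.assoc add.commute le_Suc_ex)
  have "\<alpha> + 2 * i + (c + j) + 1 = (i + j) + (\<alpha> + c + 1 + i)" by simp
  then have "pochhammer (real N') (\<alpha> + 2 * i + (c + j) + 1)
      = pochhammer (real N') (i + j) * pochhammer (real N' + real (i + j)) (\<alpha> + c + 1 + i)"
    by (simp only: pochhammer_product')
  also have "pochhammer (real N') (i + j) = (\<Prod>l<i + j. real N - 1 - real l)"
    using pochhammer_prod_down[of "real N" "i + j"] N by simp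
  also have "real N' + real (i + j) = real N" using N by simp
  finally have p: "pochhammer (real N') (\<alpha> + 2 * i + (c + j) + 1)
      = (\<Prod>l<i + j. real N - 1 - real l) * pochhammer (real N) (\<alpha> + c + 1 + i)" .
  have q1: "2 * real N' + real (\<alpha> + 2 * i) - 1 = 2 * real N + real \<alpha> - 1 - 2 * real j" using N
      by simp
  have cj: "c + j + 2 = j + (c + 2)" by simp
  have q: "pochhammer2 (2 * real N' + real (\<alpha> + 2 * i) - 1) (c + j + 2)
     = pochhammer2 (2 * real N + real \<alpha> - 1 - 2 * real j) j * pochhammer2 (2 * real N + real \<alpha>
         - 1) (c + 2)"
    unfolding q1 cj pochhammer2_add[of _ j "c + 2"] by simp
  let ?a = "pochhammer2 (real \<alpha> + 3)" and ?b = "pochhammer2 (real \<alpha> + 2 * real c + 5) (i + j)"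
  have "?a i * pochhammer2 (real (\<alpha> + 2 * i) + 3) (c + j + 1) = ?a (i + (c + j + 1))"
    unfolding pochhammer2_add by (simp add: algebra_simps)
  also have "i + (c + j + 1) = (c + 1) + (i + j)" by simp
  also have "?a \<dots> = ?a (c + 1) * ?b"
    unfolding pochhammer2_add by (simp add: algebra_simps)
  finally have r: "?a i * pochhammer2 (real (\<alpha> + 2 * i) + 3) (c + j + 1) = ?a (c + 1) * ?b" .
  have nz: "?a i \<noteq> 0" "?a (c + 1) \<noteq> 0" "?b \<noteq> 0" "pochhammer2 (real (\<alpha> + 2 * i) + 3) (c + j + 1) \<noteq> 0"
    by (metis pochhammer2_pos less_numeral_extra(3) add_nonneg_pos of_nat_0_le_iff
        zero_less_numeral mult_nonneg_nonneg zero_le_numeral add_nonneg_nonneg)+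
  have r': "1 / pochhammer2 (real (\<alpha> + 2 * i) + 3) (c + j + 1) = ?a i / (?a (c + 1) * ?b)"
    using nz r by (simp add: field_simps)
  have h: "(\<Prod>l<i + j. (real N - 1 - real l) / (real \<alpha> + 2 * real c + 5 + 2 * real l))
     = (\<Prod>l<i + j. real N - 1 - real l) / ?b"
    by (simp add: prod_dividef pochhammer2_def)
  define X Y where "X = ?a i / (?a (c + 1) * ?b)" and "Y = (\<Prod>l<i + j. real N - 1 - real l)"
  have "sel_moment \<alpha> c N i j = (-1) ^ j * (fact (c + j) * (Y * pochhammer (real N) (\<alpha> + c + 1 + i))
     * (pochhammer2 (2 * real N + real \<alpha> - 1 - 2 * real j) j * pochhammer2 (2 * real N + real \<alpha>
         - 1) (c + 2)) * X)"
    unfolding sel_moment_sum[OF N] sel_sum_closed p q X_def Y_def r'[symmetric] by simp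
  then show ?thesis unfolding h Y_def[symmetric] X_def by (simp add: mult_ac)
next
  case False
  then have z: "sel_moment \<alpha> c N i j = 0" by (intro sel_moment_zero) simp
  show ?thesis
  \<comment> \<open>For N > 0 the Hankel product has the zero factor l = N - 1. For N = 0 it does
    not vanish, but the Pochhammer symbol at 0 does.\<close>
  proof (cases N)
    case 0
    then have "pochhammer (real N) (\<alpha> + c + 1 + i) = 0" by (simp add: pochhammer_rec)
    then show ?thesis unfolding z by simp
  next
    case (Suc N')
    then have "(\<Prod>l<i + j. (real N - 1 - real l) / (real \<alpha> + 2 * real c + 5 + 2 * real l)) = 0"
      using False by (intro prod_zero bexI[of _ N']) auto
    then show ?thesis unfolding z by simp
  qed
qed

text \<open>In reverse order the i-th factor of T is a Pochhammer symbol of length n + 1 + 2 i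
  starting at x - i; it is split at x. Later x is N.\<close>

lemma T_reindex:
  "T (x - real y + 1) (n + 2 * y - 1) y = (\<Prod>i<y. pochhammer x (n + 1 + i)) * (\<Prod>i<y. \<Prod>t<i. x - 1
      - real t)"
proof -
  have "T (x - real y + 1) (n + 2 * y - 1) y = (\<Prod>i<y. pochhammer (x - real (y - Suc i))
      (n + 1 + 2 * (y - Suc i)))"
    unfolding T_def
  proof (rule prod.cong[OF refl])
    fix i assume "i \<in> {..<y}"
    then have "x - real y + 1 + real i = x - real (y - Suc i)" "n + 2 * y - 1 - 2 * i
        = n + 1 + 2 * (y - Suc i)" by auto
    then show "pochhammer (x - real y + 1 + real i) (n + 2 * y - 1 - 2 * i)
        = pochhammer (x - real (y - Suc i)) (n + 1 + 2 * (y - Suc i))"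
      by (simp only:)
  qed
  also have "\<dots> = (\<Prod>i<y. pochhammer (x - real i) (n + 1 + 2 * i))"
    by (rule prod.nat_diff_reindex)
  also have "\<dots> = (\<Prod>i<y. pochhammer x (n + 1 + i) * (\<Prod>t<i. x - 1 - real t))"
  proof (rule prod.cong[OF refl])
    fix i
    have "n + 1 + 2 * i = i + (n + 1 + i)" by simp
    then show "pochhammer (x - real i) (n + 1 + 2 * i) = pochhammer x (n + 1 + i)
        * (\<Prod>t<i. x - 1 - real t)"
      by (simp only: pochhammer_product' pochhammer_prod_down) simp
  qed
  finally show ?thesis by (simp add: prod.distrib)
qed

text \<open>As for T, but with step 2 and a split into three pieces of lengths i, c + 2 and i. The
  middle piece does not depend on i.\<close>

lemma V_reindex:
  "V (x - 2 * real y + 2) (c + 2 * y) y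
     = (\<Prod>i<y. pochhammer2 (x - 2 * real i) i) * pochhammer2 x (c + 2) ^ y * (\<Prod>i<y. \<Prod>t<i. x + 2
         * real c + 4 + 2 * real t)"
proof -
  have "V (x - 2 * real y + 2) (c + 2 * y) y = (\<Prod>i<y. pochhammer2 (x - 2 * real (y - Suc i))
      (c + 2 + 2 * (y - Suc i)))"
    unfolding V_def
  proof (rule prod.cong[OF refl])
    fix i assume "i \<in> {..<y}"
    then have "x - 2 * real y + 2 + 2 * real i = x - 2 * real (y - Suc i)" "c + 2 * y - 2 * i
        = c + 2 + 2 * (y - Suc i)" by auto
    then show "pochhammer2 (x - 2 * real y + 2 + 2 * real i) (c + 2 * y - 2 * i)
        = pochhammer2 (x - 2 * real (y - Suc i)) (c + 2 + 2 * (y - Suc i))"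
      by (simp only:)
  qed
  also have "\<dots> = (\<Prod>i<y. pochhammer2 (x - 2 * real i) (c + 2 + 2 * i))"
    by (rule prod.nat_diff_reindex)
  also have "\<dots> = (\<Prod>i<y. pochhammer2 (x - 2 * real i) i * pochhammer2 x (c + 2)
      * (\<Prod>t<i. x + 2 * real c + 4 + 2 * real t))"
  proof (rule prod.cong[OF refl])
    fix i
    have ci: "c + 2 + 2 * i = i + ((c + 2) + i)" by simp
    have "pochhammer2 (x - 2 * real i) (c + 2 + 2 * i)
        = pochhammer2 (x - 2 * real i) i * (pochhammer2 x (c + 2) * pochhammer2
            (x + 2 * real (c + 2)) i)"
      unfolding ci pochhammer2_add[of _ i "(c + 2) + i"]
      by (simp only: diff_add_cancel pochhammer2_add[of x "c + 2" i])
    also have "pochhammer2 (x + 2 * real (c + 2)) i = (\<Prod>t<i. x + 2 * real c + 4 + 2 * real t)"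
      by (simp add: pochhammer2_def algebra_simps)
    finally show "pochhammer2 (x - 2 * real i) (c + 2 + 2 * i)
        = pochhammer2 (x - 2 * real i) i * pochhammer2 x (c + 2) * (\<Prod>t<i. x + 2 * real c + 4 + 2
            * real t)"
      by simp
  qed
  finally show ?thesis by (simp add: prod.distrib)
qed

text \<open>After row and column factors are removed from the moment determinant,
  \<open>fdet_hankel\<close> applies, and what depends on N regroups into one T and one V. K stays
  implicit because only the ratio of two values of N is needed.\<close>

lemma discrete_selberg:
  "\<exists>K. \<forall>N. (\<Sum>S | S \<subseteq> {..<N} \<and> card S = y. (\<Prod>s\<in>S. sel_weight \<alpha> c N s)
      * (vset (\<lambda>s. sel_pos \<alpha> (real s)) S)\<^sup>2)
     = K * (T (real N - real y + 1) (\<alpha> + c + 2 * y - 1) y * V (2 * real N - 2 * real y + real \<alpha>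
         + 1) (c + 2 * y) y)"
proof -
  let ?\<beta> = "real \<alpha> + 2 * real c + 5"
  have "?\<beta> > 0" by (simp add: add_nonneg_pos)
  from fdet_hankel[OF this, of y] obtain K where
    K: "\<And>M. fdet y (\<lambda>i j. \<Prod>l<i + j. (M - real l) / (?\<beta> + 2 * real l))
       = K * (\<Prod>i<y. \<Prod>t<i. (M - real t) * (?\<beta> + 2 * M + 2 * real t))" by blast
  define C where "C = (1 / pochhammer2 (real \<alpha> + 3) (c + 1)) ^ y * (\<Prod>i<y. pochhammer2 (real \<alpha> + 3)
      i)
     * (\<Prod>j<y. (-1) ^ j * fact (c + j)) * K"
  show ?thesis
  proof (intro exI[of _ C] allI)
    fix N
    let ?x = "2 * real N + real \<alpha> - 1"
    have "(\<Sum>S | S \<subseteq> {..<N} \<and> card S = y. (\<Prod>s\<in>S. sel_weight \<alpha> c N s)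
        * (vset (\<lambda>s. sel_pos \<alpha> (real s)) S)\<^sup>2)
        = fdet y (sel_moment \<alpha> c N)"
      unfolding sel_moment_def by (rule andreief_subsets) simp
    also have "\<dots> = fdet y (\<lambda>i j. (pochhammer2 ?x (c + 2) / pochhammer2 (real \<alpha> + 3) (c + 1))
       * ((pochhammer (real N) (\<alpha> + c + 1 + i) * pochhammer2 (real \<alpha> + 3) i)
       * (((-1) ^ j * fact (c + j) * pochhammer2 (?x - 2 * real j) j)
       * (\<Prod>l<i + j. (real N - 1 - real l) / (?\<beta> + 2 * real l)))))"
      by (rule fdet_cong) (simp add: sel_moment_closed mult_ac)
    also have "\<dots> = (\<Prod>i<y. pochhammer2 ?x (c + 2) / pochhammer2 (real \<alpha> + 3) (c + 1))
       * ((\<Prod>i<y. pochhammer (real N) (\<alpha> + c + 1 + i) * pochhammer2 (real \<alpha> + 3) i)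
       * ((\<Prod>j<y. (-1) ^ j * fact (c + j) * pochhammer2 (?x - 2 * real j) j)
       * (K * (\<Prod>i<y. \<Prod>t<i. (real N - 1 - real t) * (?\<beta> + 2 * (real N - 1) + 2 * real t)))))"
      unfolding fdet_row_factor[of y "\<lambda>_. pochhammer2 ?x (c + 2) / pochhammer2 (real \<alpha> + 3)
          (c + 1)"]
        fdet_row_factor[of y "\<lambda>i. pochhammer (real N) (\<alpha> + c + 1 + i) * pochhammer2 (real \<alpha> + 3) i"]
        fdet_col_factor K ..
    also have "\<dots> = C * (((\<Prod>i<y. pochhammer (real N) (\<alpha> + c + 1 + i)) * (\<Prod>i<y. \<Prod>t<i. real N - 1
        - real t))
       * ((\<Prod>i<y. pochhammer2 (?x - 2 * real i) i) * pochhammer2 ?x (c + 2) ^ y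
          * (\<Prod>i<y. \<Prod>t<i. ?\<beta> + 2 * (real N - 1) + 2 * real t)))"
      unfolding C_def by (simp add: prod.distrib prod_dividef power_divide mult_ac)
    \<comment> \<open>With M = N - 1 the second Hankel factor becomes the last piece of
      \<open>V_reindex\<close>.\<close>
    also have "(\<Prod>i<y. \<Prod>t<i. ?\<beta> + 2 * (real N - 1) + 2 * real t)
        = (\<Prod>i<y. \<Prod>t<i. ?x + 2 * real c + 4 + 2 * real t)"
      by (intro prod.cong refl) simp
    finally show "(\<Sum>S | S \<subseteq> {..<N} \<and> card S = y. (\<Prod>s\<in>S. sel_weight \<alpha> c N s)
        * (vset (\<lambda>s. sel_pos \<alpha> (real s)) S)\<^sup>2)
     = C * (T (real N - real y + 1) (\<alpha> + c + 2 * y - 1) y * V (2 * real N - 2 * real y + real \<alpha>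
         + 1) (c + 2 * y) y)"
      using T_reindex[of "real N" y "\<alpha> + c"] V_reindex[of ?x y c]
      by (simp add: algebra_simps)
  qed
qed

section \<open>Tilings\<close>

text \<open>The shared edge is the base, the eastern side or the western side of the up-pointing
  triangle, in this order.\<close>

lemma lozenge_iff:
  "lozenge l \<longleftrightarrow> (\<exists>p k. l = {Up p k, Down p k} \<or> l = {Up p k, Down p (k + 1)} \<or> l
      = {Up p k, Down (p - 1) (k + 1)})"
proof
  assume "lozenge l"
  then obtain f g where fg: "f \<noteq> g" "card (verts f \<inter> verts g) = 2" "l = {f, g}"
    unfolding lozenge_def by blast
  then obtain a b where ab: "a \<noteq> b" "a \<in> verts f" "b \<in> verts f" "a \<in> verts g" "b \<in> verts g"
  proof -
    from fg(2) obtain a b where "a \<noteq> b" "verts f \<inter> verts g = {a, b}" unfolding card_2_iff by blast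
    then show thesis using that[of a b] by blast
  qed
  show "\<exists>p k. l = {Up p k, Down p k} \<or> l = {Up p k, Down p (k + 1)} \<or> l
      = {Up p k, Down (p - 1) (k + 1)}"
  proof (cases f; cases g)
    fix p k p' k' assume "f = Up p k" "g = Up p' k'"
    then show ?thesis using ab fg by auto
  next
    fix p k p' k' assume "f = Down p k" "g = Down p' k'"
    then show ?thesis using ab fg by auto
  next
    fix p k p' k' assume *: "f = Up p k" "g = Down p' k'"
    then have "(p' = p \<and> k' = k) \<or> (p' = p \<and> k' = k + 1) \<or> (p' = p - 1 \<and> k' = k + 1)"
      using ab by auto
    then show ?thesis using * fg(3) by blast
  next
    fix p k p' k' assume *: "f = Down p' k'" "g = Up p k"
    then have "(p' = p \<and> k' = k) \<or> (p' = p \<and> k' = k + 1) \<or> (p' = p - 1 \<and> k' = k + 1)"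
      using ab by auto
    then show ?thesis using * fg(3) by blast
  qed
next
  assume "\<exists>p k. l = {Up p k, Down p k} \<or> l = {Up p k, Down p (k + 1)} \<or> l
      = {Up p k, Down (p - 1) (k + 1)}"
  then obtain p k where l: "l = {Up p k, Down p k} \<or> l = {Up p k, Down p (k + 1)} \<or> l
      = {Up p k, Down (p - 1) (k + 1)}"
    by blast
  have "verts (Up p k) \<inter> verts (Down p k) = {(p, k), (p + 1, k)}"
    "verts (Up p k) \<inter> verts (Down p (k + 1)) = {(p + 1, k), (p, k + 1)}"
    "verts (Up p k) \<inter> verts (Down (p - 1) (k + 1)) = {(p, k), (p, k + 1)}" by auto
  then have "card (verts (Up p k) \<inter> verts (Down p k)) = 2"
    "card (verts (Up p k) \<inter> verts (Down p (k + 1))) = 2"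
    "card (verts (Up p k) \<inter> verts (Down (p - 1) (k + 1))) = 2" by auto
  moreover have "Up p k \<noteq> Down p' k'" for p' k' by simp
  ultimately show "lozenge l" unfolding lozenge_def using l by blast
qed

lemma lozenge_Up: "lozenge {Up p k, f} \<longleftrightarrow> f = Down p k \<or> f = Down p (k + 1) \<or> f
    = Down (p - 1) (k + 1)"
  unfolding lozenge_iff by (auto simp: doubleton_eq_iff)

lemma lozenge_Down: "lozenge {Down p k, f} \<longleftrightarrow> f = Up p k \<or> f = Up p (k - 1) \<or> f = Up (p + 1) (k - 1)"
proof (cases f)
  case (Up p' k')
  have "lozenge {Down p k, f} \<longleftrightarrow> lozenge {Up p' k', Down p k}" by (simp add: Up insert_commute)
  then show ?thesis unfolding lozenge_Up Up by auto
qed (auto simp: lozenge_iff doubleton_eq_iff)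

lemma lozenge_nonempty: "lozenge l \<Longrightarrow> l \<noteq> {}"
  by (auto simp: lozenge_def)

lemma lozenge_other:
  assumes "lozenge l" "f \<in> l"
  obtains g where "l = {f, g}" "f \<noteq> g"
  using assms unfolding lozenge_def by blast

lemma tilings_iff:
  "\<T> \<in> tilings R \<longleftrightarrow> \<Union>\<T> = R \<and> (\<forall>l\<in>\<T>. lozenge l) \<and> (\<forall>l\<in>\<T>. \<forall>l'\<in>\<T>. l \<noteq> l' \<longrightarrow> l \<inter> l' = {})"
  unfolding tilings_def partition_on_def disjoint_def using lozenge_nonempty by auto

lemma tilingsD:
  assumes "\<T> \<in> tilings R"
  shows "\<Union>\<T> = R" "\<And>l. l \<in> \<T> \<Longrightarrow> lozenge l"
    "\<And>l l'. l \<in> \<T> \<Longrightarrow> l' \<in> \<T> \<Longrightarrow> l \<noteq> l' \<Longrightarrow> l \<inter> l' = {}"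
  using assms by (auto simp: tilings_iff)

lemma finite_tiling: "finite R \<Longrightarrow> \<T> \<in> tilings R \<Longrightarrow> finite \<T>"
  unfolding tilings_iff by (metis finite_UnionD)

lemma finite_tilings: "finite R \<Longrightarrow> finite (tilings R)"
  by (rule finite_subset[of _ "Pow (Pow R)"]) (auto simp: tilings_iff)

lemma M_empty [simp]: "M ({}, w) = 1"
proof -
  have "tilings {} = {{}}"
  proof (intro equalityI subsetI)
    fix \<T> :: "face set set" assume T: "\<T> \<in> tilings {}"
    have False if "l \<in> \<T>" for l
    proof -
      have "l = {}" "lozenge l" using T that by (auto simp: tilings_iff)
      then show False using lozenge_nonempty by blast
    qed
    then show "\<T> \<in> {{}}" by auto
  qed (simp add: tilings_iff)
  then show ?thesis by (simp add: M_def)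
qed

lemma M_isolated:
  assumes "f \<in> R" "\<And>g. g \<in> R \<Longrightarrow> \<not> lozenge {f, g}"
  shows "M (R, w) = 0"
proof -
  have "tilings R = {}"
  proof (rule ccontr)
    assume "tilings R \<noteq> {}"
    then obtain \<T> where T: "\<T> \<in> tilings R" by blast
    then obtain l where l: "l \<in> \<T>" "f \<in> l" using assms(1) by (auto simp: tilings_iff)
    then obtain g where "l = {f, g}" using T by (auto simp: tilings_iff elim: lozenge_other)
    then show False using assms(2)[of g] l T by (auto simp: tilings_iff)
  qed
  then show ?thesis by (simp add: M_def)
qed

text \<open>A face with a single possible partner lies in the same lozenge in every tiling, so this
  lozenge can be split off.\<close>

lemma M_forced:
  assumes "finite R" "f \<in> R" "g \<in> R" "lozenge {f, g}" "\<And>h. h \<in> R \<Longrightarrow> lozenge {f, h} \<Longrightarrow> h = g"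
  shows "M (R, w) = w {f, g} * M (R - {f, g}, w)"
proof -
  let ?l = "{f, g}"
  have notin: "?l \<notin> \<T>" if "\<T> \<in> tilings (R - ?l)" for \<T>
    using that by (auto simp: tilings_iff)
  have "tilings R = insert ?l ` tilings (R - ?l)"
  proof (intro equalityI subsetI)
    fix \<T> assume T: "\<T> \<in> tilings R"
    then obtain l where l: "l \<in> \<T>" "f \<in> l" using assms(2) by (auto simp: tilings_iff)
    then obtain h where h: "l = {f, h}" using T by (auto simp: tilings_iff elim: lozenge_other)
    then have "h \<in> R" "lozenge {f, h}" using T l by (auto simp: tilings_iff)
    then have "l = ?l" using assms(5) h by simp
    then have lT: "?l \<in> \<T>" using l by simp
    have dis: "l' \<inter> ?l = {}" if "l' \<in> \<T>" "l' \<noteq> ?l" for l'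
      by (rule tilingsD(3)[OF T that(1) lT that(2)])
    have "\<Union>(\<T> - {?l}) = R - ?l"
    proof
      show "\<Union>(\<T> - {?l}) \<subseteq> R - ?l" using dis tilingsD(1)[OF T] by blast
      show "R - ?l \<subseteq> \<Union>(\<T> - {?l})" using tilingsD(1)[OF T] by blast
    qed
    then have "\<T> - {?l} \<in> tilings (R - ?l)"
      using T by (simp add: tilings_iff)
    moreover have "\<T> = insert ?l (\<T> - {?l})" using lT by blast
    ultimately show "\<T> \<in> insert ?l ` tilings (R - ?l)" by blast
  next
    fix \<T> assume "\<T> \<in> insert ?l ` tilings (R - ?l)"
    then obtain \<T>' where T': "\<T>' \<in> tilings (R - ?l)" "\<T> = insert ?l \<T>'" by blast
    have U: "\<Union>\<T>' = R - ?l" using T' by (simp add: tilings_iff)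
    have dis: "l' \<inter> ?l = {}" if "l' \<in> \<T>'" for l' using U that by blast
    have "\<Union>\<T> = R" using T' U assms(2,3) by auto
    moreover have "\<forall>l\<in>\<T>. lozenge l" using T' assms(4) by (auto simp: tilings_iff)
    moreover have "\<forall>l\<in>\<T>. \<forall>l'\<in>\<T>. l \<noteq> l' \<longrightarrow> l \<inter> l' = {}"
    proof (intro ballI impI)
      fix l l' assume "l \<in> \<T>" "l' \<in> \<T>" "l \<noteq> l'"
      then consider "l \<in> \<T>'" "l' \<in> \<T>'" | "l = ?l" "l' \<in> \<T>'" | "l' = ?l" "l \<in> \<T>'"
        unfolding T'(2) by blast
      then show "l \<inter> l' = {}"
        using tilingsD(3)[OF T'(1)] dis \<open>l \<noteq> l'\<close> by cases (simp_all add: Int_commute)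
    qed
    ultimately show "\<T> \<in> tilings R" by (simp add: tilings_iff)
  qed
  moreover have "inj_on (insert ?l) (tilings (R - ?l))"
    using notin by (intro inj_onI) (metis insert_ident)
  ultimately have "M (R, w) = (\<Sum>\<T>\<in>tilings (R - ?l). \<Prod>l\<in>insert ?l \<T>. w l)"
    by (simp add: M_def sum.reindex)
  also have "\<dots> = (\<Sum>\<T>\<in>tilings (R - ?l). w ?l * (\<Prod>l\<in>\<T>. w l))"
    using notin finite_tiling[of "R - ?l"] assms(1) by (intro sum.cong refl prod.insert) auto
  finally show ?thesis by (simp add: M_def sum_distrib_left)
qed

text \<open>Row k lies between the heights k and k + 1. \<open>Down p k\<close> hangs below its side
  at height k, hence the offset.\<close>

fun face_row :: "face \<Rightarrow> int" where
  "face_row (Up p k) = k"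
| "face_row (Down p k) = k - 1"

lemma row_lozenge:
  assumes "lozenge l" "f \<in> l" "g \<in> l" "face_row f < k" "k \<le> face_row g"
  shows "\<exists>p. l = {Up p k, Down p k}"
proof -
  from assms(1) obtain p j where "l = {Up p j, Down p j} \<or> l = {Up p j, Down p (j + 1)} \<or> l
      = {Up p j, Down (p - 1) (j + 1)}"
    unfolding lozenge_iff by blast
  then show ?thesis
  proof (elim disjE)
    assume l: "l = {Up p j, Down p j}"
    then have "face_row f < k \<longrightarrow> k \<le> face_row g \<longrightarrow> j = k" using assms(2,3) by auto
    then show ?thesis using l assms(4,5) by blast
  qed (use assms in auto)
qed

text \<open>Only vertical lozenges centred at height k meet both sides. A tiling is therefore the
  set X of these lozenges together with a tiling of each side from which their halves are removed,
  and weights multiply.\<close>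

lemma M_cut:
  assumes fin: "finite R"
  shows "M (R, w) = (\<Sum>X | X \<subseteq> {p. Up p k \<in> R \<and> Down p k \<in> R}.
      (\<Prod>p\<in>X. w {Up p k, Down p k})
        * M ({f \<in> R. face_row f < k} - (\<lambda>p. Down p k) ` X, w)
            * M ({f \<in> R. k \<le> face_row f} - (\<lambda>p. Up p k) ` X, w))"
proof -
  let ?V = "\<lambda>p. {Up p k, Down p k}"
  let ?C = "{p. Up p k \<in> R \<and> Down p k \<in> R}"
  let ?L = "\<lambda>X. {f \<in> R. face_row f < k} - (\<lambda>p. Down p k) ` X" and ?G
      = "\<lambda>X. {f \<in> R. k \<le> face_row f} - (\<lambda>p. Up p k) ` X"
  let ?I = "SIGMA X:Pow ?C. tilings (?L X) \<times> tilings (?G X)"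
  have "finite ((\<lambda>p. Up p k) ` ?C)" by (rule finite_subset[OF _ fin]) auto
  then have finC: "finite ?C" by (rule finite_imageD) (auto simp: inj_on_def)
  have loz: "lozenge (?V p)" for p by (auto simp: lozenge_iff)
  have step1: "M (R, w) = (\<Sum>(X, \<T>1, \<T>2)\<in>?I. \<Prod>l\<in>?V ` X \<union> \<T>1 \<union> \<T>2. w l)"
    unfolding M_def prod.case
  proof (rule sum.reindex_bij_witness[of _ "\<lambda>(X, \<T>1, \<T>2). ?V ` X \<union> \<T>1 \<union> \<T>2"
        "\<lambda>\<T>. ({p. ?V p \<in> \<T>}, {l \<in> \<T>. \<forall>f\<in>l. face_row f < k}, {l \<in> \<T>. \<forall>f\<in>l. k \<le> face_row f})"])
    fix \<T> assume T: "\<T> \<in> tilings R"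
    have split: "(\<exists>p. l = ?V p) \<or> (\<forall>f\<in>l. face_row f < k) \<or> (\<forall>f\<in>l. k \<le> face_row f)" if "l \<in> \<T>" for l
      using row_lozenge[OF tilingsD(2)[OF T that], of _ _ k] by (metis not_less)
    note U = tilingsD(1)[OF T] and lz = tilingsD(2)[OF T] and dj = tilingsD(3)[OF T]
    let ?X = "{p. ?V p \<in> \<T>}" and ?T1 = "{l \<in> \<T>. \<forall>f\<in>l. face_row f < k}" and ?T2
        = "{l \<in> \<T>. \<forall>f\<in>l. k \<le> face_row f}"
    have eq: "?V ` ?X \<union> ?T1 \<union> ?T2 = \<T>" using split by auto
    then show "(case (?X, ?T1, ?T2) of (X, \<T>1, \<T>2) \<Rightarrow> ?V ` X \<union> \<T>1 \<union> \<T>2) = \<T>" by simp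
    then show "(case (?X, ?T1, ?T2) of (X, \<T>1, \<T>2) \<Rightarrow> prod w (?V ` X \<union> \<T>1 \<union> \<T>2)) = prod w \<T>" by simp
    have "?X \<subseteq> ?C" using U by blast
    moreover have "?T1 \<in> tilings (?L ?X)"
    proof -
      have "\<Union>?T1 = ?L ?X"
      proof (intro equalityI subsetI)
        fix f assume "f \<in> \<Union>?T1"
        then obtain l where l: "l \<in> ?T1" "f \<in> l" by blast
        have "f \<noteq> Down p k" if "?V p \<in> \<T>" for p
        proof
          assume "f = Down p k"
          then have "l = ?V p" using dj[of l "?V p"] l that by blast
          then show False using l by auto
        qed
        then show "f \<in> ?L ?X" using l U by auto
      next
        fix f assume f: "f \<in> ?L ?X"
        then obtain l where l: "l \<in> \<T>" "f \<in> l" using U by blast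
        have "l \<noteq> ?V p" for p using f l by auto
        then have "l \<in> ?T1" using split[OF l(1)] f l by auto
        then show "f \<in> \<Union>?T1" using l by blast
      qed
      then show ?thesis using lz dj by (simp add: tilings_iff)
    qed
    moreover have "?T2 \<in> tilings (?G ?X)"
    proof -
      have "\<Union>?T2 = ?G ?X"
      proof (intro equalityI subsetI)
        fix f assume "f \<in> \<Union>?T2"
        then obtain l where l: "l \<in> ?T2" "f \<in> l" by blast
        have "f \<noteq> Up p k" if "?V p \<in> \<T>" for p
        proof
          assume "f = Up p k"
          then have "l = ?V p" using dj[of l "?V p"] l that by blast
          then show False using l by auto
        qed
        then show "f \<in> ?G ?X" using l U by auto
      next
        fix f assume f: "f \<in> ?G ?X"
        then obtain l where l: "l \<in> \<T>" "f \<in> l" using U by blast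
        have "l \<noteq> ?V p" for p using f l by auto
        then have "l \<in> ?T2" using split[OF l(1)] f l by auto
        then show "f \<in> \<Union>?T2" using l by blast
      qed
      then show ?thesis using lz dj by (simp add: tilings_iff)
    qed
    ultimately show "(?X, ?T1, ?T2) \<in> ?I" by simp
  next
    fix t assume "t \<in> ?I"
    then obtain X \<T>1 \<T>2 where t: "t = (X, \<T>1, \<T>2)" and X: "X \<subseteq> ?C"
      and T1: "\<T>1 \<in> tilings (?L X)" and T2: "\<T>2 \<in> tilings (?G X)" by blast
    note U1 = tilingsD(1)[OF T1] and U2 = tilingsD(1)[OF T2]
    have V1: "?V p \<notin> \<T>1" "?V p \<notin> \<T>2" for p
    proof -
      have "Up p k \<notin> ?L X" "Down p k \<notin> ?G X" by auto
      then show "?V p \<notin> \<T>1" "?V p \<notin> \<T>2" using U1 U2 by blast+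
    qed
    have in1: "\<forall>f\<in>l. face_row f < k" if "l \<in> \<T>1" for l using U1 that by blast
    have in2: "\<forall>f\<in>l. k \<le> face_row f" if "l \<in> \<T>2" for l using U2 that by blast
    have ne1: "\<exists>f. f \<in> l" if "l \<in> \<T>1 \<union> \<T>2" for l 
      using tilingsD(2)[OF T1, of l] tilingsD(2)[OF T2, of l] that lozenge_nonempty by blast
    let ?T = "?V ` X \<union> \<T>1 \<union> \<T>2"
    have 1: "{p. ?V p \<in> ?T} = X" using V1 by (auto simp: doubleton_eq_iff)
    have 2: "{l \<in> ?T. \<forall>f\<in>l. face_row f < k} = \<T>1"
    proof -
      have "\<not> (\<forall>f\<in>l. face_row f < k)" if "l \<in> \<T>2" for l using in2[OF that] ne1[of l] that by force
      then show ?thesis using in1 by auto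
    qed
    have 3: "{l \<in> ?T. \<forall>f\<in>l. k \<le> face_row f} = \<T>2"
    proof -
      have "\<not> (\<forall>f\<in>l. k \<le> face_row f)" if "l \<in> \<T>1" for l using in1[OF that] ne1[of l] that by force
      then show ?thesis using in2 by auto
    qed
    show "(\<lambda>\<T>. ({p. ?V p \<in> \<T>}, {l \<in> \<T>. \<forall>f\<in>l. face_row f < k}, {l \<in> \<T>. \<forall>f\<in>l. k \<le> face_row f}))
      (case t of (X, \<T>1, \<T>2) \<Rightarrow> ?V ` X \<union> \<T>1 \<union> \<T>2) = t"
      unfolding t prod.case 1 2 3 ..
    have "\<Union>?T = R"
    proof (intro equalityI subsetI)
      fix f assume "f \<in> \<Union>?T"
      then show "f \<in> R" using U1 U2 X by blast
    next
      fix f assume f: "f \<in> R"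
      show "f \<in> \<Union>?T"
      proof (cases "f \<in> \<Union>(?V ` X)")
        case False
        then have "f \<notin> (\<lambda>p. Down p k) ` X" "f \<notin> (\<lambda>p. Up p k) ` X" by blast+
        then have "f \<in> ?L X \<union> ?G X" using f by (cases "face_row f < k") simp_all
        then have "f \<in> \<Union>\<T>1 \<union> \<Union>\<T>2" unfolding U1 U2 .
        then show ?thesis by blast
      next
        case True
        then show ?thesis by blast
      qed
    qed
    moreover have "\<forall>l\<in>?T. lozenge l" using tilingsD(2)[OF T1] tilingsD(2)[OF T2] loz by blast
    moreover have "\<forall>l\<in>?T. \<forall>l'\<in>?T. l \<noteq> l' \<longrightarrow> l \<inter> l' = {}"
    proof -
      have a: "l \<inter> l' = {}" if "l \<in> \<T>1" "l' \<in> \<T>2" for l l' 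
      proof (rule ccontr)
        assume "l \<inter> l' \<noteq> {}"
        then obtain f where "f \<in> l" "f \<in> l'" by blast
        then show False using in1[OF that(1)] in2[OF that(2)] by (meson not_less)
      qed
      have b: "?V p \<inter> l = {}" if "p \<in> X" "l \<in> \<T>1 \<union> \<T>2" for p l
      proof (rule ccontr)
        assume "?V p \<inter> l \<noteq> {}"
        then have "Up p k \<in> l \<or> Down p k \<in> l" by blast
        moreover have "l \<subseteq> ?L X \<union> ?G X" using that(2) U1 U2
            by (metis UnCI UnE Union_upper subset_iff)
        moreover have "Up p k \<notin> ?L X \<union> ?G X" "Down p k \<notin> ?L X \<union> ?G X" using that(1) by auto
        ultimately show False by blast
      qed
      have c: "?V p \<inter> ?V p' = {}" if "p \<noteq> p'" for p p' using that by auto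
      have d: "l \<inter> l' = {}" if "l \<in> \<T>1 \<and> l' \<in> \<T>1 \<or> l \<in> \<T>2 \<and> l' \<in> \<T>2" "l \<noteq> l'" for l l'
        using that tilingsD(3)[OF T1] tilingsD(3)[OF T2] by blast
      show ?thesis
      proof (intro ballI impI)
        fix l l' assume l: "l \<in> ?T" "l' \<in> ?T" "l \<noteq> l'"
        then consider "\<exists>p\<in>X. l = ?V p" "\<exists>p\<in>X. l' = ?V p" | "\<exists>p\<in>X. l = ?V p" "l' \<in> \<T>1 \<union> \<T>2"
          | "\<exists>p\<in>X. l' = ?V p" "l \<in> \<T>1 \<union> \<T>2" | "l \<in> \<T>1 \<union> \<T>2" "l' \<in> \<T>1 \<union> \<T>2" by blast
        then show "l \<inter> l' = {}"
        proof cases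
          case 1
          then obtain p p' where "l = ?V p" "l' = ?V p'" by blast
          then show ?thesis using c[of p p'] l(3) by blast
        next
          case 2
          then show ?thesis using b by blast
        next
          case 3
          then show ?thesis using b by blast
        next
          case 4
          then consider "l \<in> \<T>1 \<and> l' \<in> \<T>1 \<or> l \<in> \<T>2 \<and> l' \<in> \<T>2" | "l \<in> \<T>1" "l' \<in> \<T>2" | "l \<in> \<T>2" "l'
              \<in> \<T>1" by blast
          then show ?thesis
          proof cases
            case 1
            then show ?thesis using d l(3) by blast
          next
            case 2
            then show ?thesis by (rule a)
          next
            case 3
            then show ?thesis using a[of l' l] by blast
          qed
        qed
      qed
    qed
    ultimately show "(case t of (X, \<T>1, \<T>2) \<Rightarrow> ?V ` X \<union> \<T>1 \<union> \<T>2) \<in> tilings R"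
      unfolding t prod.case tilings_iff by (intro conjI)
  qed
  also have "\<dots> = (\<Sum>(X, \<T>1, \<T>2)\<in>?I. (\<Prod>p\<in>X. w (?V p)) * (\<Prod>l\<in>\<T>1. w l) * (\<Prod>l\<in>\<T>2. w l))"
  proof (rule sum.cong[OF refl])
    fix t assume "t \<in> ?I"
    then obtain X \<T>1 \<T>2 where t: "t = (X, \<T>1, \<T>2)" and X: "X \<subseteq> ?C"
      and T1: "\<T>1 \<in> tilings (?L X)" and T2: "\<T>2 \<in> tilings (?G X)" by blast
    note U1 = tilingsD(1)[OF T1] and U2 = tilingsD(1)[OF T2]
    have f: "finite X" "finite \<T>1" "finite \<T>2"
      using X finC finite_subset T1 T2 fin finite_tiling[of "?L X" \<T>1] finite_tiling[of "?G X" \<T>2]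
          by auto
    have "\<T>1 \<inter> \<T>2 = {}"
    proof (rule ccontr)
      assume "\<T>1 \<inter> \<T>2 \<noteq> {}"
      then obtain l where l: "l \<in> \<T>1" "l \<in> \<T>2" by blast
      then obtain f where "f \<in> l" using tilingsD(2)[OF T1] lozenge_nonempty by blast
      moreover from this l have "f \<in> ?L X" "f \<in> ?G X" using U1 U2 by blast+
      ultimately show False by auto
    qed
    moreover have "?V ` X \<inter> (\<T>1 \<union> \<T>2) = {}"
    proof (rule ccontr)
      assume "?V ` X \<inter> (\<T>1 \<union> \<T>2) \<noteq> {}"
      then obtain p where "p \<in> X" "?V p \<in> \<T>1 \<union> \<T>2" by blast
      then have "Up p k \<in> ?L X \<or> Down p k \<in> ?G X" using U1 U2 by blast
      then show False by auto
    qed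
    moreover have "inj_on ?V X" by (auto simp: inj_on_def doubleton_eq_iff)
    ultimately show "(case t of (X, \<T>1, \<T>2) \<Rightarrow> \<Prod>l\<in>?V ` X \<union> \<T>1 \<union> \<T>2. w l)
       = (case t of (X, \<T>1, \<T>2) \<Rightarrow> (\<Prod>p\<in>X. w (?V p)) * (\<Prod>l\<in>\<T>1. w l) * (\<Prod>l\<in>\<T>2. w l))"
      unfolding t prod.case Un_assoc using f by (simp add: prod.union_disjoint prod.reindex
          mult.assoc)
  qed
  also have "\<dots> = (\<Sum>X\<in>Pow ?C. \<Sum>(\<T>1, \<T>2)\<in>tilings (?L X) \<times> tilings (?G X). (\<Prod>p\<in>X. w (?V p))
      * (\<Prod>l\<in>\<T>1. w l) * (\<Prod>l\<in>\<T>2. w l))"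
    using finC fin by (subst sum.Sigma) (auto simp: finite_tilings)
  also have "\<dots> = (\<Sum>X\<in>Pow ?C. (\<Prod>p\<in>X. w (?V p)) * M (?L X, w) * M (?G X, w))"
    by (simp only: M_def prod.case mult.assoc sum.cartesian_product[symmetric]
        sum_distrib_left[symmetric] sum_distrib_right[symmetric])
  finally show ?thesis by (simp add: Pow_def)
qed

section \<open>Rows of triangles and interlacing\<close>

text \<open>Numbers the triangles of a row from west to east, so that the lozenges within a row are
  the pairs of consecutive numbers.\<close>

definition rface :: "int \<Rightarrow> int \<Rightarrow> face" where
  "rface k n = (if even n then Up (n div 2) k else Down (n div 2) (k + 1))"

lemma row_rface [simp]: "face_row (rface k n) = k"
  by (simp add: rface_def)

lemma rface_inj: "rface k m = rface k n \<longleftrightarrow> m = n"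
  by (auto simp: rface_def split: if_splits) presburger+

lemma lozenge_rface: "lozenge {rface k m, rface k n} \<longleftrightarrow> n = m + 1 \<or> n = m - 1"
proof (cases "even m"; cases "even n")
  assume "even m" "even n"
  then show ?thesis by (auto simp: rface_def lozenge_Up)
next
  assume *: "even m" "odd n"
  then show ?thesis unfolding rface_def by (auto simp: lozenge_Up elim!: evenE oddE)
next
  assume *: "odd m" "even n"
  then show ?thesis unfolding rface_def by (auto simp: lozenge_Down elim!: evenE oddE)
next
  assume "odd m" "odd n"
  then show ?thesis by (auto simp: rface_def lozenge_Down)
qed

text \<open>The leftmost cell can only be paired with its right neighbour. Hence a row has at most
  one tiling, and it has one iff all maximal runs of cells have even length, which the parity at
  absent positions expresses.\<close>

lemma M_row:
  assumes "finite K" "\<And>n. w {rface k n, rface k (n + 1)} = 1"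
  shows "M (rface k ` K, w) = (if \<forall>n. n \<notin> K \<longrightarrow> even (card {m \<in> K. m < n}) then 1 else 0)"
  using assms(1)
proof (induction "card K" arbitrary: K rule: less_induct)
  case less
  show ?case
  proof (cases "K = {}")
    case False
    define a where "a = Min K"
    have a: "a \<in> K" "\<And>m. m \<in> K \<Longrightarrow> a \<le> m" using False less.prems by (auto simp: a_def)
    have nb: "h = rface k (a + 1) \<and> a + 1 \<in> K" if h: "h \<in> rface k ` K" "lozenge {rface k a, h}"
        for h
    proof -
      from h(1) obtain m where m: "m \<in> K" "h = rface k m" by blast
      then have "m = a + 1 \<or> m = a - 1" using h(2) by (simp add: lozenge_rface)
      then show ?thesis using m a(2)[of m] by auto
    qed
    show ?thesis
    proof (cases "a + 1 \<in> K")
      case True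
      let ?K = "K - {a, a + 1}"
      have fin: "finite ?K" using less.prems by simp
      have "card ?K < card K" using a(1) less.prems by (intro psubset_card_mono) auto
      note IH = less.hyps[OF this fin]
      have "M (rface k ` K, w) = w {rface k a, rface k (a + 1)}
          * M (rface k ` K - {rface k a, rface k (a + 1)}, w)"
        using a True less.prems nb by (intro M_forced) (auto simp: lozenge_rface)
      also have "rface k ` K - {rface k a, rface k (a + 1)} = rface k ` ?K"
        by (auto simp: rface_inj)
      finally have M: "M (rface k ` K, w) = M (rface k ` ?K, w)" using assms(2) by simp
      \<comment> \<open>Since \<open>a\<close> and \<open>a + 1\<close> are both present, an absent
        position has both or neither of them on its left.\<close>
      have cnt: "even (card {m \<in> K. m < n}) \<longleftrightarrow> even (card {m \<in> ?K. m < n})" if "n \<notin> K" for n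
      proof (cases "n < a")
        case True
        then have e: "{m \<in> K. m < n} = {}" "{m \<in> ?K. m < n} = {}" using a(2) by force+
        show ?thesis unfolding e ..
      next
        case False
        then have "a + 1 < n" using a(1) \<open>a + 1 \<in> K\<close> that
          by (metis add1_zle_eq linorder_neqE_linordered_idom order_le_less)
        then have "{m \<in> K. m < n} = insert a (insert (a + 1) {m \<in> ?K. m < n})" using a(1) True
            by auto
        then have "card {m \<in> K. m < n} = Suc (Suc (card {m \<in> ?K. m < n}))"
          using fin by simp
        then show ?thesis by simp
      qed
      have low: "{m \<in> ?K. m < a} = {}" "{m \<in> ?K. m < a + 1} = {}" using a(2) by force+
      have "(\<forall>n. n \<notin> K \<longrightarrow> even (card {m \<in> K. m < n})) \<longleftrightarrow> (\<forall>n. n \<notin> ?K \<longrightarrow> even (card {m \<in> ?K. m < n}))"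
      proof
        assume *: "\<forall>n. n \<notin> K \<longrightarrow> even (card {m \<in> K. m < n})"
        show "\<forall>n. n \<notin> ?K \<longrightarrow> even (card {m \<in> ?K. m < n})"
        proof (intro allI impI)
          fix n assume "n \<notin> ?K"
          then consider "n \<notin> K" | "n = a" | "n = a + 1" by blast
          then show "even (card {m \<in> ?K. m < n})"
          proof cases
            case 1
            then show ?thesis using * cnt by blast
          next
            case 2
            show ?thesis unfolding 2 low by simp
          next
            case 3
            show ?thesis unfolding 3 low by simp
          qed
        qed
      next
        assume *: "\<forall>n. n \<notin> ?K \<longrightarrow> even (card {m \<in> ?K. m < n})"
        then show "\<forall>n. n \<notin> K \<longrightarrow> even (card {m \<in> K. m < n})" using cnt by blast
      qed
      then show ?thesis unfolding M IH by simp
    next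
      case False
      then have "M (rface k ` K, w) = 0"
        using a(1) nb by (intro M_isolated[of "rface k a"]) auto
      moreover have "{m \<in> K. m < a + 1} = {a}" using a by force
      then have "odd (card {m \<in> K. m < a + 1})" by simp
      ultimately show ?thesis using False by auto
    qed
  qed simp
qed

lemma gap_exists:
  fixes g :: "nat \<Rightarrow> nat"
  assumes "g 0 \<le> t" "t < g l"
  shows "\<exists>i<l. g i \<le> t \<and> t < g (Suc i)"
  using assms(2)
proof (induction l)
  case 0
  then show ?case using assms(1) by simp
next
  case (Suc l)
  then show ?case by (cases "t < g l") (auto intro: less_SucI)
qed

text \<open>Families interlacing with \<open>g\<close>. The windows are half-open because the cell 2
  t lies between the cells \<open>2 g_i - 1\<close> and \<open>2 g_(i+1) - 1\<close> iff
  \<open>g_i\<close> \<le> t < \<open>g_(i+1)\<close>.\<close>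

definition gaps :: "nat \<Rightarrow> (nat \<Rightarrow> nat) \<Rightarrow> (nat \<Rightarrow> nat) set" where
  "gaps l g = PiE {..<l} (\<lambda>i. {g i..<g (Suc i)})"

lemma gapsD:
  assumes "f \<in> gaps l g" "i < l"
  shows "g i \<le> f i" "f i < g (Suc i)"
  using PiE_mem[OF assms(1)[unfolded gaps_def], of i] assms(2) by auto

lemma gaps_strict_mono:
  assumes "f \<in> gaps l g" "strict_mono_on {..l} g"
  shows "strict_mono_on {..<l} f"
proof (rule strict_mono_onI)
  fix i j assume ij: "i \<in> {..<l}" "j \<in> {..<l}" "i < j"
  have "f i < g (Suc i)" "g j \<le> f j" using gapsD[OF assms(1)] ij by auto
  moreover have "g (Suc i) \<le> g j"
    by (rule strict_mono_on_leD[OF assms(2)]) (use ij in auto)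
  ultimately show "f i < f j" by linarith
qed

text \<open>The windows are disjoint, so the set of values determines the family. This lets sums
  over dent sets become sums over families.\<close>

lemma gaps_inj:
  assumes "strict_mono_on {..l} g"
  shows "inj_on (\<lambda>f. f ` {..<l}) (gaps l g)"
proof (rule inj_onI)
  fix f f' assume f: "f \<in> gaps l g" "f' \<in> gaps l g" "f ` {..<l} = f' ` {..<l}"
  show "f = f'"
  proof (rule PiE_ext)
    show "f \<in> PiE {..<l} (\<lambda>i. {g i..<g (Suc i)})" "f' \<in> PiE {..<l} (\<lambda>i. {g i..<g (Suc i)})"
      using f by (auto simp: gaps_def)
    fix i assume i: "i \<in> {..<l}"
    then obtain j where j: "j < l" "f i = f' j" using f(3) by (metis imageE image_eqI lessThan_iff)
    have b: "g i \<le> f i" "f i < g (Suc i)" "g j \<le> f' j" "f' j < g (Suc j)"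
      using gapsD[OF f(1), of i] gapsD[OF f(2), of j] i j by auto
    have "i = j"
    proof (rule ccontr)
      assume "i \<noteq> j"
      then consider "Suc i \<le> j" | "Suc j \<le> i" by linarith
      then show False
      proof cases
        case 1
        then have "g (Suc i) \<le> g j" using strict_mono_on_leD[OF assms, of "Suc i" j] j by auto
        then show False using b j by linarith
      next
        case 2
        then have "g (Suc j) \<le> g i" using strict_mono_on_leD[OF assms, of "Suc j" i] i by auto
        then show False using b j by linarith
      qed
    qed
    then show "f i = f' i" using j by simp
  qed
qed

text \<open>The removed cells of a row: the cells \<open>2 g\<^sub>i - 1\<close> are given, the cells \<open>2 t\<close> with
  \<open>t \<in> F\<close> are chosen. What remains can be tiled iff the removed cells alternate.\<close>

lemma row_interlacing:
  fixes g :: "nat \<Rightarrow> nat"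
  assumes g: "strict_mono_on {..l} g" and gl: "g l \<le> h" and F: "F \<subseteq> {..<h}"
  defines "K \<equiv> {- 1..<2 * int h} - ((\<lambda>i. 2 * int (g i) - 1) ` {..l} \<union> (\<lambda>t. 2 * int t) ` F)"
  shows "(\<forall>n. n \<notin> K \<longrightarrow> even (card {m \<in> K. m < n})) \<longleftrightarrow> F \<in> (\<lambda>f. f ` {..<l}) ` gaps l g"
proof -
  \<comment> \<open>\<open>G t\<close> and \<open>C t\<close> count the given and the chosen cells
    west of the cell 2 t.\<close>
  define G where "G = (\<lambda>t. card {i. i \<le> l \<and> g i \<le> t})"
  define C where "C = (\<lambda>t. card {f \<in> F. f < t})"
  have finF: "finite F" using F finite_subset by blast
  have inj: "inj_on g {..l}" by (rule strict_mono_on_imp_inj_on[OF g])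
  have count: "int (card {m \<in> K. m < n}) = n + 1 - int (card {i. i \<le> l \<and> 2 * int (g i) - 1 < n})
      - int (card {f \<in> F. 2 * int f < n})"
    if "- 1 \<le> n" "n \<le> 2 * int h" for n
  proof -
    let ?A = "{i. i \<le> l \<and> 2 * int (g i) - 1 < n}" and ?B = "{f \<in> F. 2 * int f < n}"
    let ?a = "\<lambda>i. 2 * int (g i) - 1" and ?b = "\<lambda>t. 2 * int t"
    have "{m \<in> K. m < n} = {- 1..<n} - (?a ` ?A \<union> ?b ` ?B)"
      using that by (auto simp: K_def)
    moreover have "?a ` ?A \<union> ?b ` ?B \<subseteq> {- 1..<n}" by auto
    ultimately have "card {m \<in> K. m < n} = card {- 1..<n} - card (?a ` ?A \<union> ?b ` ?B)"
      using finF by (simp add: card_Diff_subset)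
    moreover have "card (?a ` ?A \<union> ?b ` ?B) \<le> card {- 1..<n}"
      using \<open>?a ` ?A \<union> ?b ` ?B \<subseteq> {- 1..<n}\<close> by (intro card_mono) auto
    moreover have "card (?a ` ?A \<union> ?b ` ?B) = card (?a ` ?A) + card (?b ` ?B)"
      using finF by (intro card_Un_disjoint) (auto, presburger)
    moreover have "card (?a ` ?A) = card ?A" using inj by (intro card_image) (auto simp: inj_on_def)
    moreover have "card (?b ` ?B) = card ?B" by (intro card_image) (auto simp: inj_on_def)
    ultimately show ?thesis using that by simp
  qed
  have eG: "card {i. i \<le> l \<and> 2 * int (g i) - 1 < 2 * int (g j) - 1} = j" if "j \<le> l" for j
  proof -
    have "g i < g j \<longleftrightarrow> i < j" if "i \<le> l" for i
      using strict_mono_on_less[OF g, of i j] that \<open>j \<le> l\<close> by simp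
    then have "{i. i \<le> l \<and> 2 * int (g i) - 1 < 2 * int (g j) - 1} = {..<j}" using that by auto
    then show ?thesis by simp
  qed
  \<comment> \<open>The full row starts at cell - 1, so it has \<open>2 g_j\<close> cells west of
    this one; j given and \<open>C (g j)\<close> chosen ones are missing.\<close>
  have P1: "even (card {m \<in> K. m < 2 * int (g j) - 1}) \<longleftrightarrow> even (j + C (g j))" if "j \<le> l" for j
  proof -
    have "g j \<le> g l" using strict_mono_on_leD[OF g, of j l] that by simp
    then have "int (card {m \<in> K. m < 2 * int (g j) - 1}) = 2 * int (g j) - int j - int
        (card {f \<in> F. 2 * int f < 2 * int (g j) - 1})"
      using count[of "2 * int (g j) - 1"] eG[OF that] gl by simp
    moreover have "{f \<in> F. 2 * int f < 2 * int (g j) - 1} = {f \<in> F. f < g j}" by auto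
    ultimately have "int (card {m \<in> K. m < 2 * int (g j) - 1}) = 2 * int (g j) - int j - int
        (C (g j))"
      by (simp add: C_def)
    then show ?thesis by presburger
  qed
  \<comment> \<open>Here 2 t + 1 cells of the full row lie to the west, which reverses the
    parity.\<close>
  have P2: "even (card {m \<in> K. m < 2 * int t}) \<longleftrightarrow> odd (G t + C t)" if "t \<le> h" for t
  proof -
    have "{i. i \<le> l \<and> 2 * int (g i) - 1 < 2 * int t} = {i. i \<le> l \<and> g i \<le> t}"
      "{f \<in> F. 2 * int f < 2 * int t} = {f \<in> F. f < t}" by auto
    then have "int (card {m \<in> K. m < 2 * int t}) = 2 * int t + 1 - int (G t) - int (C t)"
      using count[of "2 * int t"] that by (simp add: G_def C_def)
    then show ?thesis by presburger
  qed
  have Gl: "G t = Suc l" if "g l \<le> t" for t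
  proof -
    have "g i \<le> g l" if "i \<le> l" for i using strict_mono_on_leD[OF g, of i l] that by simp
    then have "{i. i \<le> l \<and> g i \<le> t} = {..l}" using that by force
    then show ?thesis by (simp add: G_def)
  qed
  have Gi: "G t = Suc i" if "i < l" "g i \<le> t" "t < g (Suc i)" for t i
  proof -
    have "g j \<le> t \<longleftrightarrow> j \<le> i" if "j \<le> l" for j
    proof
      assume "g j \<le> t"
      show "j \<le> i"
      proof (rule ccontr)
        assume "\<not> j \<le> i"
        then have "g (Suc i) \<le> g j" using strict_mono_on_leD[OF g, of "Suc i" j] that by simp
        then show False using \<open>g j \<le> t\<close> \<open>t < g (Suc i)\<close> by simp
      qed
    next
      assume "j \<le> i"
      then have "g j \<le> g i" using strict_mono_on_leD[OF g, of j i] that \<open>i < l\<close> by simp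
      then show "g j \<le> t" using \<open>g i \<le> t\<close> by simp
    qed
    then have "{j. j \<le> l \<and> g j \<le> t} = {..i}" using \<open>i < l\<close> by force
    then show ?thesis by (simp add: G_def)
  qed
  \<comment> \<open>West of the row the count is 0 and east of it constant, so only the removed
    cells and the eastern end need to be tested.\<close>
  have cond: "(\<forall>n. n \<notin> K \<longrightarrow> even (card {m \<in> K. m < n}))
     \<longleftrightarrow> (\<forall>j\<le>l. even (j + C (g j))) \<and> (\<forall>t\<in>F. odd (G t + C t)) \<and> even (l + card F)"
  proof -
    have Ch: "C h = card F" using F by (simp add: C_def) (metis (no_types, lifting) Collect_mem_eq
        Collect_cong lessThan_iff subset_iff)
    have top: "even (card {m \<in> K. m < 2 * int h}) \<longleftrightarrow> even (l + card F)"
      using P2[of h] Gl[OF gl] Ch by simp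
    have "(\<forall>n. n \<notin> K \<longrightarrow> even (card {m \<in> K. m < n})) \<longleftrightarrow>
      (\<forall>j\<le>l. even (card {m \<in> K. m < 2 * int (g j) - 1})) \<and>
          (\<forall>t\<in>F. even (card {m \<in> K. m < 2 * int t}))
        \<and> even (card {m \<in> K. m < 2 * int h})" (is "?L \<longleftrightarrow> ?R")
    proof
      assume ?L
      then show ?R by (auto simp: K_def)
    next
      assume R: ?R
      show ?L
      proof (intro allI impI)
        fix n assume n: "n \<notin> K"
        consider "n < - 1" | "2 * int h \<le> n" | "- 1 \<le> n" "n < 2 * int h" by linarith
        then show "even (card {m \<in> K. m < n})"
        proof cases
          case 1
          then have "{m \<in> K. m < n} = {}" by (auto simp: K_def)
          then show ?thesis by (simp only: card.empty even_zero)
        next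
          case 2
          then have "{m \<in> K. m < n} = {m \<in> K. m < 2 * int h}" by (auto simp: K_def)
          then show ?thesis using R by simp
        next
          case 3
          then have "n \<in> (\<lambda>i. 2 * int (g i) - 1) ` {..l} \<union> (\<lambda>t. 2 * int t) ` F"
            using n by (simp add: K_def)
          then show ?thesis using R by auto
        qed
      qed
    qed
    also have "\<dots> \<longleftrightarrow> (\<forall>j\<le>l. even (j + C (g j))) \<and> (\<forall>t\<in>F. odd (G t + C t)) \<and> even (l + card F)"
    proof -
      have P2F: "even (card {m \<in> K. m < 2 * int t}) \<longleftrightarrow> odd (G t + C t)" if "t \<in> F" for t
      proof -
        have "t \<le> h" using that F by auto
        then show ?thesis by (rule P2)
      qed
      show ?thesis using P1 P2F top by simp
    qed
    finally show ?thesis .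
  qed
  have Cdiff: "C t' = C t + card (F \<inter> {t..<t'})" if "t \<le> t'" for t t'
  proof -
    have "{f \<in> F. f < t'} = {f \<in> F. f < t} \<union> (F \<inter> {t..<t'})" using that by auto
    moreover have "card ({f \<in> F. f < t} \<union> (F \<inter> {t..<t'})) = card {f \<in> F. f < t} + card
        (F \<inter> {t..<t'})"
      by (rule card_Un_disjoint) (use finF in auto)
    ultimately show ?thesis by (simp only: C_def)
  qed
  show ?thesis unfolding cond
  proof
    assume *: "(\<forall>j\<le>l. even (j + C (g j))) \<and> (\<forall>t\<in>F. odd (G t + C t)) \<and> even (l + card F)"
    \<comment> \<open>From one chosen cell to the next, C grows by 1. With no given cell between
      them, both parities cannot be odd.\<close>
    have two: False if "t \<in> F" "t' \<in> F" "t < t'" "F \<inter> {t<..<t'} = {}" "G t = G t'" for t t'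
    proof -
      have "F \<inter> {t..<t'} = {t}" using that by force
      then have "C t' = Suc (C t)" using Cdiff[of t t'] that by simp
      moreover have "odd (G t + C t)" "odd (G t' + C t')" using * that(1,2) by blast+
      ultimately show False using that(5) by simp
    qed
    have le1: "card (F \<inter> {s..<s'}) \<le> 1" if G: "\<And>t. s \<le> t \<Longrightarrow> t < s' \<Longrightarrow> G t = c" for s s' c
    proof (rule ccontr)
      assume "\<not> card (F \<inter> {s..<s'}) \<le> 1"
      then have c: "card (F \<inter> {s..<s'}) \<ge> 2" by simp
      define t where "t = Min (F \<inter> {s..<s'})"
      have ne: "F \<inter> {s..<s'} \<noteq> {}" using c by auto
      have t: "t \<in> F \<inter> {s..<s'}" unfolding t_def by (rule Min_in) (use finF ne in auto)
      define D where "D = F \<inter> {s..<s'} - {t}"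
      have "card D \<ge> 1" using c t finF by (simp add: D_def card_Diff_singleton)
      then have ne: "D \<noteq> {}" by auto
      define t' where "t' = Min D"
      have finD: "finite D" using finF by (simp add: D_def)
      have t': "t' \<in> D" unfolding t'_def by (rule Min_in[OF finD ne])
      have mn: "t \<le> r" if "r \<in> F \<inter> {s..<s'}" for r unfolding t_def
          by (rule Min_le) (use that finF in auto)
      have mn': "t' \<le> r" if "r \<in> D" for r unfolding t'_def by (rule Min_le[OF finD that])
      have "t < t'" using mn[of t'] t' by (auto simp: D_def)
      moreover have "F \<inter> {t<..<t'} = {}"
      proof (rule ccontr)
        assume "F \<inter> {t<..<t'} \<noteq> {}"
        then obtain r where r: "r \<in> F" "t < r" "r < t'" by auto
        then have "r \<in> D" using t t' by (auto simp: D_def)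
        then show False using mn'[of r] r by simp
      qed
      ultimately show False using two[of t t'] t t' G[of t] G[of t'] by (auto simp: D_def)
    qed
    \<comment> \<open>West of \<open>g 0\<close> there is at most one chosen cell by
      \<open>le1\<close>, and an even number by the parity at \<open>g 0\<close>.\<close>
    have low: "g 0 \<le> t" if "t \<in> F" for t
    proof (rule ccontr)
      assume t: "\<not> g 0 \<le> t"
      have G0: "G r = 0" if "r < g 0" for r
      proof -
        have "\<not> g i \<le> r" if "i \<le> l" for i
          using strict_mono_on_leD[OF g, of 0 i] that \<open>r < g 0\<close> by simp
        then show ?thesis by (simp add: G_def)
      qed
      have "even (C (g 0))" using * by auto
      moreover have "C (g 0) = card (F \<inter> {0..<g 0})" using Cdiff[of 0 "g 0"] by (simp add: C_def)
      moreover have "card (F \<inter> {0..<g 0}) \<le> 1" by (rule le1) (rule G0)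
      moreover have "F \<inter> {0..<g 0} \<noteq> {}" using that t by auto
      then have "card (F \<inter> {0..<g 0}) \<noteq> 0" using finF by simp
      ultimately show False by (cases "card (F \<inter> {0..<g 0})") auto
    qed
    \<comment> \<open>The same argument east of \<open>g l\<close>, comparing the parity at
      \<open>g l\<close> with that at the eastern end.\<close>
    have high: "t < g l" if "t \<in> F" for t
    proof (rule ccontr)
      assume t: "\<not> t < g l"
      have "even (l + C (g l))" using * by auto
      moreover have Fh: "F \<inter> {..<h} = F" using F by auto
      have "C h = card F" using Fh by (simp add: C_def Int_def lessThan_def)
      then have "card F = C (g l) + card (F \<inter> {g l..<h})" using Cdiff[OF gl] by simp
      moreover have "card (F \<inter> {g l..<h}) \<le> 1" by (rule le1) (rule Gl)
      moreover have "t \<in> F \<inter> {g l..<h}" using that t F by auto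
      then have "F \<inter> {g l..<h} \<noteq> {}" by blast
      then have "card (F \<inter> {g l..<h}) \<noteq> 0" using finF by simp
      ultimately show False using * by (cases "card (F \<inter> {g l..<h})") auto
    qed
    \<comment> \<open>The parities at both ends of the window make the number of chosen cells in it
      odd.\<close>
    have ex1: "card (F \<inter> {g i..<g (Suc i)}) = 1" if "i < l" for i
    proof -
      have "card (F \<inter> {g i..<g (Suc i)}) \<le> 1" by (rule le1) (rule Gi[OF that])
      moreover have "g i \<le> g (Suc i)" using strict_mono_on_leD[OF g, of i "Suc i"] that by simp
      then have "C (g (Suc i)) = C (g i) + card (F \<inter> {g i..<g (Suc i)})" by (rule Cdiff)
      moreover have "even (i + C (g i))" "even (Suc i + C (g (Suc i)))"
        using * less_imp_le[OF that] Suc_leI[OF that] by blast+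
      ultimately show ?thesis by (cases "card (F \<inter> {g i..<g (Suc i)})") auto
    qed
    define f where "f = (\<lambda>i\<in>{..<l}. THE t. t \<in> F \<inter> {g i..<g (Suc i)})"
    have f: "F \<inter> {g i..<g (Suc i)} = {f i}" if "i < l" for i
    proof -
      obtain t where t: "F \<inter> {g i..<g (Suc i)} = {t}"
        using ex1[of i] \<open>i < l\<close> card_1_singletonE by metis
      have "f i = (THE t. t \<in> F \<inter> {g i..<g (Suc i)})" using that by (simp add: f_def)
      also have "\<dots> = t" unfolding t by simp
      finally have "f i = t" .
      then show ?thesis using t by simp
    qed
    have "f \<in> gaps l g" unfolding gaps_def
    proof (rule PiE_I)
      show "f i \<in> {g i..<g (Suc i)}" if "i \<in> {..<l}" for i using f[of i] that
          by (metis Int_iff insertI1 lessThan_iff)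
    qed (simp add: f_def)
    moreover have "F = f ` {..<l}"
    proof (intro equalityI subsetI)
      fix t assume t: "t \<in> F"
      obtain i where i: "i < l" "g i \<le> t" "t < g (Suc i)"
          using gap_exists[OF low[OF t] high[OF t]] by blast
      then have "t \<in> F \<inter> {g i..<g (Suc i)}" using t by simp
      then have "t = f i" unfolding f[OF i(1)] by simp
      then show "t \<in> f ` {..<l}" using i(1) by simp
    next
      fix t assume "t \<in> f ` {..<l}"
      then obtain i where "i < l" "t = f i" by blast
      then show "t \<in> F" using f[of i] by blast
    qed
    ultimately show "F \<in> (\<lambda>f. f ` {..<l}) ` gaps l g" by blast
  next
    assume "F \<in> (\<lambda>f. f ` {..<l}) ` gaps l g"
    then obtain f where f: "f \<in> gaps l g" "F = f ` {..<l}" by blast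
    have b: "g i \<le> f i" "f i < g (Suc i)" if "i < l" for i using gapsD[OF f(1) that] by auto
    have mono: "strict_mono_on {..<l} f" by (rule gaps_strict_mono[OF f(1) g])
    then have injf: "inj_on f {..<l}" by (rule strict_mono_on_imp_inj_on)
    \<comment> \<open>Conversely, exactly the first j members of an interlacing family lie west of
      \<open>g j\<close>.\<close>
    have Cg: "C (g j) = j" if "j \<le> l" for j
    proof -
      have "f i < g j \<longleftrightarrow> i < j" if "i < l" for i
      proof
        assume "f i < g j"
        then have "g i < g j" using b[OF that] by simp
        then show "i < j" using strict_mono_on_less[OF g, of i j] that \<open>j \<le> l\<close> by simp
      next
        assume "i < j"
        then have "g (Suc i) \<le> g j" using strict_mono_on_leD[OF g, of "Suc i" j] \<open>j \<le> l\<close> by simp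
        then show "f i < g j" using b[OF that] by simp
      qed
      then have "{t \<in> F. t < g j} = f ` {..<j}" using f(2) that by auto
      moreover have "inj_on f {..<j}" using injf by (rule inj_on_subset) (use that in auto)
      ultimately show ?thesis by (simp add: C_def card_image)
    qed
    have Cf: "C (f j) = j" if "j < l" for j
    proof -
      have "f i < f j \<longleftrightarrow> i < j" if "i < l" for i
        using strict_mono_on_less[OF mono, of i j] that \<open>j < l\<close> by simp
      then have "{t \<in> F. t < f j} = f ` {..<j}" using f(2) that by auto
      moreover have "inj_on f {..<j}" using injf by (rule inj_on_subset) (use that in auto)
      ultimately show ?thesis by (simp add: C_def card_image)
    qed
    have "card F = l" using f(2) injf by (simp add: card_image)
    moreover have "odd (G t + C t)" if "t \<in> F" for t
    proof -
      from that obtain j where j: "j < l" "t = f j" using f(2) by blast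
      then show ?thesis using Gi[OF j(1) b[OF j(1)]] Cf[OF j(1)] by simp
    qed
    ultimately show "(\<forall>j\<le>l. even (j + C (g j))) \<and> (\<forall>t\<in>F. odd (G t + C t)) \<and> even (l + card F)"
      using Cg by simp
  qed
qed

section \<open>Summation over interlacing families\<close>

text \<open>Central factorial of degree 2 j. Its companion \<open>odd_basis\<close> has degree 2 j +
  1 and zeros at 0 and at half-integers. The factorials are chosen such that the central difference
  of a function of one basis is a function of the other with coefficient 1.\<close>

definition even_basis :: "nat \<Rightarrow> real \<Rightarrow> real" where
  "even_basis j t = (\<Prod>i<j. t\<^sup>2 - (real i)\<^sup>2) / fact (2 * j)"

definition odd_basis :: "nat \<Rightarrow> real \<Rightarrow> real" where
  "odd_basis j v = v * (\<Prod>i<j. v\<^sup>2 - (real i + 1 / 2)\<^sup>2) / fact (2 * j + 1)"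

lemma odd_basis_shift: "odd_basis j (t + 1 / 2) = (t + 1 / 2) * (\<Prod>i<j. t - real i)
    * (\<Prod>i<j. t + 1 + real i) / fact (2 * j + 1)"
proof -
  have "(t + 1 / 2)\<^sup>2 - (real i + 1 / 2)\<^sup>2 = (t - real i) * (t + 1 + real i)" for i
    by (simp add: power2_eq_square field_simps)
  then show ?thesis by (simp add: odd_basis_def prod.distrib)
qed

lemma even_basis_factor: "even_basis j t = (\<Prod>i<j. t - real i) * (\<Prod>i<j. t + real i) / fact (2 * j)"
proof -
  have "t\<^sup>2 - (real i)\<^sup>2 = (t - real i) * (t + real i)" for i
    by (simp add: power2_eq_square algebra_simps)
  then show ?thesis by (simp add: even_basis_def prod.distrib)
qed

text \<open>Both values share the factors t - i and t + 1 + i for i < j; what remains is a quadratic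
  identity.\<close>

lemma even_basis_diff: "even_basis (Suc j) (t + 1) - even_basis (Suc j) t = odd_basis j (t + 1 / 2)"
proof -
  let ?A = "\<Prod>i<j. t - real i" and ?R = "\<Prod>i<j. t + 1 + real i"
  have 1: "(\<Prod>i<Suc j. t + 1 - real i) = (t + 1) * ?A"
    by (subst prod.lessThan_Suc_shift) simp
  have 2: "(\<Prod>i<Suc j. t + 1 + real i) = ?R * (t + 1 + real j)" by simp
  have 3: "(\<Prod>i<Suc j. t + real i) = t * ?R"
    by (subst prod.lessThan_Suc_shift) (simp add: algebra_simps)
  have 4: "(\<Prod>i<Suc j. t - real i) = ?A * (t - real j)" by simp
  have f: "fact (2 * Suc j) = (2 * real j + 2) * fact (2 * j + 1)" by (simp add: algebra_simps)
  have "even_basis (Suc j) (t + 1) - even_basis (Suc j) t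
     = ?A * ?R * ((t + 1) * (t + 1 + real j) - (t - real j) * t) / ((2 * real j + 2) * fact
         (2 * j + 1))"
    unfolding even_basis_factor 1 2 3 4 f by (simp add: algebra_simps add_divide_distrib
        diff_divide_distrib)
  also have "(t + 1) * (t + 1 + real j) - (t - real j) * t = (t + 1 / 2) * (2 * real j + 2)"
    by (simp add: algebra_simps)
  also have "?A * ?R * ((t + 1 / 2) * (2 * real j + 2)) / ((2 * real j + 2) * fact (2 * j + 1))
      = odd_basis j (t + 1 / 2)"
  proof -
    have "2 * real j + 2 \<noteq> 0" by linarith
    then show ?thesis unfolding odd_basis_shift by (simp add: mult_ac)
  qed
  finally show ?thesis .
qed

text \<open>The second half of the pair, with shared factors t - i and t + i.\<close>

lemma odd_basis_diff:
  assumes "t \<noteq> 0"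
  shows "odd_basis j (t + 1 / 2) - odd_basis j (t - 1 / 2) = even_basis j t"
proof -
  let ?A = "\<Prod>i<j. t - real i" and ?R = "\<Prod>i<j. t + real i"
  have 1: "t * (\<Prod>i<j. t + 1 + real i) = ?R * (t + real j)"
    using prod.lessThan_Suc_shift[of "\<lambda>i. t + real i" j] by (simp add: algebra_simps)
  have 2: "t * (\<Prod>i<j. t - 1 - real i) = ?A * (t - real j)"
    using prod.lessThan_Suc_shift[of "\<lambda>i. t - real i" j] by (simp add: algebra_simps)
  have 3: "odd_basis j (t - 1 / 2) = (t - 1 / 2) * (\<Prod>i<j. t - 1 - real i) * ?R / fact (2 * j + 1)"
    using odd_basis_shift[of j "t - 1"] by simp
  define F :: real where "F = fact (2 * j + 1)"
  have f: "F = (2 * real j + 1) * fact (2 * j)" by (simp add: F_def)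
  \<comment> \<open>The factor t completes the products of t + 1 + i and of t - 1 - i to products of
    t + i and of t - i; it is cancelled at the end.\<close>
  have "t * (odd_basis j (t + 1 / 2) - odd_basis j (t - 1 / 2))
     = ((t + 1 / 2) * ?A * (t * (\<Prod>i<j. t + 1 + real i)) - (t - 1 / 2)
         * (t * (\<Prod>i<j. t - 1 - real i)) * ?R) / F"
    unfolding 3 odd_basis_shift F_def[symmetric]
    by (simp only: right_diff_distrib diff_divide_distrib times_divide_eq_right mult_ac)
  also have "\<dots> = ?A * ?R * ((t + 1 / 2) * (t + real j) - (t - 1 / 2) * (t - real j)) / F"
  proof -
    have "x * A * (R * y) - x' * (A * y') * R = A * R * (x * y - x' * y')" for x y x' y' A R :: real
      by (simp add: algebra_simps)
    then show ?thesis unfolding 1 2 by simp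
  qed
  also have "(t + 1 / 2) * (t + real j) - (t - 1 / 2) * (t - real j) = t * (2 * real j + 1)"
    by (simp add: field_simps)
  also have "?A * ?R * (t * (2 * real j + 1)) / F = t * even_basis j t"
  proof -
    have "2 * real j + 1 \<noteq> 0" by linarith
    then show ?thesis unfolding even_basis_factor f by (simp add: mult_ac)
  qed
  finally show ?thesis using assms by simp
qed

lemma sum_odd_basis: "(\<Sum>y<g. odd_basis j (real y + 1 / 2)) = even_basis (Suc j) (real g)"
proof (induction g)
  case 0
  have "(\<Prod>i<Suc j. 0 - real i) = 0" by (rule prod_zero) auto
  then show ?case by (simp add: even_basis_factor del: prod.lessThan_Suc)
next
  case (Suc g)
  then show ?case using even_basis_diff[of j "real g"] by (simp add: add.commute)
qed

text \<open>The weight of a vertical lozenge at position y of an odd height; position 0 is at the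
  zigzag. Since \<open>odd_basis j\<close> is an odd function, its difference across 0 is twice its
  value at 1/2, so half of \<open>even_basis j 0\<close> is exactly
  \<open>odd_basis j (1/2)\<close>.\<close>

definition half_weight :: "nat \<Rightarrow> real" where
  "half_weight y = (if y = 0 then 1 / 2 else 1)"

text \<open>Telescoping from the halved value at 0. The empty sum is a separate case because
  \<open>odd_basis j (- 1/2)\<close> need not vanish.\<close>

lemma sum_even_basis:
  "(\<Sum>y<g. half_weight y * even_basis j (real y))
      = (if g = 0 then 0 else odd_basis j (real g - 1 / 2))"
proof (induction g)
  case (Suc g)
  show ?case
  proof (cases "g = 0")
    case True
    show ?thesis
    proof (cases j)
      case 0
      then show ?thesis using True by (simp add: half_weight_def even_basis_def odd_basis_def)
    next
      case (Suc j')
      then have z: "(\<Prod>i<j. 0 - real i) = 0" by (intro prod_zero) auto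
      have "odd_basis j (0 + 1 / 2) = 0" "even_basis j 0 = 0"
        unfolding odd_basis_shift even_basis_factor z by simp_all
      then show ?thesis using True by simp
    qed
  next
    case False
    then show ?thesis
      using Suc.IH odd_basis_diff[of "real g" j] by (simp add: half_weight_def add.commute)
  qed
qed simp

text \<open>\<open>odet\<close> and \<open>edet\<close> will be the weights of the strip above an
  odd, respectively even, height as functions of the dents on that height.\<close>

definition odet :: "nat \<Rightarrow> (nat \<Rightarrow> nat) \<Rightarrow> real" where
  "odet l y = fdet l (\<lambda>i j. even_basis j (real (y i)))"

definition edet :: "nat \<Rightarrow> (nat \<Rightarrow> nat) \<Rightarrow> real" where
  "edet l x = fdet l (\<lambda>i j. odd_basis j (real (x i) + 1 / 2))"

lemma sum_gap:
  fixes f :: "nat \<Rightarrow> real"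
  shows "a \<le> b \<Longrightarrow> (\<Sum>y\<in>{a..<b}. f y) = (\<Sum>y<b. f y) - (\<Sum>y<a. f y)"
  using sum.atLeastLessThan_concat[of 0 a b f] by (simp add: atLeast0LessThan)

text \<open>The sum over each window is a difference of antidifferences at its ends, and such row
  differences do not change the determinant. \<open>g 0 = 0\<close> makes the first window start at
  the halved position; the end g - 1/2 is read as (g - 1) + 1/2.\<close>

lemma sum_gaps_odet:
  assumes "strict_mono_on {..l} g" "g 0 = 0"
  shows "(\<Sum>f\<in>gaps l g. (\<Prod>i<l. half_weight (f i)) * odet l f) = edet l (\<lambda>i. g (Suc i) - 1)"
proof -
  have "(\<Sum>f\<in>gaps l g. (\<Prod>i<l. half_weight (f i)) * odet l f)
     = (\<Sum>f\<in>gaps l g. fdet l (\<lambda>i j. half_weight (f i) * even_basis j (real (f i))))"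
    by (simp add: odet_def fdet_row_factor)
  also have "\<dots> = fdet l (\<lambda>i j. \<Sum>y\<in>{g i..<g (Suc i)}. half_weight y * even_basis j (real y))"
    unfolding gaps_def
    using fdet_sum_rows[of l "\<lambda>i. {g i..<g (Suc i)}" "\<lambda>i y j. half_weight y * even_basis j
        (real y)"] by simp
  also have "\<dots> = fdet l (\<lambda>i j. odd_basis j (real (g (Suc i) - 1) + 1 / 2)
     - (if i = 0 then 0 else 1 * odd_basis j (real (g (Suc (i - 1)) - 1) + 1 / 2)))"
  proof (rule fdet_cong)
    fix i j assume i: "i < l"
    have lt: "g i < g (Suc i)" by (rule strict_mono_onD[OF assms(1)]) (use i in auto)
    have pos: "g i > 0" if "i \<noteq> 0"
      using strict_mono_onD[OF assms(1), of 0 i] that i by auto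
    have e: "real (n - 1) + 1 / 2 = real n - 1 / 2" if "n > 0" for n using that by simp
    show "(\<Sum>y\<in>{g i..<g (Suc i)}. half_weight y * even_basis j (real y))
      = odd_basis j (real (g (Suc i) - 1) + 1 / 2) - (if i = 0 then 0 else 1 * odd_basis j
          (real (g (Suc (i - 1)) - 1) + 1 / 2))"
      using lt pos assms(2) by (cases "i = 0") (simp_all add: sum_gap sum_even_basis e)
  qed
  also have "\<dots> = edet l (\<lambda>i. g (Suc i) - 1)"
    unfolding edet_def by (rule fdet_row_diff)
  finally show ?thesis .
qed

text \<open>The l + 1 ends yield only l row differences. The missing row and column come from
  bordering with the constant function \<open>even_basis 0\<close>, and the order grows by
  1.\<close>

lemma sum_gaps_edet:
  assumes "strict_mono_on {..l} g"
  shows "(\<Sum>f\<in>gaps l g. edet l f) = odet (Suc l) g"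
proof -
  have "(\<Sum>f\<in>gaps l g. edet l f) = fdet l (\<lambda>i j. \<Sum>y\<in>{g i..<g (Suc i)}. odd_basis j (real y + 1 / 2))"
    unfolding gaps_def edet_def
    using fdet_sum_rows[of l "\<lambda>i. {g i..<g (Suc i)}" "\<lambda>i y j. odd_basis j (real y + 1 / 2)"] by simp
  also have "\<dots> = fdet l (\<lambda>i j. even_basis (Suc j) (real (g (Suc i))) - even_basis (Suc j)
      (real (g i)))"
  proof (rule fdet_cong)
    fix i j assume i: "i < l"
    have lt: "g i < g (Suc i)" by (rule strict_mono_onD[OF assms(1)]) (use i in auto)
    then show "(\<Sum>y\<in>{g i..<g (Suc i)}. odd_basis j (real y + 1 / 2))
      = even_basis (Suc j) (real (g (Suc i))) - even_basis (Suc j) (real (g i))"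
      by (simp add: sum_gap sum_odd_basis)
  qed
  \<comment> \<open>Column 0 is constantly 1, so after the row differences only its top entry is
    left.\<close>
  also have "\<dots> = fdet (Suc l) (\<lambda>i j. even_basis j (real (g i)) - (if i
      = 0 then 0 else 1 * even_basis j (real (g (i - 1)))))"
    by (subst fdet_Suc_col) (simp_all add: even_basis_def)
  also have "\<dots> = odet (Suc l) g" unfolding odet_def by (rule fdet_row_diff)
  finally show ?thesis .
qed

section \<open>Transfer from row to row in a quartered hexagon with unit dents\<close>

definition west :: "nat \<Rightarrow> int" where
  "west k = - ((int k + 1) div 2)"

text \<open>Position \<open>j\<close> counts the unit edges of height \<open>k\<close> eastwards
  from the zigzag vertex \<open>(west k, k)\<close>. With this origin the dents of all heights are
  natural numbers and the zigzag is always at 0.\<close>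

abbreviation up_cell :: "nat \<Rightarrow> nat \<Rightarrow> face" where
  "up_cell k j \<equiv> Up (west k + int j) (int k)"

abbreviation down_cell :: "nat \<Rightarrow> nat \<Rightarrow> face" where
  "down_cell k j \<equiv> Down (west k + int j) (int k)"

lemma zigzag_le_iff: "zigzag_coord k \<le> hcoord (p, k) \<longleftrightarrow> - ((k + 1) div 2) \<le> p"
proof (cases "even k")
  case True
  then obtain m where "k = 2 * m" by (elim evenE)
  then show ?thesis by (simp add: zigzag_coord_def hcoord_def) linarith
next
  case False
  then obtain m where k: "k = 2 * m + 1" by (elim oddE)
  have "zigzag_coord k \<le> hcoord (p, k) \<longleftrightarrow> real_of_int (- m - 1) \<le> real_of_int p"
    using k by (simp add: zigzag_coord_def hcoord_def add_divide_distrib) linarith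
  also have "\<dots> \<longleftrightarrow> - m - 1 \<le> p" by (rule of_int_le_iff)
  finally show ?thesis using k by simp presburger
qed

lemma hcoord_le_iff: "hcoord (p, k) \<le> real L - of_int k / 2 \<longleftrightarrow> p + k \<le> int L"
proof -
  have "hcoord (p, k) \<le> real L - of_int k / 2 \<longleftrightarrow> real_of_int (p + k) \<le> real_of_int (int L)"
    by (simp add: hcoord_def) linarith
  then show ?thesis unfolding of_int_le_iff .
qed

lemma upper_part_iff:
  "f \<in> upper_part L A \<longleftrightarrow> (\<forall>(p, k)\<in>verts f. 0 \<le> k \<and> k \<le> int A \<and> - ((k + 1) div 2) \<le> p \<and> p + k \<le> int
      L)"
  unfolding upper_part_def by (auto simp: zigzag_le_iff hcoord_le_iff)

lemma Up_upper_part: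
  "Up p k \<in> upper_part L A \<longleftrightarrow> 0 \<le> k \<and> k < int A \<and> - ((k + 1) div 2) \<le> p \<and> p + k < int L"
  unfolding upper_part_iff by auto

lemma Down_upper_part:
  "Down p k \<in> upper_part L A \<longleftrightarrow> 1 \<le> k \<and> k \<le> int A \<and> - ((k + 1) div 2) \<le> p \<and> p + k < int L"
  unfolding upper_part_iff by auto

lemma finite_upper_part: "finite (upper_part L A)"
proof -
  have "upper_part L A \<subseteq> (\<lambda>(p, k). Up p k) ` ({- int A - 1..int L + int A} \<times> {0..int A})
      \<union> (\<lambda>(p, k). Down p k) ` ({- int A - 1..int L + int A} \<times> {0..int A})"
  proof
    fix f assume f: "f \<in> upper_part L A"
    show "f \<in> (\<lambda>(p, k). Up p k) ` ({- int A - 1..int L + int A} \<times> {0..int A})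
      \<union> (\<lambda>(p, k). Down p k) ` ({- int A - 1..int L + int A} \<times> {0..int A})"
    proof (cases f)
      case (Up p k)
      then have "(p, k) \<in> {- int A - 1..int L + int A} \<times> {0..int A}" using f
          by (auto simp: Up_upper_part)
      then show ?thesis using Up by force
    next
      case (Down p k)
      then have "(p, k) \<in> {- int A - 1..int L + int A} \<times> {0..int A}" using f
          by (auto simp: Down_upper_part)
      then show ?thesis using Down by force
    qed
  qed
  then show ?thesis by (rule finite_subset) auto
qed

text \<open>The properties of the weight that the computation uses. They hold for the zigzag weight
  and for its pull-back under reflection, so both parts of the region are covered by one
  argument.\<close>

definition upper_weight :: "nat \<Rightarrow> (face set \<Rightarrow> real) \<Rightarrow> bool" where
  "upper_weight A w \<longleftrightarrow> (\<forall>k n. w {rface k n, rface k (n + 1)} = 1) \<and>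
     (\<forall>k j. 1 \<le> k \<longrightarrow> k < A \<longrightarrow>
        w {up_cell k j, down_cell k j} = (if odd k then half_weight j else 1))"

lemma upper_weightD:
  assumes "upper_weight A w"
  shows "w {rface k n, rface k (n + 1)} = 1"
    "1 \<le> i \<Longrightarrow> i < A \<Longrightarrow>
       w {up_cell i j, down_cell i j} = (if odd i then half_weight j else 1)"
  using assms unfolding upper_weight_def by blast+

definition strip :: "nat \<Rightarrow> nat \<Rightarrow> nat \<Rightarrow> nat set \<Rightarrow> face set" where
  "strip L A k X = {f \<in> upper_part L A. int k \<le> face_row f} - (\<lambda>j. up_cell k j) ` X"

lemma M_row_shift:
  assumes "finite K" "\<And>n. w {rface k n, rface k (n + 1)} = 1"
  shows "M ((\<lambda>m. rface k (c + m)) ` K, w) = (if \<forall>n. n \<notin> K \<longrightarrow> even (card {m \<in> K. m < n}) then 1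
      else 0)"
proof -
  have "card {m \<in> (+) c ` K. m < n} = card {m \<in> K. m < n - c}" for n
  proof -
    have "{m \<in> (+) c ` K. m < n} = (+) c ` {m \<in> K. m < n - c}" by auto
    then show ?thesis by (simp add: card_image)
  qed
  moreover have "n \<in> (+) c ` K \<longleftrightarrow> n - c \<in> K" for n by force
  ultimately have "(\<forall>n. n \<notin> (+) c ` K \<longrightarrow> even (card {m \<in> (+) c ` K. m < n})) \<longleftrightarrow> (\<forall>n. n - c \<notin> K
      \<longrightarrow> even (card {m \<in> K. m < n - c}))"
    by simp
  also have "\<dots> \<longleftrightarrow> (\<forall>n. n \<notin> K \<longrightarrow> even (card {m \<in> K. m < n}))"
    by (metis add_diff_cancel)
  finally show ?thesis
    using M_row[of "(+) c ` K" w k] assms by (simp add: image_image)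
qed

text \<open>The number of unit edges at height k: the eastern bound on p drops by k, the western one
  by (k + 1) div 2.\<close>

definition row_length :: "nat \<Rightarrow> nat \<Rightarrow> nat" where
  "row_length L k = L - k div 2"

text \<open>The cut at height k + 1 separates row k from the strip above it; the crossing lozenges,
  at positions Y, are dents for both sides. Height k + 1 is odd, and so weighted at the zigzag, iff
  k is even.\<close>

lemma strip_step:
  assumes w: "upper_weight A w" and k: "k < A"
  shows "M (strip L A k X, w) = (\<Sum>Y | Y \<subseteq> (if Suc k < A then {..<row_length L (Suc k)} else {}).
     (\<Prod>j\<in>Y. if even k then half_weight j else 1)
     * M ({f \<in> strip L A k X. face_row f = int k} - (\<lambda>j. down_cell (Suc k) j) ` Y, w)
     * M (strip L A (Suc k) Y, w))"
proof -
  let ?R = "strip L A k X" and ?k = "int k + 1"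
  let ?C = "{p. Up p ?k \<in> ?R \<and> Down p ?k \<in> ?R}"
  \<comment> \<open>No lozenge crosses the north side.\<close>
  let ?D = "if Suc k < A then {..<row_length L (Suc k)} else {}"
  let ?i = "\<lambda>j. west (Suc k) + int j"
  have inj: "inj ?i" by (auto simp: inj_def)
  have C: "?C = ?i ` ?D"
  proof (intro equalityI subsetI)
    fix p assume "p \<in> ?C"
    then have *: "int k + 1 < int A" "- ((int k + 2) div 2) \<le> p" "p + int k + 1 < int L"
      by (auto simp: strip_def Up_upper_part add.assoc)
    define j where "j = nat (p - west (Suc k))"
    have "j < row_length L (Suc k)" and p: "p = ?i j"
      using * by (auto simp: row_length_def west_def j_def)
    then have "j \<in> ?D" using * by auto
    then show "p \<in> ?i ` ?D" unfolding p by (rule imageI)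
  next
    fix p assume "p \<in> ?i ` ?D"
    then obtain j where j: "p = ?i j" "Suc k < A" "j < row_length L (Suc k)"
        by (auto split: if_splits)
    then have "Up p ?k \<in> upper_part L A" "Down p ?k \<in> upper_part L A"
      unfolding Up_upper_part Down_upper_part by (auto simp: row_length_def west_def)
    then show "p \<in> ?C" by (auto simp: strip_def)
  qed
  have "M (?R, w) = (\<Sum>Z | Z \<subseteq> ?C. (\<Prod>p\<in>Z. w {Up p ?k, Down p ?k})
       * M ({f \<in> ?R. face_row f < ?k} - (\<lambda>p. Down p ?k) ` Z, w)
           * M ({f \<in> ?R. ?k \<le> face_row f} - (\<lambda>p. Up p ?k) ` Z, w))"
    by (rule M_cut) (simp add: strip_def finite_upper_part)
  also have "{f \<in> ?R. face_row f < ?k} = {f \<in> ?R. face_row f = int k}" by (auto simp: strip_def)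
  also have "{f \<in> ?R. ?k \<le> face_row f} = {f \<in> upper_part L A. int (Suc k) \<le> face_row f}"
      by (auto simp: strip_def)
  also have "(\<Sum>Z | Z \<subseteq> ?C. (\<Prod>p\<in>Z. w {Up p ?k, Down p ?k})
       * M ({f \<in> ?R. face_row f = int k} - (\<lambda>p. Down p ?k) ` Z, w)
           * M ({f \<in> upper_part L A. int (Suc k) \<le> face_row f} - (\<lambda>p. Up p ?k) ` Z, w))
     = (\<Sum>Y | Y \<subseteq> ?D. (\<Prod>p\<in>?i ` Y. w {Up p ?k, Down p ?k})
       * M ({f \<in> ?R. face_row f = int k} - (\<lambda>p. Down p ?k) ` ?i ` Y, w)
           * M ({f \<in> upper_part L A. int (Suc k) \<le> face_row f} - (\<lambda>p. Up p ?k) ` ?i ` Y, w))"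
    unfolding C
  proof (rule sum.reindex_bij_witness[of _ "(`) ?i" "\<lambda>Z. ?i -` Z"])
    fix Z assume "Z \<in> {Z. Z \<subseteq> ?i ` ?D}"
    then have Z: "Z \<subseteq> ?i ` ?D" by simp
    then show "?i ` ?i -` Z = Z" by (auto simp: image_vimage_eq)
    then show "(\<Prod>p\<in>?i ` ?i -` Z. w {Up p ?k, Down p ?k})
       * M ({f \<in> ?R. face_row f = int k} - (\<lambda>p. Down p ?k) ` ?i ` ?i -` Z, w)
           * M ({f \<in> upper_part L A. int (Suc k) \<le> face_row f} - (\<lambda>p. Up p ?k) ` ?i ` ?i -` Z, w)
       = (\<Prod>p\<in>Z. w {Up p ?k, Down p ?k})
       * M ({f \<in> ?R. face_row f = int k} - (\<lambda>p. Down p ?k) ` Z, w)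
           * M ({f \<in> upper_part L A. int (Suc k) \<le> face_row f} - (\<lambda>p. Up p ?k) ` Z, w)"
      by simp
    show "?i -` Z \<in> {Y. Y \<subseteq> ?D }" using Z inj by (auto dest: injD)
  next
    fix Y assume "Y \<in> {Y. Y \<subseteq> ?D }"
    then show "?i ` Y \<in> {Z. Z \<subseteq> ?i ` ?D}" by auto
    show "?i -` ?i ` Y = Y" by (rule inj_vimage_image_eq[OF inj])
  qed
  also have "\<dots> = (\<Sum>Y | Y \<subseteq> ?D.
     (\<Prod>j\<in>Y. if even k then half_weight j else 1)
     * M ({f \<in> ?R. face_row f = int k} - (\<lambda>j. down_cell (Suc k) j) ` Y, w)
     * M (strip L A (Suc k) Y, w))"
  proof (rule sum.cong[OF refl])
    fix Y assume "Y \<in> {Y. Y \<subseteq> ?D }"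
    then have Y: "Y \<subseteq> ?D" by simp
    have k1: "?k = int (Suc k)" by simp
    have "(\<Prod>p\<in>?i ` Y. w {Up p ?k, Down p ?k})
        = (\<Prod>j\<in>Y. w {Up (?i j) (int (Suc k)), Down (?i j) (int (Suc k))})"
      unfolding k1 by (subst prod.reindex) (auto simp: inj_on_def)
    also have "\<dots> = (\<Prod>j\<in>Y. if even k then half_weight j else 1)"
    proof (rule prod.cong[OF refl])
      fix j assume "j \<in> Y"
      then have "Suc k < A" using Y by (auto split: if_splits)
      then show "w {Up (?i j) (int (Suc k)), Down (?i j) (int (Suc k))}
          = (if even k then half_weight j else 1)"
        using upper_weightD(2)[OF w, of "Suc k" j] by simp
    qed
    finally show "(\<Prod>p\<in>?i ` Y. w {Up p ?k, Down p ?k})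
       * M ({f \<in> ?R. face_row f = int k} - (\<lambda>p. Down p ?k) ` ?i ` Y, w)
           * M ({f \<in> upper_part L A. int (Suc k) \<le> face_row f} - (\<lambda>p. Up p ?k) ` ?i ` Y, w)
      = (\<Prod>j\<in>Y. if even k then half_weight j else 1)
     * M ({f \<in> ?R. face_row f = int k} - (\<lambda>j. down_cell (Suc k) j) ` Y, w)
     * M (strip L A (Suc k) Y, w)"
      unfolding strip_def k1 image_image by simp
  qed
  finally show ?thesis .
qed

lemma row_cells:
  "{f \<in> strip L A k X. face_row f = int k} - (\<lambda>j. down_cell (Suc k) j) ` Y
    = ((\<lambda>j. up_cell k j) ` ({..<row_length L k} - X))
        \<union> ((\<lambda>j. down_cell (Suc k) j) ` ({..<row_length L (Suc k)} - Y))"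
  if "k < A"
proof (intro equalityI subsetI)
  fix f assume f: "f \<in> {f \<in> strip L A k X. face_row f = int k} - (\<lambda>j. down_cell (Suc k) j) ` Y"
  show "f \<in> ((\<lambda>j. up_cell k j) ` ({..<row_length L k} - X))
      \<union> ((\<lambda>j. down_cell (Suc k) j) ` ({..<row_length L (Suc k)} - Y))"
  proof (cases f)
    case (Up p k')
    then have k': "k' = int k" and p: "- ((int k + 1) div 2) \<le> p" "p + int k < int L" using f
        by (auto simp: strip_def Up_upper_part)
    define j where "j = nat (p - west k)"
    have j: "j < row_length L k" "p = west k + int j"
      using p by (auto simp: row_length_def west_def j_def)
    then have "j \<notin> X" using f Up k' by (auto simp: strip_def)
    then show ?thesis using j Up k' by blast
  next
    case (Down p k')
    then have k': "k' = int (Suc k)" and p: "- ((int (Suc k) + 1) div 2) \<le> p" "p + int (Suc k)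
        < int L"
      using f by (auto simp: strip_def Down_upper_part)
    define j where "j = nat (p - west (Suc k))"
    have j: "j < row_length L (Suc k)" "p = west (Suc k) + int j"
      using p by (auto simp: row_length_def west_def j_def)
    then have "j \<notin> Y" using f Down k' by auto
    then show ?thesis using j Down k' by blast
  qed
next
  fix f assume "f \<in> ((\<lambda>j. up_cell k j) ` ({..<row_length L k} - X))
      \<union> ((\<lambda>j. down_cell (Suc k) j) ` ({..<row_length L (Suc k)} - Y))"
  then show "f \<in> {f \<in> strip L A k X. face_row f = int k} - (\<lambda>j. down_cell (Suc k) j) ` Y"
  proof
    assume "f \<in> (\<lambda>j. up_cell k j) ` ({..<row_length L k} - X)"
    then obtain j where j: "f = up_cell k j" "j < row_length L k" "j \<notin> X" by auto
    then have "f \<in> upper_part L A" using that by (auto simp: Up_upper_part row_length_def west_def)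
    then show ?thesis using j by (auto simp: strip_def)
  next
    assume "f \<in> (\<lambda>j. down_cell (Suc k) j) ` ({..<row_length L (Suc k)} - Y)"
    then obtain j where j: "f = down_cell (Suc k) j" "j < row_length L (Suc k)" "j \<notin> Y" by auto
    then have "f \<in> upper_part L A" using that by (auto simp: Down_upper_part row_length_def
        west_def)
    then show ?thesis using j by (auto simp: strip_def)
  qed
qed

text \<open>An even row begins with a down cell, whereas \<open>M_interlacing\<close> expects an up
  cell, numbered - 1, in front. A fictitious up cell is added at 0 and declared a dent, which shifts
  the true dents by 1.\<close>

definition prepend :: "(nat \<Rightarrow> nat) \<Rightarrow> nat \<Rightarrow> nat" where
  "prepend x i = (case i of 0 \<Rightarrow> 0 | Suc i' \<Rightarrow> Suc (x i'))"

lemma prepend_simps [simp]: "prepend x 0 = 0" "prepend x (Suc i) = Suc (x i)"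
  by (simp_all add: prepend_def)

lemma strict_mono_prepend:
  assumes "strict_mono_on {..<l} x"
  shows "strict_mono_on {..l} (prepend x)"
proof (rule strict_mono_onI)
  fix i j assume ij: "i \<in> {..l}" "j \<in> {..l}" "i < j"
  then obtain j' where j: "j = Suc j'" by (cases j) auto
  show "prepend x i < prepend x j"
  proof (cases i)
    case (Suc i')
    have "x i' < x j'" by (rule strict_mono_onD[OF assms]) (use ij j Suc in auto)
    then show ?thesis using j Suc by simp
  qed (simp add: j)
qed

lemma interlacing_cells:
  fixes g :: "nat \<Rightarrow> nat"
  shows "{- 1..<2 * int h} - ((\<lambda>i. 2 * int (g i) - 1) ` I \<union> (\<lambda>t. 2 * int t) ` Y)
    = (\<lambda>j. 2 * int j - 1) ` ({..h} - g ` I) \<union> (\<lambda>j. 2 * int j) ` ({..<h} - Y)"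
proof (intro equalityI subsetI)
  fix m assume m: "m \<in> {- 1..<2 * int h} - ((\<lambda>i. 2 * int (g i) - 1) ` I \<union> (\<lambda>t. 2 * int t) ` Y)"
  show "m \<in> (\<lambda>j. 2 * int j - 1) ` ({..h} - g ` I) \<union> (\<lambda>j. 2 * int j) ` ({..<h} - Y)"
  proof (cases "even m")
    case True
    define j where "j = nat (m div 2)"
    have "m \<noteq> - 1" using True by auto
    then have j: "m = 2 * int j" "j < h" using True m by (auto simp: j_def)
    then have "j \<notin> Y" using m by auto
    then show ?thesis using j by auto
  next
    case False
    then obtain b where b: "m = 2 * b + 1" by (elim oddE)
    define j where "j = nat (b + 1)"
    have j: "m = 2 * int j - 1" "j \<le> h" using b m by (auto simp: j_def)
    then have "j \<notin> g ` I" using m by auto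
    then show ?thesis using j by auto
  qed
next
  fix m assume m: "m \<in> (\<lambda>j. 2 * int j - 1) ` ({..h} - g ` I) \<union> (\<lambda>j. 2 * int j) ` ({..<h} - Y)"
  then show "m \<in> {- 1..<2 * int h} - ((\<lambda>i. 2 * int (g i) - 1) ` I \<union> (\<lambda>t. 2 * int t) ` Y)"
  proof
    assume "m \<in> (\<lambda>j. 2 * int j - 1) ` ({..h} - g ` I)"
    then obtain j where j: "m = 2 * int j - 1" "j \<le> h" "j \<notin> g ` I" by auto
    have "odd m" using j(1) by simp
    then have "m \<notin> (\<lambda>t. 2 * int t) ` Y" by auto
    moreover have "m \<notin> (\<lambda>i. 2 * int (g i) - 1) ` I" using j by auto
    ultimately show ?thesis using j by auto
  next
    assume "m \<in> (\<lambda>j. 2 * int j) ` ({..<h} - Y)"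
    then obtain j where j: "m = 2 * int j" "j < h" "j \<notin> Y" by auto
    have "2 * int j \<noteq> 2 * i - 1" for i by presburger
    then have "m \<notin> (\<lambda>i. 2 * int (g i) - 1) ` I" using j(1) by auto
    then show ?thesis using j by auto
  qed
qed

lemma M_interlacing:
  assumes "strict_mono_on {..l} g" "g l \<le> h" "Y \<subseteq> {..<h}" "\<And>n. w {rface k n, rface k (n + 1)} = 1"
  shows "M ((\<lambda>m. rface k (c + m)) ` ((\<lambda>j. 2 * int j - 1) ` ({..h} - g ` {..l})
      \<union> (\<lambda>j. 2 * int j) ` ({..<h} - Y)), w)
    = (if Y \<in> (\<lambda>f. f ` {..<l}) ` gaps l g then 1 else 0)"
proof -
  let ?K = "{- 1..<2 * int h} - ((\<lambda>i. 2 * int (g i) - 1) ` {..l} \<union> (\<lambda>t. 2 * int t) ` Y)"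
  have "M ((\<lambda>m. rface k (c + m)) ` ?K, w) = (if \<forall>n. n \<notin> ?K \<longrightarrow> even (card {m \<in> ?K. m < n}) then 1
      else 0)"
    by (rule M_row_shift) (simp_all add: assms(4))
  then show ?thesis unfolding row_interlacing[OF assms(1-3)] unfolding interlacing_cells .
qed

lemma rface_even [simp]: "rface k (2 * p) = Up p k" "rface k (p * 2) = Up p k"
  by (simp_all add: rface_def)

lemma rface_odd [simp]: "rface k (2 * p + 1) = Down p (k + 1)"
  by (simp add: rface_def)

text \<open>An odd row begins and ends with an up cell, so it has one position more below than
  above; l + 1 dents below interlace with l above.\<close>

lemma M_row_odd:
  assumes w: "upper_weight A w" and k: "odd k" "k < A" and g: "strict_mono_on {..l} g"
    and X: "g l < row_length L k" and Y: "Y \<subseteq> {..<row_length L (Suc k)}"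
  shows "M ({f \<in> strip L A k (g ` {..l}). face_row f = int k} - (\<lambda>j. down_cell (Suc k) j) ` Y, w)
    = (if Y \<in> (\<lambda>f. f ` {..<l}) ` gaps l g then 1 else 0)"
proof -
  have h: "{..<row_length L k} = {..row_length L (Suc k)}" "g l \<le> row_length L (Suc k)"
    using k X by (auto simp: row_length_def elim!: oddE)
  have pmS: "west (Suc k) = west k" using k(1) by (auto simp: west_def elim!: oddE)
  \<comment> \<open>This offset puts up cell j at 2 j - 1 and down cell j at 2 j, as in
    \<open>M_interlacing\<close>.\<close>
  let ?c = "2 * west k + 1"
  have u: "up_cell k j = rface (int k) (?c + (2 * int j - 1))" for j
    using rface_even(1)[of "int k" "west k + int j"] by (simp add: algebra_simps)
  have d: "down_cell (Suc k) j = rface (int k) (?c + 2 * int j)" for j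
    using rface_odd[of "int k" "west k + int j"] by (simp add: algebra_simps pmS)
  have "{f \<in> strip L A k (g ` {..l}). face_row f = int k} - (\<lambda>j. down_cell (Suc k) j) ` Y
     = (\<lambda>m. rface (int k) (?c + m)) ` ((\<lambda>j. 2 * int j - 1) ` ({..row_length L (Suc k)} - g
         ` {..l}) \<union> (\<lambda>j. 2 * int j) ` ({..<row_length L (Suc k)} - Y))"
    unfolding row_cells[OF k(2)] unfolding image_Un image_image u d h(1) ..
  then show ?thesis
    using M_interlacing[OF g h(2) Y] upper_weightD(1)[OF w] by simp
qed

lemma M_row_even:
  assumes w: "upper_weight A w" and k: "even k" "k < A" and x: "strict_mono_on {..<l} x"
    and X: "x ` {..<l} \<subseteq> {..<row_length L k}" and Y: "Y \<subseteq> {..<row_length L (Suc k)}"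
  shows "M ({f \<in> strip L A k (x ` {..<l}). face_row f = int k} - (\<lambda>j. down_cell (Suc k) j) ` Y, w)
    = (if Y \<in> (\<lambda>f. f ` {..<l}) ` gaps l (prepend x) then 1 else 0)"
proof -
  have h: "row_length L k = row_length L (Suc k)" using k(1)
      by (auto simp: row_length_def elim!: evenE)
  have pmS: "west (Suc k) = west k - 1" using k(1) by (auto simp: west_def elim!: evenE)
  let ?c = "2 * west k - 1" and ?h = "row_length L (Suc k)"
  have u: "up_cell k j = rface (int k) (?c + (2 * int (Suc j) - 1))" for j
    using rface_even(1)[of "int k" "west k + int j"] by (simp add: algebra_simps)
  have d: "down_cell (Suc k) j = rface (int k) (?c + 2 * int j)" for j
    using rface_odd[of "int k" "west k + int j - 1"] by (simp add: algebra_simps pmS)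
  have "{..?h} - prepend x ` {..l} = Suc ` ({..<?h} - x ` {..<l})"
  proof -
    have "prepend x ` {..l} = insert 0 (Suc ` x ` {..<l})"
      by (simp add: lessThan_Suc_atMost[symmetric] lessThan_Suc_eq_insert_0 image_image)
    moreover have "{..?h} = insert 0 (Suc ` {..<?h})"
      by (metis lessThan_Suc_atMost lessThan_Suc_eq_insert_0)
    ultimately show ?thesis by auto
  qed
  then have "{f \<in> strip L A k (x ` {..<l}). face_row f = int k} - (\<lambda>j. down_cell (Suc k) j) ` Y
     = (\<lambda>m. rface (int k) (?c + m)) ` ((\<lambda>j. 2 * int j - 1) ` ({..?h} - prepend x ` {..l})
         \<union> (\<lambda>j. 2 * int j) ` ({..<?h} - Y))"
    unfolding row_cells[OF k(2)] unfolding h u d by (simp only: image_Un image_image)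
  moreover have "prepend x l \<le> ?h"
  proof (cases l)
    case (Suc l')
    then have "x l' \<in> {..<row_length L k}" using X by blast
    then show ?thesis using Suc h by simp
  qed simp
  ultimately show ?thesis
    using M_interlacing[OF strict_mono_prepend[OF x] _ Y] upper_weightD(1)[OF w] by simp
qed

lemma sum_indicator_image:
  assumes "finite D" "inj_on h G" "h ` G \<subseteq> D"
  shows "(\<Sum>Y\<in>D. c Y * (if Y \<in> h ` G then 1 else 0) * F Y) = (\<Sum>f\<in>G. c (h f) * (F (h f) :: real))"
proof -
  have "(\<Sum>Y\<in>D. c Y * (if Y \<in> h ` G then 1 else 0) * F Y) = (\<Sum>Y\<in>h ` G. c Y * F Y)"
    by (rule sum.mono_neutral_cong_right) (use assms in auto)
  also have "\<dots> = (\<Sum>f\<in>G. c (h f) * F (h f))" by (simp add: sum.reindex[OF assms(2)])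
  finally show ?thesis .
qed

text \<open>The first half of the induction step of \<open>M_strip_even\<close>, whose hypothesis
  enters as the assumption \<open>IH\<close>.\<close>

lemma M_strip_odd:
  assumes w: "upper_weight A w" and A: "even A" and l: "Suc (2 * l) \<le> A"
    and IH: "\<And>x. strict_mono_on {..<l} x \<Longrightarrow> x ` {..<l} \<subseteq> {..<row_length L (A - 2 * l)} \<Longrightarrow>
       M (strip L A (A - 2 * l) (x ` {..<l}), w) = edet l x"
    and g: "strict_mono_on {..l} g" "g l < row_length L (A - Suc (2 * l))"
  shows "M (strip L A (A - Suc (2 * l)) (g ` {..l}), w) = odet (Suc l) g"
proof -
  let ?k = "A - Suc (2 * l)"
  have k: "odd ?k" "?k < A" "Suc ?k = A - 2 * l" using A l by auto
  let ?D = "if Suc ?k < A then {..<row_length L (Suc ?k)} else {}"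
  have row_length: "row_length L ?k = Suc (row_length L (Suc ?k))" using k(1) g(2)
      by (auto simp: row_length_def elim!: oddE)
  have inD: "f ` {..<l} \<subseteq> {..<row_length L (Suc ?k)}" if "f \<in> gaps l g" for f
  proof
    fix t assume "t \<in> f ` {..<l}"
    then obtain i where i: "i < l" "t = f i" by blast
    have "f i < g (Suc i)" using gapsD[OF that i(1)] by simp
    also have "g (Suc i) \<le> g l" by (rule strict_mono_on_leD[OF g(1)]) (use i in auto)
    finally show "t \<in> {..<row_length L (Suc ?k)}" using g(2) row_length i by simp
  qed
  have "M (strip L A ?k (g ` {..l}), w) = (\<Sum>Y | Y \<subseteq> ?D. (\<Prod>j\<in>Y. if even ?k then half_weight j else 1)
     * (if Y \<in> (\<lambda>f. f ` {..<l}) ` gaps l g then 1 else 0) * M (strip L A (Suc ?k) Y, w))"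
    unfolding strip_step[OF w k(2)]
  proof (rule sum.cong[OF refl])
    fix Y assume "Y \<in> {Y. Y \<subseteq> ?D}"
    then have "Y \<subseteq> {..<row_length L (Suc ?k)}" by (auto split: if_splits)
    then show "(\<Prod>j\<in>Y. if even ?k then half_weight j else 1)
      * M ({f \<in> strip L A ?k (g ` {..l}). face_row f = int ?k} - (\<lambda>j. down_cell (Suc ?k) j) ` Y, w)
      * M (strip L A (Suc ?k) Y, w)
      = (\<Prod>j\<in>Y. if even ?k then half_weight j else 1)
     * (if Y \<in> (\<lambda>f. f ` {..<l}) ` gaps l g then 1 else 0) * M (strip L A (Suc ?k) Y, w)"
      using M_row_odd[OF w k(1,2) g] by simp
  qed
  also have "\<dots> = (\<Sum>f\<in>gaps l g. (\<Prod>j\<in>f ` {..<l}. if even ?k then half_weight j else 1)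
      * M (strip L A (Suc ?k) (f ` {..<l}), w))"
  proof (rule sum_indicator_image)
    show "finite {Y. Y \<subseteq> ?D}" by simp
    show "inj_on (\<lambda>f. f ` {..<l}) (gaps l g)" by (rule gaps_inj[OF g(1)])
    show "(\<lambda>f. f ` {..<l}) ` gaps l g \<subseteq> {Y. Y \<subseteq> ?D}"
    proof (cases "Suc ?k < A")
      case True
      then show ?thesis using inD by auto
    next
      \<comment> \<open>Row \<open>?k\<close> is then the top row: nothing crosses its northern
        boundary, and only the empty family occurs.\<close>
      case False
      then have "l = 0" using l by simp
      then show ?thesis by auto
    qed
  qed
  also have "\<dots> = (\<Sum>f\<in>gaps l g. edet l f)"
  proof (rule sum.cong[OF refl])
    fix f assume f: "f \<in> gaps l g"
    show "(\<Prod>j\<in>f ` {..<l}. if even ?k then half_weight j else 1)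
        * M (strip L A (Suc ?k) (f ` {..<l}), w) = edet l f"
      using IH[OF gaps_strict_mono[OF f g(1)]] inD[OF f] k by simp
  qed
  also have "\<dots> = odet (Suc l) g" by (rule sum_gaps_edet[OF g(1)])
  finally show ?thesis .
qed

text \<open>Induction from the north side downwards, two rows and one additional dent at a time:
  \<open>sum_gaps_edet\<close> handles the odd row, \<open>sum_gaps_odet\<close> the even row below
  it.\<close>

lemma M_strip_even:
  assumes w: "upper_weight A w" and A: "even A"
  shows "2 * l \<le> A \<Longrightarrow> strict_mono_on {..<l} x \<Longrightarrow> x ` {..<l} \<subseteq> {..<row_length L (A - 2 * l)} \<Longrightarrow>
     M (strip L A (A - 2 * l) (x ` {..<l}), w) = edet l x"
proof (induction l arbitrary: x)
  case 0
  have "strip L A A {} = {}"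
  proof -
    have "\<not> int A \<le> face_row f" if "f \<in> upper_part L A" for f
      using that by (cases f) (auto simp: Up_upper_part Down_upper_part)
    then show ?thesis by (auto simp: strip_def)
  qed
  then show ?case by (simp add: edet_def)
next
  case (Suc l)
  let ?k = "A - 2 * Suc l" and ?l = "Suc l"
  let ?g = "prepend x"
  have k: "even ?k" "?k < A" "Suc ?k = A - Suc (2 * l)" "Suc ?k < A" using A Suc.prems(1) by auto
  note g = strict_mono_prepend[OF Suc.prems(2)]
  let ?D = "if Suc ?k < A then {..<row_length L (Suc ?k)} else {}"
  have D: "?D = {..<row_length L (Suc ?k)}" using k(4) by simp
  have row_length: "row_length L ?k = row_length L (Suc ?k)" using k(1)
      by (auto simp: row_length_def elim!: evenE)
  have inD: "f i < row_length L (Suc ?k)" if "f \<in> gaps ?l ?g" "i < ?l" for f i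
  proof -
    have "f i < ?g (Suc i)" using gapsD[OF that] by simp
    moreover have "x i \<in> {..<row_length L ?k}" using Suc.prems(3) that(2) by blast
    ultimately show ?thesis using row_length by simp
  qed
  have "M (strip L A ?k (x ` {..<?l}), w)
      = (\<Sum>Y | Y \<subseteq> ?D. (\<Prod>j\<in>Y. if even ?k then half_weight j else 1)
     * (if Y \<in> (\<lambda>f. f ` {..<?l}) ` gaps ?l ?g then 1 else 0) * M (strip L A (Suc ?k) Y, w))"
    unfolding strip_step[OF w k(2)]
  proof (rule sum.cong[OF refl])
    fix Y assume "Y \<in> {Y. Y \<subseteq> ?D}"
    then have "Y \<subseteq> {..<row_length L (Suc ?k)}" using D by simp
    then show "(\<Prod>j\<in>Y. if even ?k then half_weight j else 1)
      * M ({f \<in> strip L A ?k (x ` {..<?l}). face_row f = int ?k} - (\<lambda>j. down_cell (Suc ?k) j)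
          ` Y, w)
      * M (strip L A (Suc ?k) Y, w)
      = (\<Prod>j\<in>Y. if even ?k then half_weight j else 1)
     * (if Y \<in> (\<lambda>f. f ` {..<?l}) ` gaps ?l ?g then 1 else 0) * M (strip L A (Suc ?k) Y, w)"
      using M_row_even[OF w k(1,2) Suc.prems(2,3)] by simp
  qed
  also have "\<dots> = (\<Sum>f\<in>gaps ?l ?g. (\<Prod>j\<in>f ` {..<?l}. if even ?k then half_weight j else 1)
      * M (strip L A (Suc ?k) (f ` {..<?l}), w))"
  proof (rule sum_indicator_image)
    show "finite {Y. Y \<subseteq> ?D}" by simp
    show "inj_on (\<lambda>f. f ` {..<?l}) (gaps ?l ?g)" by (rule gaps_inj[OF g])
    show "(\<lambda>f. f ` {..<?l}) ` gaps ?l ?g \<subseteq> {Y. Y \<subseteq> ?D}" unfolding D using inD by auto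
  qed
  also have "\<dots> = (\<Sum>f\<in>gaps ?l ?g. (\<Prod>i<?l. half_weight (f i)) * odet ?l f)"
  proof (rule sum.cong[OF refl])
    fix f assume f: "f \<in> gaps ?l ?g"
    note sm = gaps_strict_mono[OF f g]
    have "M (strip L A (A - Suc (2 * l)) (f ` {..l}), w) = odet (Suc l) f"
    proof (rule M_strip_odd[OF w A])
      show "Suc (2 * l) \<le> A" using Suc.prems(1) by simp
      show "M (strip L A (A - 2 * l) (x ` {..<l}), w) = edet l x"
        if "strict_mono_on {..<l} x" "x ` {..<l} \<subseteq> {..<row_length L (A - 2 * l)}" for x
        using Suc.IH[OF _ that] Suc.prems(1) by simp
      show "strict_mono_on {..l} f" using sm by (simp add: lessThan_Suc_atMost)
      show "f l < row_length L (A - Suc (2 * l))" using inD[OF f, of l] k by simp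
    qed
    then have "M (strip L A (Suc ?k) (f ` {..<?l}), w) = odet ?l f"
      unfolding k(3) lessThan_Suc_atMost .
    moreover have "(\<Prod>j\<in>f ` {..<?l}. if even ?k then half_weight j else 1)
        = (\<Prod>i<?l. half_weight (f i))"
      using k(1) by (simp only: if_True prod.reindex[OF strict_mono_on_imp_inj_on[OF sm]] comp_def)
    ultimately show "(\<Prod>j\<in>f ` {..<?l}. if even ?k then half_weight j else 1)
        * M (strip L A (Suc ?k) (f ` {..<?l}), w)
      = (\<Prod>i<?l. half_weight (f i)) * odet ?l f" by simp
  qed
  \<comment> \<open>The fictitious dent supplies the hypothesis \<open>g 0 = 0\<close>, and the
    subtraction of 1 takes back the shift.\<close>
  also have "\<dots> = edet ?l (\<lambda>i. ?g (Suc i) - 1)" by (rule sum_gaps_odet[OF g]) simp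
  also have "\<dots> = edet ?l x" by simp
  finally show ?case .
qed

text \<open>The square of v_p. Apart from its factor v_p, an \<open>odd_basis\<close> function is a
  polynomial in this variable with leading coefficient 1 / (2 j + 1)!.\<close>

definition vpos :: "nat \<Rightarrow> real" where
  "vpos p = (real p + 1 / 2)\<^sup>2"

definition odd_facts :: "nat \<Rightarrow> real" where
  "odd_facts n = (\<Prod>j<n. fact (2 * j + 1))"

definition dented :: "nat set \<Rightarrow> real" where
  "dented P = (\<Prod>p\<in>P. real p + 1 / 2) * vset vpos P / odd_facts (card P)"

lemma edet_eq:
  "edet l x = (\<Prod>i<l. real (x i) + 1 / 2) * vand l (\<lambda>i. vpos (x i)) / odd_facts l"
proof -
  have "edet l x = fdet l (\<lambda>i j. (1 / fact (2 * j + 1)) * ((real (x i) + 1 / 2)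
      * (\<Prod>e<j. vpos (x i) - (real e + 1 / 2)\<^sup>2)))"
    unfolding edet_def by (rule fdet_cong) (simp add: odd_basis_def vpos_def)
  also have "\<dots> = (\<Prod>j<l. 1 / fact (2 * j + 1)) * ((\<Prod>i<l. real (x i) + 1 / 2) * vand l
      (\<lambda>i. vpos (x i)))"
    unfolding fdet_col_factor fdet_row_factor fdet_newton ..
  finally show ?thesis by (simp add: prod_dividef odd_facts_def)
qed

text \<open>A height of twice the number of dents is the case in which \<open>M_strip_even\<close>
  has come down to the base; sorting \<open>P\<close> provides the increasing family.\<close>

lemma M_dented:
  assumes w: "upper_weight A w" and A: "2 * card P = A" and P: "P \<subseteq> {..<L}"
  shows "M (upper_part L A - (\<lambda>p. Up (int p) 0) ` P, w) = dented P"
proof -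
  have fin: "finite P" using P finite_subset by blast
  let ?l = "card P" and ?x = "\<lambda>i. sorted_list_of_set P ! i"
  have len: "length (sorted_list_of_set P) = ?l" by simp
  have sm: "strict_mono_on {..<?l} ?x"
    by (rule strict_mono_onI) (simp add: sorted_wrt_nth_less[OF strict_sorted_list_of_set])
  have im: "?x ` {..<?l} = P"
    using fin nth_image[of ?l "sorted_list_of_set P"] by (simp add: atLeast0LessThan)
  have eA: "even A" using A by auto
  have "upper_part L A - (\<lambda>p. Up (int p) 0) ` P = strip L A (A - 2 * ?l) (?x ` {..<?l})"
  proof -
    have "0 \<le> face_row f" if "f \<in> upper_part L A" for f
      using that by (cases f) (auto simp: Up_upper_part Down_upper_part)
    then have "{f \<in> upper_part L A. 0 \<le> face_row f} = upper_part L A" by auto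
    moreover have "west 0 = 0" by (simp add: west_def)
    moreover have "A - 2 * ?l = 0" using A by simp
    ultimately show ?thesis unfolding strip_def im by simp
  qed
  also have "M (\<dots>, w) = edet ?l ?x"
    by (rule M_strip_even[OF w eA _ sm]) (use A P im in \<open>auto simp: row_length_def\<close>)
  also have "\<dots> = dented P"
  proof -
    have "vand ?l (\<lambda>i. vpos (?x i)) = vset vpos (?x ` {..<?l})"
      unfolding vset_image[OF sm] vset_lessThan comp_def ..
    moreover have "(\<Prod>i<?l. real (?x i) + 1 / 2) = (\<Prod>p\<in>?x ` {..<?l}. real p + 1 / 2)"
      by (simp only: prod.reindex[OF strict_mono_on_imp_inj_on[OF sm]] comp_def)
    ultimately show ?thesis unfolding edet_eq dented_def im by simp
  qed
  finally show ?thesis .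
qed

section \<open>Unbalanced regions, reflection and forced lozenges\<close>

text \<open>Every lozenge consists of one up-pointing and one down-pointing triangle.\<close>

lemma M_unbalanced:
  assumes fin: "finite R" and ne: "card {f \<in> R. \<exists>p k. f = Up p k} \<noteq> card {f \<in> R. \<exists>p k. f
      = Down p k}"
  shows "M (R, w) = 0"
proof -
  have "tilings R = {}"
  proof (rule ccontr)
    assume "tilings R \<noteq> {}"
    then obtain \<T> where T: "\<T> \<in> tilings R" by blast
    note U = tilingsD(1)[OF T] and lz = tilingsD(2)[OF T] and dj = tilingsD(3)[OF T]
    have finT: "finite \<T>" by (rule finite_tiling[OF fin T])
    have finl: "finite l" if "l \<in> \<T>" for l using that U fin by (metis Union_upper finite_subset)
    have count: "card {f \<in> R. Q f} = card \<T>" if Q: "\<And>l. lozenge l \<Longrightarrow> card {f \<in> l. Q f} = 1" for Q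
    proof -
      have "{f \<in> R. Q f} = (\<Union>l\<in>\<T>. {f \<in> l. Q f})" unfolding U[symmetric] by blast
      then have "card {f \<in> R. Q f} = (\<Sum>l\<in>\<T>. card {f \<in> l. Q f})"
        using finT finl dj by (simp add: card_UN_disjoint disjoint_iff)
      also have "\<dots> = (\<Sum>l\<in>\<T>. 1)" by (rule sum.cong[OF refl]) (rule Q[OF lz])
      finally show ?thesis by simp
    qed
    have "card {f \<in> l. \<exists>p k. f = Up p k} = 1" "card {f \<in> l. \<exists>p k. f = Down p k} = 1"
        if "lozenge l" for l
    proof -
      from that obtain p k p' k' where "l = {Up p k, Down p' k'}" unfolding lozenge_iff by blast
      then have "{f \<in> l. \<exists>p k. f = Up p k} = {Up p k}" "{f \<in> l. \<exists>p k. f = Down p k}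
          = {Down p' k'}" by auto
      then show "card {f \<in> l. \<exists>p k. f = Up p k} = 1" "card {f \<in> l. \<exists>p k. f = Down p k} = 1"
          by simp_all
    qed
    then show False using ne count by simp
  qed
  then show ?thesis by (simp add: M_def)
qed

lemma card_Up_upper_part: "card {f \<in> upper_part L A. \<exists>p k. f = Up p k} = (\<Sum>k<A. row_length L k)"
proof -
  have "{f \<in> upper_part L A. \<exists>p k. f = Up p k} = (\<lambda>(k, j). up_cell k j) ` (SIGMA k:{..<A}.
      {..<row_length L k})"
  proof (intro equalityI subsetI)
    fix f assume "f \<in> {f \<in> upper_part L A. \<exists>p k. f = Up p k}"
    then obtain p k where f: "f = Up p k" "0 \<le> k" "k < int A" "- ((k + 1) div 2) \<le> p" "p + k < int
        L"
      by (auto simp: Up_upper_part)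
    define k' j where "k' = nat k" and "j = nat (p - west k')"
    have k: "k = int k'" using f by (simp add: k'_def)
    have "p = west k' + int j" "k' < A" "j < row_length L k'" using f unfolding k
        by (auto simp: j_def west_def row_length_def)
    then show "f \<in> (\<lambda>(k, j). up_cell k j) ` (SIGMA k:{..<A}. {..<row_length L k})"
        unfolding f(1) k by force
  next
    fix f assume "f \<in> (\<lambda>(k, j). up_cell k j) ` (SIGMA k:{..<A}. {..<row_length L k})"
    then obtain k j where "f = up_cell k j" "k < A" "j < row_length L k" by auto
    then show "f \<in> {f \<in> upper_part L A. \<exists>p k. f = Up p k}"
        by (auto simp: Up_upper_part west_def row_length_def)
  qed
  moreover have "inj_on (\<lambda>(k, j). up_cell k j) (SIGMA k:{..<A}. {..<row_length L k})"
      by (auto simp: inj_on_def)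
  ultimately show ?thesis by (simp add: card_image)
qed

lemma card_Down_upper_part: "card {f \<in> upper_part L A. \<exists>p k. f = Down p k}
    = (\<Sum>k<A. row_length L (Suc k))"
proof -
  have "{f \<in> upper_part L A. \<exists>p k. f = Down p k} = (\<lambda>(k, j). down_cell (Suc k) j)
      ` (SIGMA k:{..<A}. {..<row_length L (Suc k)})"
  proof (intro equalityI subsetI)
    fix f assume "f \<in> {f \<in> upper_part L A. \<exists>p k. f = Down p k}"
    then obtain p k where f: "f = Down p k" "1 \<le> k" "k \<le> int A" "- ((k + 1) div 2) \<le> p" "p + k
        < int L"
      by (auto simp: Down_upper_part)
    define k' j where "k' = nat (k - 1)" and "j = nat (p - west (Suc k'))"
    have k: "k = int (Suc k')" using f by (simp add: k'_def)
    have "p = west (Suc k') + int j" "k' < A" "j < row_length L (Suc k')" using f unfolding k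
        by (auto simp: j_def west_def row_length_def)
    then show "f \<in> (\<lambda>(k, j). down_cell (Suc k) j) ` (SIGMA k:{..<A}. {..<row_length L (Suc k)})"
        unfolding f(1) k by force
  next
    fix f assume "f \<in> (\<lambda>(k, j). down_cell (Suc k) j) ` (SIGMA k:{..<A}. {..<row_length L (Suc k)})"
    then obtain k j where "f = down_cell (Suc k) j" "k < A" "j < row_length L (Suc k)" by auto
    then show "f \<in> {f \<in> upper_part L A. \<exists>p k. f = Down p k}"
        by (auto simp: Down_upper_part west_def row_length_def)
  qed
  moreover have "inj_on (\<lambda>(k, j). down_cell (Suc k) j) (SIGMA k:{..<A}. {..<row_length L
      (Suc k)})" by (auto simp: inj_on_def)
  ultimately show ?thesis by (simp add: card_image)
qed

text \<open>Summed over the rows, the up triangles exceed the down triangles by L minus the length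
  of the north side, which is A / 2. Balance needs exactly that many dents.\<close>

lemma M_dented_zero:
  assumes A: "even A" "A \<le> 2 * L" "0 < A" and P: "P \<subseteq> {..<L}" "2 * card P \<noteq> A"
  shows "M (upper_part L A - (\<lambda>p. Up (int p) 0) ` P, w) = 0"
proof (rule M_unbalanced)
  let ?R = "upper_part L A" and ?D = "(\<lambda>p. Up (int p) 0) ` P"
  show "finite (?R - ?D)" by (simp add: finite_upper_part)
  have sub: "?D \<subseteq> {f \<in> ?R. \<exists>p k. f = Up p k}" using A P by (auto simp: Up_upper_part)
  have cD: "card ?D = card P" by (rule card_image) (auto simp: inj_on_def)
  have finD: "finite ?D" using P(1) finite_subset by blast
  have "{f \<in> ?R - ?D. \<exists>p k. f = Up p k} = {f \<in> ?R. \<exists>p k. f = Up p k} - ?D" by blast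
  then have u: "card {f \<in> ?R - ?D. \<exists>p k. f = Up p k} = (\<Sum>k<A. row_length L k) - card P"
    using card_Diff_subset[OF finD sub] by (simp add: card_Up_upper_part cD)
  have le: "card P \<le> (\<Sum>k<A. row_length L k)"
    unfolding card_Up_upper_part[symmetric] cD[symmetric]
    by (rule card_mono[OF _ sub]) (simp add: finite_upper_part)
  have "{f \<in> ?R - ?D. \<exists>p k. f = Down p k} = {f \<in> ?R. \<exists>p k. f = Down p k}" by blast
  then have d: "card {f \<in> ?R - ?D. \<exists>p k. f = Down p k} = (\<Sum>k<A. row_length L (Suc k))"
    by (simp add: card_Down_upper_part)
  have "(\<Sum>k<A. row_length L k) + row_length L A = row_length L 0 + (\<Sum>k<A. row_length L (Suc k))"
    by (simp add: sum.lessThan_Suc_shift[symmetric])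
  moreover have "row_length L 0 = L" "row_length L A = L - A div 2"
      by (simp_all add: row_length_def)
  ultimately have "(\<Sum>k<A. row_length L k) = A div 2 + (\<Sum>k<A. row_length L (Suc k))" using A by auto
  then show "card {f \<in> ?R - ?D. \<exists>p k. f = Up p k} \<noteq> card {f \<in> ?R - ?D. \<exists>p k. f = Down p k}"
    unfolding u d using le P(2) A(1) by auto
qed

section \<open>Reflection in the base line and the weights on the zigzag\<close>

lemma M_image:
  assumes inj: "inj \<phi>" and loz: "\<And>l. lozenge (\<phi> ` l) \<longleftrightarrow> lozenge l"
  shows "M (\<phi> ` R, w) = M (R, \<lambda>l. w (\<phi> ` l))"
proof -
  have injI: "inj ((`) \<phi>)" using inj by (simp add: inj_image_eq_iff inj_def)
  have "tilings (\<phi> ` R) = (`) ((`) \<phi>) ` tilings R"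
  proof (intro equalityI subsetI)
    fix \<T> assume T: "\<T> \<in> tilings (\<phi> ` R)"
    note U = tilingsD(1)[OF T] and lz = tilingsD(2)[OF T] and dj = tilingsD(3)[OF T]
    let ?S = "(\<lambda>l. \<phi> -` l) ` \<T>"
    have im: "\<phi> ` \<phi> -` l = l" if "l \<in> \<T>" for l
    proof -
      have "l \<subseteq> range \<phi>" using that U by blast
      then show ?thesis by (simp add: image_vimage_eq Int_absorb2)
    qed
    have "(`) ((`) \<phi>) ?S = \<T>"
    proof -
      have "(`) ((`) \<phi>) ?S = (\<lambda>l. \<phi> ` \<phi> -` l) ` \<T>" by (simp add: image_image)
      also have "\<dots> = (\<lambda>l. l) ` \<T>" by (rule image_cong[OF refl im])
      finally show ?thesis by simp
    qed
    moreover have "?S \<in> tilings R" unfolding tilings_iff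
    proof (intro conjI ballI impI)
      have "\<Union>?S = \<phi> -` \<Union>\<T>" by auto
      also have "\<dots> = R" unfolding U by (rule inj_vimage_image_eq[OF inj])
      finally show "\<Union>?S = R" .
      fix l assume "l \<in> ?S"
      then obtain l0 where l0: "l0 \<in> \<T>" "l = \<phi> -` l0" by blast
      then show "lozenge l" using loz[of l] im lz by simp
      fix l' assume "l' \<in> ?S" and ne: "l \<noteq> l'"
      then obtain l1 where l1: "l1 \<in> \<T>" "l' = \<phi> -` l1" by blast
      then have "l0 \<inter> l1 = {}" using dj[of l0 l1] l0 ne by blast
      then show "l \<inter> l' = {}" using l0 l1 by auto
    qed
    ultimately show "\<T> \<in> (`) ((`) \<phi>) ` tilings R" by (metis imageI)
  next
    fix \<T> assume "\<T> \<in> (`) ((`) \<phi>) ` tilings R"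
    then obtain \<S> where S: "\<S> \<in> tilings R" "\<T> = (`) \<phi> ` \<S>" by blast
    note U = tilingsD(1)[OF S(1)] and lz = tilingsD(2)[OF S(1)] and dj = tilingsD(3)[OF S(1)]
    show "\<T> \<in> tilings (\<phi> ` R)" unfolding tilings_iff S(2)
    proof (intro conjI ballI impI)
      show "\<Union>((`) \<phi> ` \<S>) = \<phi> ` R" using U by auto
      fix l assume "l \<in> (`) \<phi> ` \<S>"
      then obtain l0 where l0: "l0 \<in> \<S>" "l = \<phi> ` l0" by blast
      then show "lozenge l" using loz lz by simp
      fix l' assume "l' \<in> (`) \<phi> ` \<S>" and ne: "l \<noteq> l'"
      then obtain l1 where l1: "l1 \<in> \<S>" "l' = \<phi> ` l1" by blast
      then have "l0 \<inter> l1 = {}" using dj[of l0 l1] l0 ne by blast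
      then show "l \<inter> l' = {}" using l0 l1 image_Int[OF inj, of l0 l1] by simp
    qed
  qed
  moreover have "inj_on ((`) ((`) \<phi>)) (tilings R)"
    using injI by (meson inj_image_eq_iff inj_onI)
  ultimately have "M (\<phi> ` R, w) = (\<Sum>\<T>\<in>tilings R. \<Prod>l\<in>(`) \<phi> ` \<T>. w l)"
    by (simp add: M_def sum.reindex)
  also have "\<dots> = (\<Sum>\<T>\<in>tilings R. \<Prod>l\<in>\<T>. w (\<phi> ` l))"
    by (intro sum.cong refl) (simp add: prod.reindex inj_on_subset[OF injI])
  finally show ?thesis by (simp add: M_def)
qed

text \<open>The map [u;k] to [u;-k] in the coordinate p = u - k/2, where it sends p to p +
  k.\<close>

fun reflect :: "face \<Rightarrow> face" where
  "reflect (Up p k) = Down (p + k) (- k)"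
| "reflect (Down p k) = Up (p + k) (- k)"

lemma reflect_reflect [simp]: "reflect (reflect f) = f"
  by (cases f) simp_all

lemma inj_reflect: "inj reflect"
  by (metis injI reflect_reflect)

lemma lozenge_reflect: "lozenge (reflect ` l) \<longleftrightarrow> lozenge l"
proof -
  have *: "lozenge (reflect ` l)" if "lozenge l" for l
  proof -
    from that obtain p k where "l = {Up p k, Down p k} \<or> l = {Up p k, Down p (k + 1)} \<or> l
        = {Up p k, Down (p - 1) (k + 1)}"
      unfolding lozenge_iff by blast
    then show ?thesis
      by (elim disjE) (simp_all add: lozenge_Down)
  qed
  have "reflect ` reflect ` l = l" by (simp add: image_image)
  then show ?thesis using *[of l] *[of "reflect ` l"] by auto
qed

lemma M_reflect: "M (reflect ` R, w) = M (R, \<lambda>l. w (reflect ` l))"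
  by (rule M_image[OF inj_reflect lozenge_reflect])

lemma face_row_reflect: "face_row (reflect f) = - 1 - face_row f"
  by (cases f) simp_all

lemma verts_reflect: "verts (reflect f) = (\<lambda>(p, k). (p + k, - k)) ` verts f"
  by (cases f) (auto simp: algebra_simps)

text \<open>Lattice points on a horizontal line have distance 1, so the zigzag point is the one that
  is not west of the zigzag although its left neighbour is.\<close>

lemma on_zigzag_iff: "hcoord (p, k) = zigzag_coord k \<longleftrightarrow> p = - ((k + 1) div 2)"
proof -
  have "hcoord (p, k) = zigzag_coord k \<longleftrightarrow> zigzag_coord k \<le> hcoord (p, k) \<and> \<not> zigzag_coord k \<le>
      hcoord (p - 1, k)"
  proof (cases "even k")
    case True
    then obtain m where k: "k = 2 * m" by (elim evenE)
    have e: "hcoord (p, k) = real_of_int (p + m)" "hcoord (p - 1, k) = real_of_int (p + m - 1)"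
        "zigzag_coord k = 0"
      using k by (simp_all add: hcoord_def zigzag_coord_def)
    show ?thesis unfolding e of_int_eq_0_iff of_int_0_le_iff by presburger
  next
    case False
    then obtain m where k: "k = 2 * m + 1" by (elim oddE)
    have e: "hcoord (p, k) = real_of_int (p + m + 1) - 1 / 2" "hcoord (p - 1, k)
        = real_of_int (p + m) - 1 / 2" "zigzag_coord k = - 1 / 2"
      using k by (simp_all add: hcoord_def zigzag_coord_def add_divide_distrib)
    have c: "x - 1 / 2 = - 1 / 2 \<longleftrightarrow> x = 0" "- 1 / 2 \<le> x - 1 / 2 \<longleftrightarrow> 0 \<le> x" for x :: real
      by auto
    show ?thesis unfolding e c of_int_eq_0_iff of_int_0_le_iff using k by presburger
  qed
  then show ?thesis unfolding zigzag_le_iff by linarith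
qed

lemma vertical_unique: "{Up p k, Down p k} = {Up p' k', Down p' k'} \<longleftrightarrow> p = p' \<and> k = k'"
  by (auto simp: doubleton_eq_iff)

text \<open>The western corner of the lozenge must be a westernmost point of the zigzag, hence of
  odd height, with both neighbouring heights in range.\<close>

lemma zigzag_weight_vertical:
  "zigzag_weight (zigzag lo hi) {Up p k, Down p k}
    = (if lo < k \<and> k < hi \<and> odd k \<and> p = - ((k + 1) div 2) then 1 / 2 else 1)"
proof -
  have "{(p, k), (p, k + 1), (p + 1, k - 1)} \<subseteq> zigzag lo hi \<longleftrightarrow> lo < k \<and> k < hi \<and> odd k \<and> p
      = - ((k + 1) div 2)"
  proof -
    have "{(p, k), (p, k + 1), (p + 1, k - 1)} \<subseteq> zigzag lo hi \<longleftrightarrow>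
      lo < k \<and> k < hi \<and> p = - ((k + 1) div 2) \<and> p = - ((k + 1 + 1) div 2) \<and> p + 1
          = - ((k - 1 + 1) div 2)"
      unfolding zigzag_def by (auto simp: on_zigzag_iff)
    also have "\<dots> \<longleftrightarrow> lo < k \<and> k < hi \<and> odd k \<and> p = - ((k + 1) div 2)" by presburger
    finally show ?thesis .
  qed
  then show ?thesis unfolding zigzag_weight_def vertical_unique by auto
qed

lemma zigzag_weight_same_row:
  assumes "face_row f = face_row g"
  shows "zigzag_weight Z {f, g} = 1"
proof -
  have "{f, g} \<noteq> {Up p k, Down p k}" for p k
    using assms by (auto simp: doubleton_eq_iff)
  then show ?thesis unfolding zigzag_weight_def by auto
qed

lemma upper_weight_zigzag:
  assumes "lo \<le> 0"
  shows "upper_weight A (zigzag_weight (zigzag lo (int A)))"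
  unfolding upper_weight_def
proof (intro conjI allI impI)
  show "zigzag_weight (zigzag lo (int A)) {rface k n, rface k (n + 1)} = 1" for k n
    by (rule zigzag_weight_same_row) simp
  show "zigzag_weight (zigzag lo (int A)) {up_cell k j, down_cell k j}
      = (if odd k then half_weight j else 1)"
    if "1 \<le> k" "k < A" for k j
    unfolding zigzag_weight_vertical using that assms by (auto simp: half_weight_def west_def)
qed

text \<open>Reflection preserves the parity of heights and takes position j at height k to position
  j at height - k.\<close>

lemma upper_weight_zigzag_reflect:
  assumes "0 \<le> hi"
  shows "upper_weight B (\<lambda>l. zigzag_weight (zigzag (- int B) hi) (reflect ` l))"
  unfolding upper_weight_def
proof (intro conjI allI impI)
  show "zigzag_weight (zigzag (- int B) hi) (reflect ` {rface k n, rface k (n + 1)}) = 1" for k n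
    unfolding image_insert image_empty by (rule zigzag_weight_same_row) (simp add: face_row_reflect)
  show "zigzag_weight (zigzag (- int B) hi) (reflect ` {up_cell k j, down_cell k j})
      = (if odd k then half_weight j else 1)"
    if "1 \<le> k" "k < B" for k j
  proof -
    have "reflect ` {up_cell k j, down_cell k j}
       = {Up (west k + int j + int k) (- int k), Down (west k + int j + int k) (- int k)}" by auto
    moreover have "west k + int j + int k = - ((- int k + 1) div 2) \<longleftrightarrow> j = 0"
      unfolding west_def by presburger
    ultimately show ?thesis using that assms by (auto simp: zigzag_weight_vertical half_weight_def)
  qed
qed

section \<open>Trading removed triangles for unit dents\<close>

definition column :: "int \<times> int \<Rightarrow> face set" where
  "column = (\<lambda>(p, k). {Up p k, Down p k})"

text \<open>Removing the faces below a set \<open>W\<close> of vertical lozenges forces these lozenges, from the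
  bottom upwards.\<close>

lemma M_forced_columns:
  assumes fin: "finite R" "finite W"
    and W: "\<And>p k. (p, k) \<in> W \<Longrightarrow> Up p k \<in> R \<and> Down p k \<in> R
      \<and> (Up p (k - 1) \<notin> R \<or> (p, k - 1) \<in> W) \<and> (Up (p + 1) (k - 1) \<notin> R \<or> (p + 1, k - 1) \<in> W)"
  shows "M (R, w) = (\<Prod>v\<in>W. w (column v)) * M (R - \<Union>(column ` W), w)"
  using fin(2) W
proof (induction "card W" arbitrary: W)
  case 0
  then show ?case by simp
next
  case (Suc n)
  have "W \<noteq> {}" using Suc.hyps(2) by auto
  \<comment> \<open>A lozenge of maximal height is split off last. The condition on the others
    involves only lower members of W, so the induction applies to them; once they are gone,
    \<open>Down p k\<close> has lost both lower neighbours.\<close>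
  then have "Max (snd ` W) \<in> snd ` W" using Suc.prems(1) by simp
  then obtain p k where pk: "(p, k) \<in> W" "k = Max (snd ` W)" by auto
  have top: "k' \<le> k" if "(p', k') \<in> W" for p' k'
    using that Suc.prems(1) pk(2) by (metis Max_ge finite_imageI imageI snd_conv)
  define W' where "W' = W - {(p, k)}"
  have W': "finite W'" "n = card W'" "W = insert (p, k) W'" "(p, k) \<notin> W'"
    using pk Suc.prems(1) Suc.hyps(2) by (auto simp: W'_def card_Diff_singleton)
  have IH: "M (R, w) = (\<Prod>v\<in>W'. w (column v)) * M (R - \<Union>(column ` W'), w)"
  proof (rule Suc.hyps(1)[OF W'(2,1)])
    fix p' k' assume a: "(p', k') \<in> W'"
    then have "(p', k') \<in> W" by (simp add: W'_def)
    moreover have "k' - 1 \<noteq> k" using top[OF calculation] by simp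
    ultimately show "Up p' k' \<in> R \<and> Down p' k' \<in> R
      \<and> (Up p' (k' - 1) \<notin> R \<or> (p', k' - 1) \<in> W') \<and> (Up (p' + 1) (k' - 1) \<notin> R \<or> (p' + 1, k' - 1) \<in>
          W')"
      using Suc.prems(2)[of p' k'] unfolding W'_def by auto
  qed
  let ?R = "R - \<Union>(column ` W')"
  have mem: "Up p' k' \<in> ?R \<longleftrightarrow> Up p' k' \<in> R \<and> (p', k') \<notin> W'" "Down p' k' \<in> ?R
      \<longleftrightarrow> Down p' k' \<in> R \<and> (p', k') \<notin> W'" for p' k'
    by (auto simp: column_def)
  have "M (?R, w) = w {Down p k, Up p k} * M (?R - {Down p k, Up p k}, w)"
  proof (rule M_forced)
    show "finite ?R" using fin(1) by simp
    show "Down p k \<in> ?R" "Up p k \<in> ?R" using Suc.prems(2)[OF pk(1)] W'(4) unfolding mem by auto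
    show "lozenge {Down p k, Up p k}" by (simp add: lozenge_Down)
    fix h assume h: "h \<in> ?R" "lozenge {Down p k, h}"
    have "(p', k - 1) \<in> W \<longleftrightarrow> (p', k - 1) \<in> W'" for p' by (simp add: W'_def)
    then have "Up p (k - 1) \<notin> ?R" "Up (p + 1) (k - 1) \<notin> ?R"
      using Suc.prems(2)[OF pk(1)] unfolding mem by auto
    then show "h = Up p k" using h unfolding lozenge_Down by auto
  qed
  moreover have "{Down p k, Up p k} = column (p, k)" by (auto simp: column_def)
  moreover have "?R - column (p, k) = R - \<Union>(column ` W)" unfolding W'(3) by auto
  ultimately show ?case
    unfolding IH W'(3) using W'(1,4) by (simp add: mult_ac)
qed

lemma le_hcoord_iff: "real s + of_int k / 2 \<le> hcoord (p, k) \<longleftrightarrow> int s \<le> p"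
  by (simp add: hcoord_def) (metis of_int_le_iff of_int_of_nat_eq)

lemma up_triangle_iff:
  "f \<in> up_triangle (real s) (real t) \<longleftrightarrow> (\<forall>(p, k)\<in>verts f. 0 \<le> k \<and> int s \<le> p \<and> p + k \<le> int t)"
  unfolding up_triangle_def by (auto simp: le_hcoord_iff hcoord_le_iff)

lemma Up_up_triangle: "Up p k \<in> up_triangle (real s) (real t) \<longleftrightarrow> 0 \<le> k \<and> int s \<le> p \<and> p + k < int t"
  unfolding up_triangle_iff by auto

lemma Down_up_triangle: "Down p k \<in> up_triangle (real s) (real t) \<longleftrightarrow> 1 \<le> k \<and> int s \<le> p \<and> p + k
    < int t"
  unfolding up_triangle_iff by auto

text \<open>The mirror image of \<open>below_west\<close>. Inside \<open>upper_part\<close> the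
  zigzag bounds it on the west.\<close>

definition half_triangle :: "nat \<Rightarrow> face set" where
  "half_triangle h = {f. \<forall>v\<in>verts f. 0 \<le> snd v \<and> hcoord v \<le> real h - of_int (snd v) / 2}"

lemma half_triangle_iff: "f \<in> half_triangle h \<longleftrightarrow> (\<forall>(p, k)\<in>verts f. 0 \<le> k \<and> p + k \<le> int h)"
  unfolding half_triangle_def by (auto simp: hcoord_le_iff)

lemma Up_half_triangle: "Up p k \<in> half_triangle h \<longleftrightarrow> 0 \<le> k \<and> p + k < int h"
  unfolding half_triangle_iff by auto

lemma Down_half_triangle: "Down p k \<in> half_triangle h \<longleftrightarrow> 1 \<le> k \<and> p + k < int h"
  unfolding half_triangle_iff by auto

definition triangles :: "(nat \<times> nat) set \<Rightarrow> face set" where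
  "triangles \<I> = (\<Union>(s, t)\<in>\<I>. up_triangle (real s) (real t))"

definition dents :: "(nat \<times> nat) set \<Rightarrow> nat set" where
  "dents \<I> = (\<Union>(s, t)\<in>\<I>. {s..<t})"

lemma triangles_iff: "f \<in> triangles \<I> \<longleftrightarrow> (\<exists>s t. (s, t) \<in> \<I> \<and> f \<in> up_triangle (real s) (real t))"
  unfolding triangles_def by force

lemma dents_iff: "p \<in> dents \<I> \<longleftrightarrow> (\<exists>s t. (s, t) \<in> \<I> \<and> s \<le> p \<and> p < t)"
  unfolding dents_def by force

text \<open>Above a run of unit dents the down triangles have no lower partner, so vertical lozenges
  fill the triangle over the run. The first h dents likewise fill a half triangle of side 2 h at the
  zigzag. Of all these lozenges only h have weight 1/2, one at each odd height below 2 h.\<close>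

lemma M_triangles:
  assumes w: "upper_weight A w" and A: "2 * h \<le> A" "h \<le> L"
    and I: "finite \<I>" "\<And>s t. (s, t) \<in> \<I> \<Longrightarrow> t \<le> L \<and> t \<le> s + A"
  shows "M (upper_part L A - (\<lambda>p. Up (int p) 0) ` ({..<h} \<union> dents \<I> \<union> X), w)
     = (1 / 2) ^ h * M (upper_part L A - half_triangle h - triangles \<I> - (\<lambda>p. Up (int p) 0) ` X, w)"
proof -
  let ?D = "{..<h} \<union> dents \<I> \<union> X"
  let ?R = "upper_part L A - (\<lambda>p. Up (int p) 0) ` ?D"
  \<comment> \<open>\<open>W1\<close> and \<open>W2\<close> are the forced lozenges in the half
    triangle and in the triangles. Heights start at 1 because height 0 is taken by the dents
    themselves.\<close>
  define W1 where "W1 = {(p, k). 1 \<le> k \<and> - ((k + 1) div 2) \<le> p \<and> p + k < int h}"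
  define W2 where "W2 = (\<Union>(s, t)\<in>\<I>. {(p, k). 1 \<le> k \<and> int s \<le> p \<and> p + k < int t})"
  have "W1 \<subseteq> {- int h - 1..int h} \<times> {1..2 * int h}" unfolding W1_def by auto
  then have fin1: "finite W1" by (rule finite_subset) simp
  have fin2: "finite W2" unfolding W2_def
  proof (rule finite_UN_I[OF I(1)])
    fix st assume "st \<in> \<I>"
    obtain s t where "st = (s, t)" by fastforce
    moreover have "finite {(p, k). 1 \<le> k \<and> int s \<le> p \<and> p + k < int t}"
      by (rule finite_subset[of _ "{int s..int t} \<times> {1..int t}"]) auto
    ultimately show "finite (case st of (s, t) \<Rightarrow> {(p, k). 1 \<le> k \<and> int s \<le> p \<and> p + k < int t})"
        by simp
  qed
  have in2: "(p, k) \<in> W2 \<longleftrightarrow> (\<exists>s t. (s, t) \<in> \<I> \<and> 1 \<le> k \<and> int s \<le> p \<and> p + k < int t)" for p k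
    unfolding W2_def by force
  have in1: "(p, k) \<in> W1 \<longleftrightarrow> 1 \<le> k \<and> - ((k + 1) div 2) \<le> p \<and> p + k < int h" for p k
    unfolding W1_def by auto
  have dent: "Up p 0 \<notin> ?R" if "int s \<le> p" "p < int t" "{s..<t} \<subseteq> ?D" for p s t
  proof -
    have "nat p \<in> {s..<t}" and p: "p = int (nat p)" using that(1,2) by auto
    then have "nat p \<in> ?D" using that(3) by blast
    with p show ?thesis by (metis DiffE imageI)
  qed
  have "M (?R, w) = (\<Prod>v\<in>W1 \<union> W2. w (column v)) * M (?R - \<Union>(column ` (W1 \<union> W2)), w)"
  proof (rule M_forced_columns)
    show "finite ?R" by (simp add: finite_upper_part)
    show "finite (W1 \<union> W2)" using fin1 fin2 by simp
    fix p k assume "(p, k) \<in> W1 \<union> W2"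
    then consider "(p, k) \<in> W1" | s t where "(s, t) \<in> \<I>" "1 \<le> k" "int s \<le> p" "p + k < int t"
      unfolding Un_iff in2 by auto
    then show "Up p k \<in> ?R \<and> Down p k \<in> ?R
      \<and> (Up p (k - 1) \<notin> ?R \<or> (p, k - 1) \<in> W1 \<union> W2) \<and> (Up (p + 1) (k - 1) \<notin> ?R \<or> (p + 1, k - 1) \<in>
          W1 \<union> W2)"
    proof cases
      case 1
      then have b: "1 \<le> k" "- ((k + 1) div 2) \<le> p" "p + k < int h" unfolding in1 by auto
      have "Up p k \<in> ?R \<and> Down p k \<in> ?R"
        using b A by (auto simp: Up_upper_part Down_upper_part)
      moreover have "Up p' (k - 1) \<notin> ?R \<or> (p', k - 1) \<in> W1 \<union> W2" if "p' = p \<or> p' = p + 1" for p'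
      proof (cases "- (k div 2) \<le> p'")
        case True
        show ?thesis
        proof (cases "k = 1")
          case k1: True
          have "{0..<h} \<subseteq> ?D" by auto
          moreover have "int 0 \<le> p'" "p' < int h" using True b that k1 by auto
          ultimately have "Up p' 0 \<notin> ?R" using dent by blast
          then show ?thesis using k1 by simp
        next
          case False
          then have "(p', k - 1) \<in> W1" using True b that by (auto simp: in1)
          then show ?thesis by simp
        qed
      next
        case False
        then show ?thesis by (simp add: Up_upper_part)
      qed
      ultimately show ?thesis by blast
    next
      case 2
      have st: "t \<le> L" "t \<le> s + A" using I(2)[OF 2(1)] by auto
      have "Up p k \<in> ?R \<and> Down p k \<in> ?R"
        using 2 st by (auto simp: Up_upper_part Down_upper_part)
      moreover have "Up p' (k - 1) \<notin> ?R \<or> (p', k - 1) \<in> W1 \<union> W2" if "p' = p \<or> p' = p + 1" for p'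
      proof (cases "k = 1")
        case k1: True
        have "{s..<t} \<subseteq> ?D" using 2(1) by (force simp: dents_def)
        moreover have "int s \<le> p'" "p' < int t" using 2 that k1 by auto
        ultimately have "Up p' 0 \<notin> ?R" using dent by blast
        then show ?thesis using k1 by simp
      next
        case False
        then have "(p', k - 1) \<in> W2" unfolding in2 using 2 that by (intro exI[of _ s] exI[of _ t])
            auto
        then show ?thesis by simp
      qed
      ultimately show ?thesis by blast
    qed
  qed
  also have "(\<Prod>v\<in>W1 \<union> W2. w (column v)) = (1 / 2) ^ h"
  proof -
    \<comment> \<open>The zigzag corners at the heights 2 r + 1; there p + k = r, so the corner
      belongs to the half triangle iff r < h.\<close>
    let ?H = "(\<lambda>r. (- (int r + 1), 2 * int r + 1)) ` {..<h}"
    have wt: "w (column v) = (if v \<in> ?H then 1 / 2 else 1)" if v: "v \<in> W1 \<union> W2" for v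
    proof -
      obtain p k where pk: "v = (p, k)" by fastforce
      have b: "1 \<le> k" "k < int A" "- ((k + 1) div 2) \<le> p" "p + k < int h \<or> 0 \<le> p"
        using v I(2) A unfolding pk Un_iff in1 in2 by fastforce+
      define i j where "i = nat k" and "j = nat (p - west i)"
      have ij: "k = int i" "p = west i + int j" "1 \<le> i" "i < A" using b
          by (auto simp: i_def j_def west_def)
      have "odd i \<and> j = 0 \<longleftrightarrow> v \<in> ?H"
      proof
        assume *: "odd i \<and> j = 0"
        then obtain r where r: "i = 2 * r + 1" by (elim conjE oddE)
        then have "v = (- (int r + 1), 2 * int r + 1)" using ij * pk by (simp add: west_def)
        moreover have "r < h" using b(4) ij r * by (auto simp: west_def)
        ultimately show "v \<in> ?H" by simp
      next
        assume "v \<in> ?H"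
        then obtain r where "p = - (int r + 1)" "k = 2 * int r + 1" unfolding pk by auto
        then show "odd i \<and> j = 0" using ij by (simp add: west_def) presburger
      qed
      moreover have "w (column v) = (if odd i \<and> j = 0 then 1 / 2 else 1)"
        using upper_weightD(2)[OF w ij(3,4), of j] ij(1,2) unfolding pk column_def half_weight_def
            by simp
      ultimately show ?thesis by simp
    qed
    have sub: "?H \<subseteq> W1 \<union> W2" by (auto simp: in1)
    have "(\<Prod>v\<in>W1 \<union> W2. w (column v)) = (\<Prod>v\<in>W1 \<union> W2. if v \<in> ?H then 1 / 2 else 1)"
      by (rule prod.cong[OF refl wt])
    also have "\<dots> = (\<Prod>v\<in>?H. 1 / 2)"
      using fin1 fin2 sub by (subst prod.If_cases) (auto simp: Int_absorb1)
    also have "\<dots> = (1 / 2) ^ card ?H" by simp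
    also have "card ?H = h" by (subst card_image) (auto simp: inj_on_def)
    finally show ?thesis .
  qed
  also have "?R - \<Union>(column ` (W1 \<union> W2)) = upper_part L A - half_triangle h - triangles \<I>
      - (\<lambda>p. Up (int p) 0) ` X"
  proof (rule Set.set_eqI)
    fix f
    show "f \<in> ?R - \<Union>(column ` (W1 \<union> W2)) \<longleftrightarrow> f \<in> upper_part L A - half_triangle h - triangles \<I>
        - (\<lambda>p. Up (int p) 0) ` X"
    proof (cases f)
      case (Up p k)
      have c: "f \<in> \<Union>(column ` (W1 \<union> W2)) \<longleftrightarrow> (p, k) \<in> W1 \<or> (p, k) \<in> W2"
        unfolding Up column_def by auto
      have t: "f \<in> triangles \<I> \<longleftrightarrow> (\<exists>s t. (s, t) \<in> \<I> \<and> 0 \<le> k \<and> int s \<le> p \<and> p + k < int t)"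
        unfolding Up triangles_iff Up_up_triangle ..
      show ?thesis
      proof (cases "k = 0")
        case True
        have d: "f \<in> (\<lambda>p. Up (int p) 0) ` Z \<longleftrightarrow> 0 \<le> p \<and> nat p \<in> Z" for Z
          unfolding Up True by force
        have "0 \<le> p \<and> nat p \<in> dents \<I> \<longleftrightarrow> f \<in> triangles \<I>"
        proof
          assume "0 \<le> p \<and> nat p \<in> dents \<I>"
          then obtain s t where "(s, t) \<in> \<I>" "int s \<le> p" "p < int t" unfolding dents_iff by auto
          then show "f \<in> triangles \<I>" unfolding t True by auto
        next
          assume "f \<in> triangles \<I>"
          then obtain s t where st: "(s, t) \<in> \<I>" "int s \<le> p" "p < int t" unfolding t True by auto
          then have "s \<le> nat p" "nat p < t" "0 \<le> p" by auto
          then show "0 \<le> p \<and> nat p \<in> dents \<I>" unfolding dents_iff using st(1) by blast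
        qed
        then show ?thesis
          unfolding Diff_iff c d in1 in2 unfolding Up Up_half_triangle Up_upper_part True by auto
      next
        case False
        then have d: "f \<notin> (\<lambda>p. Up (int p) 0) ` Z" for Z unfolding Up by auto
        have "f \<in> upper_part L A \<Longrightarrow> (p, k) \<in> W1 \<longleftrightarrow> f \<in> half_triangle h"
          unfolding in1 Up Up_half_triangle Up_upper_part using False by auto
        moreover have "f \<in> upper_part L A \<Longrightarrow> (p, k) \<in> W2 \<longleftrightarrow> f \<in> triangles \<I>"
          unfolding in2 t using False unfolding Up Up_upper_part by auto
        ultimately show ?thesis unfolding Diff_iff c using d by blast
      qed
    next
      case (Down p k)
      have c: "f \<in> \<Union>(column ` (W1 \<union> W2)) \<longleftrightarrow> (p, k) \<in> W1 \<or> (p, k) \<in> W2"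
        unfolding Down column_def by auto
      have t: "f \<in> triangles \<I> \<longleftrightarrow> (p, k) \<in> W2"
        unfolding Down triangles_iff in2 Down_up_triangle ..
      have d: "f \<notin> (\<lambda>p. Up (int p) 0) ` Z" for Z unfolding Down by auto
      have "f \<in> upper_part L A \<Longrightarrow> (p, k) \<in> W1 \<longleftrightarrow> f \<in> half_triangle h"
        unfolding in1 Down Down_half_triangle Down_upper_part by auto
      then show ?thesis unfolding Diff_iff c t using d by blast
    qed
  qed
  finally show ?thesis .
qed

lemma half_triangle_0: "upper_part L A - half_triangle 0 = upper_part L A"
proof -
  have "f \<notin> half_triangle 0" if "f \<in> upper_part L A" for f
    using that by (cases f) (auto simp: Up_upper_part Down_upper_part Up_half_triangle
        Down_half_triangle)
  then show ?thesis by blast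
qed

lemma upper_part_face_row: "f \<in> upper_part L A \<Longrightarrow> 0 \<le> face_row f"
  by (cases f) (auto simp: Up_upper_part Down_upper_part)

lemma up_triangle_face_row: "f \<in> up_triangle (real s) (real t) \<Longrightarrow> 0 \<le> face_row f"
  by (cases f) (auto simp: Up_up_triangle Down_up_triangle)

lemma half_triangle_face_row: "f \<in> half_triangle h \<Longrightarrow> 0 \<le> face_row f"
  by (cases f) (auto simp: Up_half_triangle Down_half_triangle)

lemma hcoord_reflect: "hcoord (p + k, - k) = hcoord (p, k)"
  by (simp add: hcoord_def)

lemma down_triangle_reflect: "f \<in> down_triangle s t \<longleftrightarrow> reflect f \<in> up_triangle s t"
proof -
  have e: "(\<exists>k. snd v = - k \<and> Q k) \<longleftrightarrow> Q (- snd v)" for v :: vertex and Q by (metis minus_minus)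
  show ?thesis
    unfolding down_triangle_def up_triangle_def mem_Collect_eq verts_reflect e
    by (auto simp: hcoord_reflect case_prod_unfold split: prod.splits)
qed

lemma below_west_reflect: "f \<in> below_west (real h) \<longleftrightarrow> reflect f \<in> half_triangle h"
proof -
  have e: "(\<exists>k. snd v = - k \<and> Q k) \<longleftrightarrow> Q (- snd v)" for v :: vertex and Q by (metis minus_minus)
  show ?thesis
    unfolding below_west_def half_triangle_def mem_Collect_eq verts_reflect e
    by (auto simp: hcoord_reflect case_prod_unfold split: prod.splits)
qed

text \<open>The eastern side first runs outwards for z steps and then back. Extended to the base
  line, the second segment meets it at L + z, and what has been added is the triangle over the
  segment from L to L + z. This is the origin of the last entry of \<open>t_minus\<close>.\<close>

lemma lower_part_reflect:
  "f \<in> lower_part L z B \<longleftrightarrow> reflect f \<in> upper_part (L + z) B \<and> reflect f \<notin> up_triangle (real L)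
      (real (L + z))"
proof -
  have e: "(\<exists>k. snd v = - k \<and> Q k) \<longleftrightarrow> Q (- snd v)" for v :: vertex and Q by (metis minus_minus)
  have zz: "zigzag_coord (- k) = zigzag_coord k" for k by (simp add: zigzag_coord_def)
  have w: "hcoord (p, k) \<le> real L + of_int k / 2 \<longleftrightarrow> p \<le> int L" for p k
    by (simp add: hcoord_def) (metis of_int_le_iff of_int_of_nat_eq)
  have "f \<in> lower_part L z B \<longleftrightarrow> (\<forall>(p, k)\<in>verts (reflect f). 0 \<le> k \<and> k \<le> int B \<and>
     zigzag_coord k \<le> hcoord (p, k) \<and> hcoord (p, k) \<le> real L + of_int k / 2 \<and> hcoord (p, k) \<le> real
         (L + z) - of_int k / 2)"
    unfolding lower_part_def mem_Collect_eq verts_reflect e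
    by (auto simp: hcoord_reflect zz case_prod_unfold split: prod.splits)
  also have "\<dots> \<longleftrightarrow> (\<forall>(p, k)\<in>verts (reflect f). 0 \<le> k \<and> k \<le> int B \<and> - ((k + 1) div 2) \<le> p \<and> p \<le> int L
      \<and> p + k \<le> int (L + z))"
    unfolding zigzag_le_iff w hcoord_le_iff ..
  also have "\<dots> \<longleftrightarrow> reflect f \<in> upper_part (L + z) B \<and> reflect f \<notin> up_triangle (real L) (real (L + z))"
  proof (cases "reflect f")
    case (Up p k)
    then show ?thesis unfolding upper_part_iff up_triangle_iff by auto
  next
    case (Down p k)
    then show ?thesis unfolding upper_part_iff up_triangle_iff by auto
  qed
  finally show ?thesis .
qed

section \<open>Dents along the base line\<close>

lemma partial_sum_0 [simp]: "partial_sum s 0 = 0"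
  by (simp add: partial_sum_def)

lemma partial_sum_Suc [simp]: "partial_sum s (Suc k) = partial_sum s k + entry s (Suc k)"
  by (simp add: partial_sum_def)

lemma partial_sum_pred: "1 \<le> i \<Longrightarrow> partial_sum s i = partial_sum s (i - 1) + entry s i"
  using partial_sum_Suc[of s "i - 1"] by simp

lemma partial_sum_take: "partial_sum s k = sum_list (take k s)"
proof (induction k)
  case (Suc k)
  then show ?case by (cases "k < length s") (simp_all add: entry_def take_Suc_conv_app_nth)
qed simp

lemma partial_sum_le: "partial_sum s k \<le> sum_list s"
  unfolding partial_sum_take by (metis append_take_drop_id le_add1 sum_list_append)

lemma partial_sum_length: "partial_sum s (length s) = sum_list s"
  by (simp add: partial_sum_take)

lemma partial_sum_mono: "i \<le> j \<Longrightarrow> partial_sum s i \<le> partial_sum s j"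
  by (rule lift_Suc_mono_le[of "partial_sum s"]) auto

definition blocks :: "nat list \<Rightarrow> (nat \<Rightarrow> bool) \<Rightarrow> (nat \<times> nat) set" where
  "blocks s P = (\<lambda>i. (partial_sum s (i - 1), partial_sum s i)) ` {i \<in> {1..length s}. P i}"

text \<open>Blocks laid westwards from L; the natural subtraction is exact whenever
  \<open>sum_list s\<close> \<le> \<open>L\<close>.\<close>

definition rblocks :: "nat \<Rightarrow> nat list \<Rightarrow> (nat \<Rightarrow> bool) \<Rightarrow> (nat \<times> nat) set" where
  "rblocks L s P = (\<lambda>i. (L - partial_sum s i, L - partial_sum s (i - 1))) ` {i \<in> {1..length s}. P
      i}"

lemma finite_blocks [simp]: "finite (blocks s P)" "finite (rblocks L s P)"
  by (simp_all add: blocks_def rblocks_def)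

lemma in_dents_blocks:
  "p \<in> dents (blocks s P) \<longleftrightarrow> (\<exists>i. 1 \<le> i \<and> i \<le> length s \<and> P i \<and> partial_sum s (i - 1) \<le> p \<and> p
      < partial_sum s i)"
  unfolding dents_iff blocks_def by auto

lemma in_dents_rblocks:
  "p \<in> dents (rblocks L s P) \<longleftrightarrow> (\<exists>i. 1 \<le> i \<and> i \<le> length s \<and> P i \<and> L - partial_sum s i \<le> p \<and> p < L
      - partial_sum s (i - 1))"
  unfolding dents_iff rblocks_def by auto

text \<open>A dent is named by the western end of its unit segment, so mirroring the base sends p to
  L - 1 - p.\<close>

lemma dents_rblocks:
  assumes "sum_list s \<le> L"
  shows "p \<in> dents (rblocks L s P) \<longleftrightarrow> p < L \<and> L - 1 - p \<in> dents (blocks s P)"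
proof -
  have "L - partial_sum s i \<le> p \<and> p < L - partial_sum s (i - 1)
     \<longleftrightarrow> p < L \<and> partial_sum s (i - 1) \<le> L - 1 - p \<and> L - 1 - p < partial_sum s i" for i
    using partial_sum_le[of s i] partial_sum_le[of s "i - 1"] assms by linarith
  then show ?thesis unfolding in_dents_rblocks in_dents_blocks by blast
qed

lemma block_unique:
  assumes "1 \<le> i" "partial_sum s (i - 1) \<le> p" "p < partial_sum s i"
    "1 \<le> j" "partial_sum s (j - 1) \<le> p" "p < partial_sum s j"
  shows "i = j"
proof (rule ccontr)
  assume "i \<noteq> j"
  then consider "i \<le> j - 1" | "j \<le> i - 1" by linarith
  then show False
    using partial_sum_mono[of i "j - 1" s] partial_sum_mono[of j "i - 1" s] assms by cases linarith+
qed

lemma block_exists: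
  assumes "p < sum_list s"
  shows "\<exists>i. 1 \<le> i \<and> i \<le> length s \<and> partial_sum s (i - 1) \<le> p \<and> p < partial_sum s i"
proof -
  obtain i where "i < length s" "partial_sum s i \<le> p" "p < partial_sum s (Suc i)"
    using gap_exists[of "partial_sum s" p "length s"] assms by (auto simp: partial_sum_length)
  then show ?thesis by (intro exI[of _ "Suc i"]) simp
qed

lemma blocks_disjoint: "dents (blocks s P) \<inter> dents (blocks s (\<lambda>i. \<not> P i)) = {}"
  using block_unique unfolding disjoint_iff in_dents_blocks by blast

lemma blocks_union: "dents (blocks s P) \<union> dents (blocks s (\<lambda>i. \<not> P i)) = {..<sum_list s}"
proof (intro equalityI subsetI)
  fix p assume "p \<in> dents (blocks s P) \<union> dents (blocks s (\<lambda>i. \<not> P i))"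
  then obtain i where "p < partial_sum s i" unfolding Un_iff in_dents_blocks by blast
  then show "p \<in> {..<sum_list s}" using partial_sum_le[of s i] by simp
next
  fix p assume "p \<in> {..<sum_list s}"
  then show "p \<in> dents (blocks s P) \<union> dents (blocks s (\<lambda>i. \<not> P i))"
    using block_exists[of p s] unfolding Un_iff in_dents_blocks by auto
qed

lemma card_dents_blocks: "card (dents (blocks s P)) = (\<Sum>i | i \<in> {1..length s} \<and> P i. entry s i)"
proof -
  have "dents (blocks s P) = (\<Union>i\<in>{i \<in> {1..length s}. P i}. {partial_sum s (i - 1)..<partial_sum s
      i})"
    unfolding dents_def blocks_def by auto
  also have "card \<dots> = (\<Sum>i\<in>{i \<in> {1..length s}. P i}. card {partial_sum s (i - 1)..<partial_sum s i})"
  proof (rule card_UN_disjoint)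
    show "\<forall>i\<in>{i \<in> {1..length s}. P i}. \<forall>j\<in>{i \<in> {1..length s}. P i}. i \<noteq> j \<longrightarrow>
      {partial_sum s (i - 1)..<partial_sum s i} \<inter> {partial_sum s (j - 1)..<partial_sum s j} = {}"
    proof (intro ballI impI)
      fix i j assume "i \<in> {i \<in> {1..length s}. P i}" "j \<in> {i \<in> {1..length s}. P i}" and ne: "i \<noteq> j"
      then have "1 \<le> i" "1 \<le> j" by auto
      then show "{partial_sum s (i - 1)..<partial_sum s i} \<inter> {partial_sum s (j - 1)..<partial_sum
          s j} = {}"
        using block_unique[of i s _ j] ne unfolding disjoint_iff atLeastLessThan_iff by blast
    qed
  qed auto
  also have "\<dots> = (\<Sum>i | i \<in> {1..length s} \<and> P i. entry s i)"
    by (rule sum.cong) (auto simp: partial_sum_pred)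
  finally show ?thesis .
qed

lemma card_dents_rblocks:
  assumes "sum_list s \<le> L"
  shows "card (dents (rblocks L s P)) = (\<Sum>i | i \<in> {1..length s} \<and> P i. entry s i)"
proof -
  have sub: "p < L" if "p \<in> dents (blocks s P)" for p
  proof -
    have "p \<in> {..<sum_list s}" using that blocks_union[of s P] by blast
    then show ?thesis using assms by simp
  qed
  have "dents (rblocks L s P) = (\<lambda>r. L - 1 - r) ` dents (blocks s P)"
  proof (intro equalityI subsetI)
    fix p assume "p \<in> dents (rblocks L s P)"
    then have "p < L" "L - 1 - p \<in> dents (blocks s P)" by (auto simp: dents_rblocks[OF assms])
    then show "p \<in> (\<lambda>r. L - 1 - r) ` dents (blocks s P)" by (intro image_eqI[of _ _ "L - 1 - p"])
        auto
  next
    fix p assume "p \<in> (\<lambda>r. L - 1 - r) ` dents (blocks s P)"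
    then obtain r where r: "p = L - 1 - r" "r \<in> dents (blocks s P)" by blast
    then have "r < L" using sub by simp
    then show "p \<in> dents (rblocks L s P)" using r by (auto simp: dents_rblocks[OF assms])
  qed
  moreover have "inj_on (\<lambda>r. L - 1 - r) (dents (blocks s P))"
    using sub by (intro inj_onI) (metis Suc_leI Suc_pred' diff_diff_cancel less_imp_le_nat
        less_Suc_eq_le not_less_zero zero_less_iff_neq_zero)
  ultimately show ?thesis by (simp add: card_image card_dents_blocks)
qed

lemma entry_le_odd_sum: "1 \<le> i \<Longrightarrow> odd i \<Longrightarrow> entry s i \<le> odd_sum s"
proof (cases "i \<le> length s")
  case True
  assume "1 \<le> i" "odd i"
  then show ?thesis unfolding odd_sum_def using True by (intro member_le_sum) auto
qed (simp add: entry_def)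

lemma entry_le_even_sum: "1 \<le> i \<Longrightarrow> even i \<Longrightarrow> entry s i \<le> even_sum s"
proof (cases "i \<le> length s")
  case True
  assume "1 \<le> i" "even i"
  then show ?thesis unfolding even_sum_def using True by (intro member_le_sum) auto
qed (simp add: entry_def)

lemma odd_even_sum: "odd_sum s + even_sum s = sum_list s"
proof -
  have "odd_sum s + even_sum s = card (dents (blocks s even)) + card
      (dents (blocks s (\<lambda>i. \<not> even i)))"
    by (simp add: card_dents_blocks odd_sum_def even_sum_def)
  also have "\<dots> = card (dents (blocks s even) \<union> dents (blocks s (\<lambda>i. \<not> even i)))"
  proof (rule card_Un_disjoint[symmetric])
    show "finite (dents (blocks s even))" "finite (dents (blocks s (\<lambda>i. \<not> even i)))"
      by (rule finite_subset[of _ "{..<sum_list s}"], use blocks_union[of s even] in blast, simp)+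
  qed (rule blocks_disjoint)
  also have "\<dots> = sum_list s" by (simp only: blocks_union card_lessThan)
  finally show ?thesis .
qed

text \<open>The removed triangles stand over the even blocks. By \<open>M_triangles\<close> with h =
  0 they may be replaced by unit dents, and their number \<open>even_sum t\<close> is half the
  height, as \<open>M_dented\<close> demands.\<close>

lemma Q'_dented:
  assumes "even (length t)"
  shows "Q' t = dented (dents (blocks t even))"
proof -
  let ?L = "odd_sum t + even_sum t" and ?A = "2 * even_sum t"
  let ?w = "zigzag_weight (zigzag 0 (int ?A))"
  have w: "upper_weight ?A ?w" by (rule upper_weight_zigzag) simp
  have tri: "(\<Union>i\<in>{1..length t div 2}. up_triangle (real (partial_sum t (2 * i - 1)))
      (real (partial_sum t (2 * i)))) = triangles (blocks t even)"
  proof (intro equalityI subsetI)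
    fix f assume "f \<in> (\<Union>i\<in>{1..length t div 2}. up_triangle (real (partial_sum t (2 * i - 1)))
        (real (partial_sum t (2 * i))))"
    then obtain i where i: "i \<in> {1..length t div 2}" "f \<in> up_triangle
        (real (partial_sum t (2 * i - 1))) (real (partial_sum t (2 * i)))"
      by blast
    have "2 * i \<in> {i \<in> {1..length t}. even i}" using i(1) by auto
    then have "(partial_sum t (2 * i - 1), partial_sum t (2 * i)) \<in> blocks t even"
        unfolding blocks_def by (rule imageI)
    then show "f \<in> triangles (blocks t even)" unfolding triangles_iff using i(2) by blast
  next
    fix f assume "f \<in> triangles (blocks t even)"
    then obtain j where j: "1 \<le> j" "j \<le> length t" "even j" "f \<in> up_triangle
        (real (partial_sum t (j - 1))) (real (partial_sum t j))"
      unfolding triangles_iff blocks_def by auto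
    then obtain i where i: "j = 2 * i" by (elim evenE)
    then have "i \<in> {1..length t div 2}" using j by auto
    then show "f \<in> (\<Union>i\<in>{1..length t div 2}. up_triangle (real (partial_sum t (2 * i - 1)))
        (real (partial_sum t (2 * i))))"
      using j(4) unfolding i by blast
  qed
  have le: "b \<le> ?L \<and> b \<le> a + ?A" if "(a, b) \<in> blocks t even" for a b
  proof -
    from that obtain i where i: "1 \<le> i" "even i" "a = partial_sum t (i - 1)" "b = partial_sum t i"
      unfolding blocks_def by auto
    then show ?thesis
      using partial_sum_le[of t i] odd_even_sum[of t] partial_sum_pred[of i t]
          entry_le_even_sum[of i t] by simp
  qed
  have "Q' t = M (upper_part ?L ?A - triangles (blocks t even), ?w)"
    unfolding Q'_def quartered_hexagon_def tri ..
  also have "\<dots> = M (upper_part ?L ?A - (\<lambda>p. Up (int p) 0) ` ({..<0} \<union> dents (blocks t even)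
      \<union> {}), ?w)"
    by (subst M_triangles[OF w _ _ _ le]) (simp_all add: half_triangle_0)
  also have "\<dots> = dented (dents (blocks t even))"
  proof -
    have "dents (blocks t even) \<subseteq> {..<?L}" using blocks_union[of t even] odd_even_sum[of t] by auto
    then show ?thesis
      using M_dented[OF w, of "dents (blocks t even)" ?L]
          by (simp add: card_dents_blocks even_sum_def)
  qed
  finally show ?thesis .
qed

section \<open>Cutting the region along the base line\<close>

definition upper_dents :: "nat \<Rightarrow> nat list \<Rightarrow> nat list \<Rightarrow> nat set" where
  "upper_dents L as bs = dents (blocks as even \<union> rblocks L bs odd)"

text \<open>Block 1 of \<open>as\<close> stands for the half triangle of side 2 a_1, and the block
  from L to L + z for the completion of the southeastern side.\<close>

definition lower_dents :: "nat \<Rightarrow> nat \<Rightarrow> nat list \<Rightarrow> nat list \<Rightarrow> nat set" where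
  "lower_dents L z as bs = dents (blocks as odd \<union> rblocks L bs even \<union> {(L, L + z)})"

lemma dents_Un [simp]: "dents (I \<union> J) = dents I \<union> dents J"
  by (auto simp: dents_def)

lemma dents_single [simp]: "dents {(s, t)} = {s..<t}"
  by (simp add: dents_def)

lemma blocks_odd_even: "dents (blocks s odd) \<inter> dents (blocks s even) = {}"
  "dents (blocks s odd) \<union> dents (blocks s even) = {..<sum_list s}"
  using blocks_disjoint[of s odd] blocks_union[of s odd] by simp_all

lemma rblocks_odd_even:
  assumes "sum_list s \<le> L"
  shows "dents (rblocks L s odd) \<inter> dents (rblocks L s even) = {}"
    "dents (rblocks L s odd) \<union> dents (rblocks L s even) = {L - sum_list s..<L}"
proof -
  show "dents (rblocks L s odd) \<inter> dents (rblocks L s even) = {}"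
    using blocks_odd_even(1)[of s] unfolding disjoint_iff dents_rblocks[OF assms] by blast
  have *: "q \<in> dents (blocks s odd) \<or> q \<in> dents (blocks s even) \<longleftrightarrow> q < sum_list s" for q
    using blocks_odd_even(2)[of s] by blast
  have 1: "p \<in> dents (rblocks L s odd) \<union> dents (rblocks L s even) \<longleftrightarrow> p < L \<and> L - 1 - p < sum_list
      s" for p
    unfolding Un_iff dents_rblocks[OF assms] *[symmetric] by blast
  have 2: "p < L \<and> L - 1 - p < sum_list s \<longleftrightarrow> L - sum_list s \<le> p \<and> p < L" for p
    using assms by linarith
  show "dents (rblocks L s odd) \<union> dents (rblocks L s even) = {L - sum_list s..<L}"
    by (rule Set.set_eqI) (simp only: 1 2 atLeastLessThan_iff)
qed

text \<open>Consecutive triangles lie on alternate sides of the base line, so each block is dented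
  on exactly one side. Only the free segment of length x + y remains.\<close>

lemma dents_split:
  assumes "sum_list as + sum_list bs \<le> L"
  shows "upper_dents L as bs \<inter> lower_dents L z as bs = {}"
    "upper_dents L as bs \<union> lower_dents L z as bs = {..<sum_list as} \<union> {L - sum_list bs..<L + z}"
proof -
  have bL: "sum_list bs \<le> L" using assms by simp
  note a = blocks_odd_even[of as] and b = rblocks_odd_even[OF bL]
  have *: "p < sum_list as \<Longrightarrow> \<not> L - sum_list bs \<le> p" for p using assms by simp
  have A: "p < sum_list as" if "p \<in> dents (blocks as odd) \<or> p \<in> dents (blocks as even)" for p
    using that a(2) by blast
  have B: "L - sum_list bs \<le> p \<and> p < L" if "p \<in> dents (rblocks L bs odd) \<or> p \<in> dents
      (rblocks L bs even)" for p
    using that b(2) by force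
  show "upper_dents L as bs \<inter> lower_dents L z as bs = {}"
  proof (rule ccontr)
    assume "upper_dents L as bs \<inter> lower_dents L z as bs \<noteq> {}"
    then obtain p where p0: "p \<in> upper_dents L as bs" "p \<in> lower_dents L z as bs" by blast
    have p1: "p \<in> dents (blocks as even) \<or> p \<in> dents (rblocks L bs odd)"
      using p0(1) unfolding upper_dents_def dents_Un by blast
    have p2: "p \<in> dents (blocks as odd) \<or> p \<in> dents (rblocks L bs even) \<or> L \<le> p"
      using p0(2) unfolding lower_dents_def dents_Un dents_single Un_iff atLeastLessThan_iff
          by blast
    have "p < L" using p1
    proof
      assume "p \<in> dents (blocks as even)"
      then have "p < sum_list as" using A by blast
      then show ?thesis using assms by linarith
    next
      assume "p \<in> dents (rblocks L bs odd)"
      then show ?thesis using B by blast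
    qed
    then have "p \<in> dents (blocks as odd) \<or> p \<in> dents (rblocks L bs even)" using p2 by linarith
    with p1 show False using disjoint_iff[THEN iffD1, OF a(1)] disjoint_iff[THEN iffD1, OF b(1)]
        A[of p] B[of p] *[of p]
      by blast
  qed
  have "upper_dents L as bs \<union> lower_dents L z as bs
     = (dents (blocks as odd) \<union> dents (blocks as even)) \<union> (dents (rblocks L bs odd)
         \<union> dents (rblocks L bs even)) \<union> {L..<L + z}"
    unfolding upper_dents_def lower_dents_def dents_Un dents_single by blast
  also have "\<dots> = {..<sum_list as} \<union> {L - sum_list bs..<L + z}"
    unfolding a(2) b(2) using bL by auto
  finally show "upper_dents L as bs \<union> lower_dents L z as bs = {..<sum_list as}
      \<union> {L - sum_list bs..<L + z}" .
qed

lemma finite_dents: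
  assumes "sum_list as + sum_list bs \<le> L"
  shows "finite (upper_dents L as bs)" "finite (lower_dents L z as bs)"
proof -
  have "finite (upper_dents L as bs \<union> lower_dents L z as bs)" unfolding dents_split(2)[OF assms]
      by simp
  then show "finite (upper_dents L as bs)" "finite (lower_dents L z as bs)" by simp_all
qed

lemma card_dents:
  assumes "sum_list as + sum_list bs \<le> L"
  shows "card (upper_dents L as bs) = even_sum as + odd_sum bs"
    "card (lower_dents L z as bs) = odd_sum as + even_sum bs + z"
proof -
  have bL: "sum_list bs \<le> L" using assms by simp
  note b = rblocks_odd_even[OF bL]
  have sep: "dents (blocks as P) \<inter> dents (rblocks L bs Q) = {}" for P Q
  proof (rule ccontr)
    assume "dents (blocks as P) \<inter> dents (rblocks L bs Q) \<noteq> {}"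
    then obtain p where p: "p \<in> dents (blocks as P)" "p < L" "L - 1 - p \<in> dents (blocks bs Q)"
      unfolding disjoint_iff dents_rblocks[OF bL] by blast
    then have "p < sum_list as" "L - 1 - p < sum_list bs"
      using blocks_union[of as P] blocks_union[of bs Q] by blast+
    then show False using p(2) assms by linarith
  qed
  have fin: "finite (dents (blocks as P))" "finite (dents (rblocks L bs Q))" for P Q
    by (auto simp: dents_def)
  show "card (upper_dents L as bs) = even_sum as + odd_sum bs"
    unfolding upper_dents_def dents_Un using sep fin
    by (simp add: card_Un_disjoint card_dents_blocks card_dents_rblocks[OF bL] even_sum_def
        odd_sum_def)
  have "(dents (blocks as odd) \<union> dents (rblocks L bs even)) \<inter> {L..<L + z} = {}"
  proof -
    have "p < L" if "p \<in> dents (blocks as odd)" for p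
    proof -
      have "p \<in> {..<sum_list as}" using that blocks_odd_even(2)[of as] by blast
      then show ?thesis using assms by simp
    qed
    moreover have "p < L" if "p \<in> dents (rblocks L bs even)" for p using that
        by (simp add: dents_rblocks[OF bL])
    ultimately show ?thesis by force
  qed
  then have "card (lower_dents L z as bs) = card (dents (blocks as odd)
      \<union> dents (rblocks L bs even)) + z"
    unfolding lower_dents_def dents_Un dents_single using fin by (subst card_Un_disjoint) auto
  then show "card (lower_dents L z as bs) = odd_sum as + even_sum bs + z"
    using sep fin by (simp add: card_Un_disjoint card_dents_blocks card_dents_rblocks[OF bL]
        even_sum_def odd_sum_def)
qed

text \<open>\<open>M_cut\<close> at height 0, followed by \<open>M_triangles\<close> on both sides,
  after reflection for the lower one. The balance of the upper part forces
  \<open>card S = y\<close>. The dented lower part contains a_1 forced lozenges of weight 1/2 that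
  the region itself lacks, whence the power of 2.\<close>

lemma M_RW1:
  fixes x y z :: nat and as bs :: "nat list"
  defines "a \<equiv> sum_list as" and "L \<equiv> x + y + sum_list as + sum_list bs"
  shows "M (RW1 x y z as bs) = 2 ^ entry as 1 *
    (\<Sum>S | S \<subseteq> {a..<a + (x + y)} \<and> card S = y. dented (upper_dents L as bs \<union> S) * dented
        (lower_dents L z as bs \<union> S))"
proof -
  define A where "A = 2 * (y + even_sum as + odd_sum bs)"
  define B where "B = 2 * (y + z + odd_sum as + even_sum bs)"
  define h where "h = entry as 1"
  define w where "w = zigzag_weight (zigzag (- int B) (int A))"
  define R where "R = upper_part L A \<union> lower_part L z B
           - below_west (real (entry as 1))
           - (\<Union>i\<in>{2..length as}.
                (if even i then up_triangle else down_triangle)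
                  (real (partial_sum as (i - 1))) (real (partial_sum as i)))
           - (\<Union>j\<in>{1..length bs}.
                (if odd j then up_triangle else down_triangle)
                  (real L - real (partial_sum bs j)) (real L - real (partial_sum bs (j - 1))))"
  define \<I> where "\<I> = blocks as even \<union> rblocks L bs odd"
  \<comment> \<open>The index 1 is left out because this block is the half triangle, which is
    removed as \<open>below_west\<close>.\<close>
  define \<J>1 where "\<J>1 = (\<lambda>i. (partial_sum as (i - 1), partial_sum as i)) ` {i \<in> {2..length as}.
      odd i}"
  define \<J> where "\<J> = \<J>1 \<union> rblocks L bs even \<union> {(L, L + z)}"
  let ?mid = "{a..<a + (x + y)}"
  have RW: "RW1 x y z as bs = (R, w)"
    unfolding RW1_def Let_def R_def w_def A_def B_def L_def ..
  have abL: "sum_list as + sum_list bs \<le> L" and bL: "sum_list bs \<le> L" by (simp_all add: L_def)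
  have diff: "real L - real (partial_sum bs j) = real (L - partial_sum bs j)" for j
    using partial_sum_le[of bs j] bL by (simp add: of_nat_diff)
  have triI: "f \<in> triangles \<I> \<longleftrightarrow>
     (\<exists>i\<in>{2..length as}. even i \<and> f \<in> up_triangle (real (partial_sum as (i - 1)))
         (real (partial_sum as i))) \<or>
     (\<exists>j\<in>{1..length bs}. odd j \<and> f \<in> up_triangle (real (L - partial_sum bs j))
         (real (L - partial_sum bs (j - 1))))" for f
  proof -
    have "{i \<in> {1..length as}. even i} = {i \<in> {2..length as}. even i}"
    proof (intro Collect_cong)
      fix i :: nat
      have "even i \<Longrightarrow> 1 \<le> i \<Longrightarrow> 2 \<le> i" by presburger
      then show "i \<in> {1..length as} \<and> even i \<longleftrightarrow> i \<in> {2..length as} \<and> even i" by auto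
    qed
    then show ?thesis unfolding triangles_iff \<I>_def blocks_def rblocks_def by blast
  qed
  have triJ: "f \<in> triangles \<J> \<longleftrightarrow>
     (\<exists>i\<in>{2..length as}. odd i \<and> f \<in> up_triangle (real (partial_sum as (i - 1)))
         (real (partial_sum as i))) \<or>
     (\<exists>j\<in>{1..length bs}. even j \<and> f \<in> up_triangle (real (L - partial_sum bs j))
         (real (L - partial_sum bs (j - 1)))) \<or>
     f \<in> up_triangle (real L) (real (L + z))" for f
    unfolding triangles_iff \<J>_def \<J>1_def rblocks_def by blast
  have upper: "{f \<in> R. 0 \<le> face_row f} = upper_part L A - triangles \<I>"
  proof (rule Set.set_eqI)
    fix f
    show "f \<in> {f \<in> R. 0 \<le> face_row f} \<longleftrightarrow> f \<in> upper_part L A - triangles \<I>"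
    proof (cases "0 \<le> face_row f")
      case True
      then have neg: "face_row (reflect f) < 0" by (simp add: face_row_reflect)
      have d: "f \<notin> down_triangle (real s) (real t)" for s t
        using neg up_triangle_face_row[of "reflect f" s t] unfolding down_triangle_reflect by auto
      have l: "f \<notin> lower_part L z B"
        using neg upper_part_face_row[of "reflect f"] unfolding lower_part_reflect by auto
      have b: "f \<notin> below_west (real (entry as 1))"
        using neg half_triangle_face_row[of "reflect f"] unfolding below_west_reflect by auto
      show ?thesis
        unfolding R_def diff Diff_iff Un_iff UN_iff mem_Collect_eq triI using True d l b by auto
    next
      case False
      then show ?thesis using upper_part_face_row[of f] by auto
    qed
  qed
  have lower: "{f \<in> R. face_row f < 0} = reflect ` (upper_part (L + z) B - half_triangle h
      - triangles \<J>)"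
  proof (rule Set.set_eqI)
    fix f
    have "f \<in> reflect ` Z \<longleftrightarrow> reflect f \<in> Z" for Z by (metis imageE imageI reflect_reflect)
    moreover have "f \<in> {f \<in> R. face_row f < 0} \<longleftrightarrow> reflect f \<in> upper_part (L + z) B - half_triangle
        h - triangles \<J>"
    proof (cases "face_row f < 0")
      case True
      have u: "f \<notin> up_triangle (real s) (real t)" for s t
          using True up_triangle_face_row[of f s t] by auto
      have p: "f \<notin> upper_part L A" using True upper_part_face_row[of f] by auto
      show ?thesis
        unfolding R_def diff Diff_iff Un_iff UN_iff mem_Collect_eq triJ h_def
          lower_part_reflect below_west_reflect using True u p by (auto simp: down_triangle_reflect)
    next
      case False
      then show ?thesis using upper_part_face_row[of "reflect f"] by (auto simp: face_row_reflect)
    qed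
    ultimately show "f \<in> {f \<in> R. face_row f < 0}
        \<longleftrightarrow> f \<in> reflect ` (upper_part (L + z) B - half_triangle h - triangles \<J>)" by simp
  qed
  have fin: "finite R"
  proof -
    have "R = {f \<in> R. 0 \<le> face_row f} \<union> {f \<in> R. face_row f < 0}" by auto
    moreover have "finite ({f \<in> R. 0 \<le> face_row f} \<union> {f \<in> R. face_row f < 0})"
      unfolding upper lower by (simp add: finite_upper_part)
    ultimately show ?thesis by (rule ssubst)
  qed
  define w' where "w' = (\<lambda>l. w (reflect ` l))"
  have uw: "upper_weight A w" unfolding w_def by (rule upper_weight_zigzag) simp
  have lw: "upper_weight B w'" unfolding w_def w'_def by (rule upper_weight_zigzag_reflect) simp
  have UD: "dents \<I> = upper_dents L as bs" unfolding \<I>_def upper_dents_def ..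
  have LD: "{..<h} \<union> dents \<J> = lower_dents L z as bs"
  proof -
    have "{..<h} \<union> dents \<J>1 = dents (blocks as odd)"
    proof (cases "as = []")
      case True
      then show ?thesis by (simp add: h_def entry_def \<J>1_def blocks_def dents_def)
    next
      case False
      have "{i \<in> {1..length as}. odd i} = insert 1 {i \<in> {2..length as}. odd i}"
        using False by (auto simp: Suc_le_eq)
      then have "blocks as odd = insert (0, h) \<J>1"
        unfolding blocks_def \<J>1_def h_def by simp
      then show ?thesis using dents_Un[of "{(0, h)}" \<J>1] by (simp add: atLeast0LessThan)
    qed
    then show ?thesis unfolding \<J>_def lower_dents_def dents_Un dents_single by blast
  qed
  have h: "2 * h \<le> B" "h \<le> L + z"
    using entry_le_odd_sum[of 1 as] partial_sum_le[of as 1] by (simp_all add: h_def B_def L_def)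
  have finI: "finite \<I>" and finJ: "finite \<J>" by (simp_all add: \<I>_def \<J>_def \<J>1_def)
  have inI: "t \<le> L \<and> t \<le> s + A" if "(s, t) \<in> \<I>" for s t
  proof -
    from that consider i where "1 \<le> i" "even i" "s = partial_sum as (i - 1)" "t = partial_sum as i"
      | j where "1 \<le> j" "odd j" "s = L - partial_sum bs j" "t = L - partial_sum bs (j - 1)"
      unfolding \<I>_def blocks_def rblocks_def by auto
    then show ?thesis
    proof cases
      case 1
      then show ?thesis using partial_sum_pred[of i as] entry_le_even_sum[of i as]
          partial_sum_le[of as i]
        by (simp add: A_def L_def)
    next
      case 2
      have *: "n - p \<le> n - (p + e) + e" for n p e :: nat by arith
      have "t \<le> s + entry bs j" unfolding 2(3,4) partial_sum_pred[OF 2(1), of bs] by (rule *)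
      moreover have "t \<le> L" unfolding 2(4) by simp
      ultimately show ?thesis using entry_le_odd_sum[OF 2(1,2), of bs] by (simp add: A_def)
    qed
  qed
  have inJ: "t \<le> L + z \<and> t \<le> s + B" if "(s, t) \<in> \<J>" for s t
  proof -
    from that consider i where "2 \<le> i" "odd i" "s = partial_sum as (i - 1)" "t = partial_sum as i"
      | j where "1 \<le> j" "even j" "s = L - partial_sum bs j" "t = L - partial_sum bs (j - 1)"
      | "s = L" "t = L + z"
      unfolding \<J>_def \<J>1_def rblocks_def by auto
    then show ?thesis
    proof cases
      case 1
      then show ?thesis using partial_sum_pred[of i as] entry_le_odd_sum[of i as]
          partial_sum_le[of as i]
        by (simp add: B_def L_def)
    next
      case 2
      have *: "n - p \<le> n - (p + e) + e" for n p e :: nat by arith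
      have "t \<le> s + entry bs j" unfolding 2(3,4) partial_sum_pred[OF 2(1), of bs] by (rule *)
      moreover have "t \<le> L" unfolding 2(4) by simp
      ultimately show ?thesis using entry_le_even_sum[OF 2(1,2), of bs] by (simp add: B_def)
    next
      case 3
      then show ?thesis by (simp add: B_def)
    qed
  qed
  have upM: "M ({f \<in> R. 0 \<le> face_row f} - (\<lambda>p. Up (int p) 0) ` S, w)
      = M (upper_part L A - (\<lambda>p. Up (int p) 0) ` (upper_dents L as bs \<union> S), w)" for S
  proof -
    have "M (upper_part L A - (\<lambda>p. Up (int p) 0) ` ({..<0} \<union> dents \<I> \<union> S), w)
      = (1 / 2) ^ 0 * M (upper_part L A - half_triangle 0 - triangles \<I> - (\<lambda>p. Up (int p) 0)
          ` S, w)"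
      by (rule M_triangles[OF uw _ _ finI inI]) simp_all
    then show ?thesis unfolding half_triangle_0 upper UD by simp
  qed
  have lowM: "M ({f \<in> R. face_row f < 0} - (\<lambda>p. Down (int p) 0) ` S, w)
      = 2 ^ h * M (upper_part (L + z) B - (\<lambda>p. Up (int p) 0) ` (lower_dents L z as bs \<union> S), w')"
          for S
  proof -
    let ?G = "upper_part (L + z) B - half_triangle h - triangles \<J>"
    have "(\<lambda>p. Down (int p) 0) ` S = reflect ` (\<lambda>p. Up (int p) 0) ` S" by (simp add: image_image)
    then have "{f \<in> R. face_row f < 0} - (\<lambda>p. Down (int p) 0) ` S
        = reflect ` (?G - (\<lambda>p. Up (int p) 0) ` S)"
      unfolding lower by (simp only: image_set_diff[OF inj_reflect])
    then have "M ({f \<in> R. face_row f < 0} - (\<lambda>p. Down (int p) 0) ` S, w)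
        = M (?G - (\<lambda>p. Up (int p) 0) ` S, w')"
      by (simp only: M_reflect w'_def)
    moreover have "M (upper_part (L + z) B - (\<lambda>p. Up (int p) 0) ` ({..<h} \<union> dents \<J> \<union> S), w')
      = (1 / 2) ^ h * M (?G - (\<lambda>p. Up (int p) 0) ` S, w')"
      by (rule M_triangles[OF lw h finJ inJ])
    moreover have "2 ^ h * ((1 / 2) ^ h * m) = m" for m :: real by (simp add: power_divide)
    ultimately show ?thesis unfolding LD by simp
  qed
  define C where "C = {p. Up (int p) 0 \<in> R \<and> Down (int p) 0 \<in> R}"
  have dI: "Up (int p) 0 \<in> triangles \<K> \<longleftrightarrow> p \<in> dents \<K>" for p \<K>
    unfolding triangles_iff dents_iff Up_up_triangle by simp
  have memU: "Up p 0 \<in> R \<longleftrightarrow> Up p 0 \<in> upper_part L A - triangles \<I>" for p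
    unfolding upper[symmetric] by simp
  have memD: "Down p 0 \<in> R \<longleftrightarrow> Up p 0 \<in> upper_part (L + z) B - half_triangle h - triangles \<J>" for p
  proof -
    have "Down p 0 \<in> R \<longleftrightarrow> Down p 0 \<in> {f \<in> R. face_row f < 0}" by simp
    also have "\<dots> \<longleftrightarrow> Up p 0 \<in> upper_part (L + z) B - half_triangle h - triangles \<J>"
      unfolding lower by (metis (no_types, lifting) add.right_neutral imageE imageI
          neg_equal_0_iff_equal reflect.simps(1) reflect_reflect)
    finally show ?thesis .
  qed
  note split = dents_split[OF abL, of z]
  \<comment> \<open>If one of the parts has height 0, nothing can cross the base line.\<close>
  have C: "p \<in> C \<longleftrightarrow> 0 < A \<and> 0 < B \<and> p \<in> ?mid" for p
  proof -
    have "p \<in> C \<longleftrightarrow> 0 < A \<and> 0 < B \<and> p < L \<and> p \<notin> upper_dents L as bs \<union> lower_dents L z as bs"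
      unfolding C_def mem_Collect_eq memU memD Diff_iff dI UD LD[symmetric] Up_upper_part
          Up_half_triangle by auto
    also have "\<dots> \<longleftrightarrow> 0 < A \<and> 0 < B \<and> p \<in> ?mid"
      unfolding split(2) by (auto simp: a_def L_def)
    finally show ?thesis .
  qed
  have Cint: "{p. Up p 0 \<in> R \<and> Down p 0 \<in> R} = int ` C"
  proof (intro equalityI subsetI)
    fix p assume p: "p \<in> {p. Up p 0 \<in> R \<and> Down p 0 \<in> R}"
    then have "0 \<le> p" by (simp add: memU Up_upper_part)
    then have "p = int (nat p)" by simp
    moreover from this p have "nat p \<in> C" unfolding C_def by simp
    ultimately show "p \<in> int ` C" by (rule image_eqI)
  qed (auto simp: C_def)
  have Cmid: "C \<subseteq> ?mid" using C by blast
  then have finC: "finite C" by (rule finite_subset) simp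
  let ?t = "\<lambda>S. dented (upper_dents L as bs \<union> S) * dented (lower_dents L z as bs \<union> S)"
  have "M (R, w) = (\<Sum>X | X \<subseteq> int ` C. (\<Prod>p\<in>X. w {Up p 0, Down p 0})
      * M ({f \<in> R. face_row f < 0} - (\<lambda>p. Down p 0) ` X, w)
          * M ({f \<in> R. 0 \<le> face_row f} - (\<lambda>p. Up p 0) ` X, w))"
    using M_cut[OF fin, of w 0] unfolding Cint .
  also have "\<dots> = (\<Sum>S | S \<subseteq> C. (\<Prod>p\<in>int ` S. w {Up p 0, Down p 0})
      * M ({f \<in> R. face_row f < 0} - (\<lambda>p. Down p 0) ` int ` S, w)
          * M ({f \<in> R. 0 \<le> face_row f} - (\<lambda>p. Up p 0) ` int ` S, w))"
  proof (rule sum.reindex_bij_witness[of _ "(`) int" "\<lambda>X. int -` X"])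
    fix X assume "X \<in> {X. X \<subseteq> int ` C}"
    then have X: "X \<subseteq> int ` C" by simp
    then show e: "int ` int -` X = X" by blast
    show "int -` X \<in> {S. S \<subseteq> C}" using X by auto
    show "(\<Prod>p\<in>int ` int -` X. w {Up p 0, Down p 0})
      * M ({f \<in> R. face_row f < 0} - (\<lambda>p. Down p 0) ` int ` int -` X, w)
          * M ({f \<in> R. 0 \<le> face_row f} - (\<lambda>p. Up p 0) ` int ` int -` X, w)
      = (\<Prod>p\<in>X. w {Up p 0, Down p 0})
      * M ({f \<in> R. face_row f < 0} - (\<lambda>p. Down p 0) ` X, w)
          * M ({f \<in> R. 0 \<le> face_row f} - (\<lambda>p. Up p 0) ` X, w)"
      unfolding e ..
  next
    fix S assume "S \<in> {S. S \<subseteq> C}"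
    then show "int ` S \<in> {X. X \<subseteq> int ` C}" by auto
    show "int -` int ` S = S" by (rule inj_vimage_image_eq) simp
  qed
  also have "\<dots> = (\<Sum>S | S \<subseteq> C. 2 ^ h * (if card S = y then ?t S else 0))"
  proof (rule sum.cong[OF refl])
    fix S assume "S \<in> {S. S \<subseteq> C}"
    then have S: "S \<subseteq> C" by simp
    have Smid: "S \<subseteq> ?mid" using S Cmid by (rule subset_trans)
    have finS: "finite S" using S finC finite_subset by blast
    have dj: "(upper_dents L as bs \<union> lower_dents L z as bs) \<inter> S = {}"
      using Smid unfolding split(2) by (auto simp: a_def L_def)
    have cU: "card (upper_dents L as bs \<union> S) = even_sum as + odd_sum bs + card S"
      and cL: "card (lower_dents L z as bs \<union> S) = odd_sum as + even_sum bs + z + card S"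
      using dj finS finite_dents(1)[OF abL] finite_dents(2)[OF abL, of z]
          by (simp_all add: card_Un_disjoint Int_Un_distrib2 card_dents[OF abL])
    have SL: "S \<subseteq> {..<L}" using Smid by (auto simp: a_def L_def)
    have subU: "upper_dents L as bs \<union> S \<subseteq> {..<L}"
    proof -
      have "p < L" if "p \<in> upper_dents L as bs" for p
      proof -
        have "p \<in> {..<sum_list as} \<union> {L - sum_list bs..<L + 0}"
          using that dents_split(2)[OF abL, of 0] by blast
        then show ?thesis by (auto simp: L_def)
      qed
      then show ?thesis using SL by auto
    qed
    have subL: "lower_dents L z as bs \<union> S \<subseteq> {..<L + z}"
    proof -
      have "p < L + z" if "p \<in> lower_dents L z as bs" for p
      proof -
        have "p \<in> {..<sum_list as} \<union> {L - sum_list bs..<L + z}" using that split(2) by blast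
        then show ?thesis by (auto simp: L_def)
      qed
      then show ?thesis using SL by auto
    qed
    \<comment> \<open>The base line has even height, so crossing lozenges are never halved.\<close>
    have one: "(\<Prod>p\<in>int ` S. w {Up p 0, Down p 0}) = 1"
      unfolding w_def zigzag_weight_vertical by (rule prod.neutral) simp
    have U0: "M (upper_part L A - (\<lambda>p. Up (int p) 0) ` (upper_dents L as bs \<union> S), w)
       = (if card S = y then dented (upper_dents L as bs \<union> S) else 0)"
    proof (cases "card S = y")
      case True
      then show ?thesis using M_dented[OF uw _ subU] cU by (simp add: A_def)
    next
      case False
      have "A \<le> 2 * L" using odd_even_sum[of as] odd_even_sum[of bs] by (simp add: A_def L_def)
      \<comment> \<open>With A = 0 there would be no crossing and y = 0, so the empty S would have
        size y after all.\<close>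
      moreover have "0 < A"
      proof (rule ccontr)
        assume "\<not> 0 < A"
        then have "y = 0" by (simp add: A_def)
        moreover have "C = {}" using C \<open>\<not> 0 < A\<close> by blast
        ultimately show False using False S by simp
      qed
      ultimately show ?thesis using M_dented_zero[OF _ _ _ subU] cU False by (simp add: A_def)
    qed
    \<comment> \<open>Sets of any other size are already annihilated by the upper factor.\<close>
    have L0: "M (upper_part (L + z) B - (\<lambda>p. Up (int p) 0) ` (lower_dents L z as bs \<union> S), w')
        = dented (lower_dents L z as bs \<union> S)"
      if "card S = y"
      by (rule M_dented[OF lw _ subL]) (simp add: cL that B_def)
    show "(\<Prod>p\<in>int ` S. w {Up p 0, Down p 0})
      * M ({f \<in> R. face_row f < 0} - (\<lambda>p. Down p 0) ` int ` S, w)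
          * M ({f \<in> R. 0 \<le> face_row f} - (\<lambda>p. Up p 0) ` int ` S, w)
      = 2 ^ h * (if card S = y then ?t S else 0)"
      unfolding one image_image upM lowM U0 using L0 by simp
  qed
  also have "\<dots> = 2 ^ h * (\<Sum>S | S \<subseteq> C \<and> card S = y. ?t S)"
    unfolding sum_distrib_left[symmetric] by (simp add: sum.If_cases finC Int_def)
  \<comment> \<open>For y = 0 both sides contain just the empty set, although C may be empty while
    the free segment is not. For y > 0 both heights are positive and C is the whole segment.\<close>
  also have "{S. S \<subseteq> C \<and> card S = y} = {S. S \<subseteq> ?mid \<and> card S = y}"
  proof (cases "y = 0")
    case True
    have "finite S" if "S \<subseteq> C \<or> S \<subseteq> ?mid" for S
      using that finC finite_subset[of S C] finite_subset[of S ?mid] by blast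
    then have "S \<subseteq> C \<and> card S = 0 \<longleftrightarrow> S \<subseteq> ?mid \<and> card S = 0" for S
      using card_0_eq by blast
    then show ?thesis unfolding True by simp
  next
    case False
    then have "0 < A" "0 < B" by (simp_all add: A_def B_def)
    then have "C = ?mid" using C by blast
    then show ?thesis by simp
  qed
  finally show ?thesis unfolding RW h_def .
qed

section \<open>The dents encoded by the sequences \<open>t_plus\<close> and
  \<open>t_minus\<close>\<close>

lemma dents_blocks_append:
  "p \<in> dents (blocks (xs @ ys) P) \<longleftrightarrow> p \<in> dents (blocks xs P) \<or>
     (sum_list xs \<le> p \<and> p - sum_list xs \<in> dents (blocks ys (\<lambda>i. P (i + length xs))))"
proof -
  have 1: "partial_sum (xs @ ys) i = partial_sum xs i" if "i \<le> length xs" for i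
    using that by (simp add: partial_sum_take)
  have 2: "partial_sum (xs @ ys) (i + length xs) = sum_list xs + partial_sum ys i" for i
    by (simp add: partial_sum_take)
  show ?thesis
  proof
    assume "p \<in> dents (blocks (xs @ ys) P)"
    then obtain i where i: "1 \<le> i" "i \<le> length xs + length ys" "P i" "partial_sum (xs @ ys)
        (i - 1) \<le> p" "p < partial_sum (xs @ ys) i"
      unfolding in_dents_blocks by auto
    show "p \<in> dents (blocks xs P) \<or> (sum_list xs \<le> p \<and> p - sum_list xs \<in> dents
        (blocks ys (\<lambda>i. P (i + length xs))))"
    proof (cases "i \<le> length xs")
      case True
      then have "p \<in> dents (blocks xs P)" unfolding in_dents_blocks using i 1[of i] 1[of "i - 1"]
          by (intro exI[of _ i]) auto
      then show ?thesis ..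
    next
      case False
      define j where "j = i - length xs"
      have j: "i = j + length xs" "1 \<le> j" "j \<le> length ys" "i - 1 = (j - 1) + length xs"
          using False i(2) by (auto simp: j_def)
      have "sum_list xs + partial_sum ys (j - 1) \<le> p" "p < sum_list xs + partial_sum ys j"
        using i(4,5) 2[of j] 2[of "j - 1"] unfolding j(4) unfolding j(1) by auto
      then have "sum_list xs \<le> p" "partial_sum ys (j - 1) \<le> p - sum_list xs" "p - sum_list xs
          < partial_sum ys j" by auto
      then show ?thesis unfolding in_dents_blocks using j(2,3) i(3) unfolding j(1) by blast
    qed
  next
    assume "p \<in> dents (blocks xs P) \<or> (sum_list xs \<le> p \<and> p - sum_list xs \<in> dents
        (blocks ys (\<lambda>i. P (i + length xs))))"
    then show "p \<in> dents (blocks (xs @ ys) P)"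
    proof
      assume "p \<in> dents (blocks xs P)"
      then obtain i where i: "1 \<le> i" "i \<le> length xs" "P i" "partial_sum xs (i - 1) \<le> p" "p
          < partial_sum xs i"
        unfolding in_dents_blocks by auto
      then show ?thesis unfolding in_dents_blocks using 1[of i] 1[of "i - 1"]
          by (intro exI[of _ i]) auto
    next
      assume a: "sum_list xs \<le> p \<and> p - sum_list xs \<in> dents (blocks ys (\<lambda>i. P (i + length xs)))"
      then obtain j where j: "1 \<le> j" "j \<le> length ys" "P (j + length xs)" "partial_sum ys (j - 1) \<le>
          p - sum_list xs" "p - sum_list xs < partial_sum ys j"
        unfolding in_dents_blocks by auto
      have e: "j + length xs - 1 = (j - 1) + length xs" using j(1) by simp
      show ?thesis unfolding in_dents_blocks
      proof (intro exI[of _ "j + length xs"] conjI)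
        show "partial_sum (xs @ ys) (j + length xs - 1) \<le> p" "p < partial_sum (xs @ ys)
            (j + length xs)"
          unfolding e 2 using a j(4,5) by linarith+
      qed (use j in auto)
    qed
  qed
qed

lemma dents_blocks_single: "dents (blocks [c] P) = (if P 1 then {..<c} else {})"
proof -
  have "p \<in> dents (blocks [c] P) \<longleftrightarrow> P 1 \<and> p < c" for p
  proof -
    have "p \<in> dents (blocks [c] P) \<longleftrightarrow> (\<exists>i. i = 1 \<and> P i \<and> partial_sum [c] (i - 1) \<le> p \<and> p
        < partial_sum [c] i)"
      unfolding in_dents_blocks by (rule ex_cong1) auto
    then show ?thesis by (simp add: partial_sum_take)
  qed
  then show ?thesis by auto
qed

lemma dents_blocks_rev:
  "p \<in> dents (blocks (rev xs) P) \<longleftrightarrow> p < sum_list xs \<and> sum_list xs - 1 - p \<in> dents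
      (blocks xs (\<lambda>i. P (length xs + 1 - i)))"
proof -
  have ps: "partial_sum (rev xs) i = sum_list xs - partial_sum xs (length xs - i)" for i
  proof -
    have "sum_list (take (length xs - i) xs) + sum_list (drop (length xs - i) xs) = sum_list xs"
      by (metis append_take_drop_id sum_list_append)
    then show ?thesis by (simp add: partial_sum_take take_rev)
  qed
  have iff: "partial_sum (rev xs) (i - 1) \<le> p \<and> p < partial_sum (rev xs) i
     \<longleftrightarrow> p < sum_list xs \<and> partial_sum xs (length xs - i) \<le> sum_list xs - 1 - p \<and> sum_list xs - 1
         - p < partial_sum xs (length xs + 1 - i)"
    if "1 \<le> i" "i \<le> length xs" for i
  proof -
    have *: "S - U \<le> p \<and> p < S - V \<longleftrightarrow> p < S \<and> V \<le> S - 1 - p \<and> S - 1 - p < U" if "U \<le> S" "V \<le> S"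
        for S U V :: nat
      using that by linarith
    have e: "length xs - (i - 1) = length xs + 1 - i" using that by simp
    show ?thesis unfolding ps e by (rule *[OF partial_sum_le partial_sum_le])
  qed
  have "p \<in> dents (blocks (rev xs) P) \<longleftrightarrow> (\<exists>i. 1 \<le> i \<and> i \<le> length xs \<and> P i \<and> p < sum_list xs
     \<and> partial_sum xs (length xs - i) \<le> sum_list xs - 1 - p \<and> sum_list xs - 1 - p < partial_sum xs
         (length xs + 1 - i))"
    unfolding in_dents_blocks length_rev using iff by blast
  also have "\<dots> \<longleftrightarrow> (\<exists>j. 1 \<le> j \<and> j \<le> length xs \<and> P (length xs + 1 - j) \<and> p < sum_list xs
     \<and> partial_sum xs (j - 1) \<le> sum_list xs - 1 - p \<and> sum_list xs - 1 - p < partial_sum xs j)"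
         (is "?l \<longleftrightarrow> ?r")
  proof
    assume ?l
    then obtain i where i: "1 \<le> i" "i \<le> length xs" "P i" "p < sum_list xs"
     "partial_sum xs (length xs - i) \<le> sum_list xs - 1 - p" "sum_list xs - 1 - p < partial_sum xs
         (length xs + 1 - i)" by blast
    have "length xs + 1 - (length xs + 1 - i) = i" "length xs + 1 - i - 1 = length xs - i" using i
        by auto
    then show ?r using i by (intro exI[of _ "length xs + 1 - i"]) auto
  next
    assume ?r
    then obtain j where j: "1 \<le> j" "j \<le> length xs" "P (length xs + 1 - j)" "p < sum_list xs"
     "partial_sum xs (j - 1) \<le> sum_list xs - 1 - p" "sum_list xs - 1 - p < partial_sum xs j"
         by blast
    have "length xs + 1 - (length xs + 1 - j) = j" "length xs - (length xs + 1 - j) = j - 1"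
        using j by auto
    then show ?l using j by (intro exI[of _ "length xs + 1 - j"]) auto
  qed
  finally show ?thesis unfolding in_dents_blocks by blast
qed

lemma partial_sum_map_entry: "i \<le> k \<Longrightarrow> partial_sum (map (entry s) [1..<k + 1]) i = partial_sum s i"
proof (induction i)
  case (Suc i)
  have "entry (map (entry s) [1..<k + 1]) (Suc i) = entry s (Suc i)"
    using Suc.prems unfolding entry_def[of "map (entry s) [1..<k + 1]"] by (simp del: upt_Suc)
  then show ?case using Suc by (simp del: upt_Suc)
qed simp

lemma partial_sum_ge: "length s \<le> k \<Longrightarrow> partial_sum s k = sum_list s"
  by (simp add: partial_sum_take)

lemma sum_list_map_entry: "sum_list (map (entry s) [1..<k + 1]) = partial_sum s k"
  using partial_sum_map_entry[of k k s] partial_sum_length[of "map (entry s) [1..<k + 1]"]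
      by (simp del: upt_Suc)

text \<open>Terms beyond the end of \<open>s\<close> are 0 and give empty blocks, so a sequence may
  be padded, or cut behind its last selected term.\<close>

lemma dents_blocks_map_entry:
  assumes "\<And>i. k < i \<Longrightarrow> i \<le> length s \<Longrightarrow> \<not> Q i" "\<And>i. 1 \<le> i \<Longrightarrow> i \<le> k \<Longrightarrow> P i \<longleftrightarrow> Q i"
  shows "dents (blocks (map (entry s) [1..<k + 1]) P) = dents (blocks s Q)"
proof (rule Set.set_eqI)
  fix p
  let ?t = "map (entry s) [1..<k + 1]"
  have len: "length ?t = k" by simp
  show "p \<in> dents (blocks ?t P) \<longleftrightarrow> p \<in> dents (blocks s Q)"
  proof
    assume "p \<in> dents (blocks ?t P)"
    then obtain i where i: "1 \<le> i" "i \<le> k" "P i" "partial_sum ?t (i - 1) \<le> p" "p < partial_sum ?t i"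
      unfolding in_dents_blocks len by blast
    then have ps: "partial_sum s (i - 1) \<le> p" "p < partial_sum s i"
      using partial_sum_map_entry[of i k s] partial_sum_map_entry[of "i - 1" k s] by simp_all
    have "i \<le> length s"
    proof (rule ccontr)
      assume "\<not> i \<le> length s"
      then have "partial_sum s (i - 1) = partial_sum s i" using partial_sum_ge[of s i]
          partial_sum_ge[of s "i - 1"] by simp
      then show False using ps by simp
    qed
    then show "p \<in> dents (blocks s Q)" unfolding in_dents_blocks using i ps assms(2)[of i] by blast
  next
    assume "p \<in> dents (blocks s Q)"
    then obtain i where i: "1 \<le> i" "i \<le> length s" "Q i" "partial_sum s (i - 1) \<le> p" "p
        < partial_sum s i"
      unfolding in_dents_blocks by blast
    then have ik: "i \<le> k" using assms(1)[of i] by force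
    then have "partial_sum ?t (i - 1) \<le> p" "p < partial_sum ?t i"
      using partial_sum_map_entry[of i k s] partial_sum_map_entry[of "i - 1" k s] i by simp_all
    then show "p \<in> dents (blocks ?t P)" unfolding in_dents_blocks len using i ik assms(2)[of i]
        by blast
  qed
qed

text \<open>The reversed terms \<open>b_k, ..., b_1\<close> end at L, so their blocks are those laid
  westwards from L.\<close>

lemma dents_tail:
  assumes "s0 + partial_sum bs k = L" "sum_list bs \<le> L"
    and "\<And>i. k < i \<Longrightarrow> i \<le> length bs \<Longrightarrow> \<not> Q i" "\<And>i. 1 \<le> i \<Longrightarrow> i \<le> k \<Longrightarrow> P (k + 1 - i) \<longleftrightarrow> Q i"
  shows "s0 \<le> p \<and> p - s0 \<in> dents (blocks (rev (map (entry bs) [1..<k + 1])) P)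
      \<longleftrightarrow> p \<in> dents (rblocks L bs Q)"
proof -
  let ?s = "map (entry bs) [1..<k + 1]"
  have len: "length ?s = k" by simp
  have D: "dents (blocks ?s (\<lambda>i. P (k + 1 - i))) = dents (blocks bs Q)"
    by (rule dents_blocks_map_entry) (use assms(3,4) in auto)
  have small: "q < partial_sum bs k" if "q \<in> dents (blocks bs Q)" for q
  proof -
    have "q \<in> dents (blocks ?s (\<lambda>i. P (k + 1 - i)))" using that D by simp
    then have "q \<in> {..<sum_list ?s}" using blocks_union[of ?s] by blast
    then show ?thesis unfolding sum_list_map_entry by simp
  qed
  have "p - s0 \<in> dents (blocks (rev ?s) P) \<longleftrightarrow> p - s0 < partial_sum bs k \<and> partial_sum bs k - 1
      - (p - s0) \<in> dents (blocks bs Q)"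
    unfolding dents_blocks_rev len D sum_list_map_entry ..
  moreover have "s0 \<le> p \<Longrightarrow> partial_sum bs k - 1 - (p - s0) = L - 1 - p" using assms(1) by auto
  moreover have "s0 \<le> p" if "p < L" "L - 1 - p \<in> dents (blocks bs Q)"
    using small[OF that(2)] that(1) assms(1) by linarith
  moreover have "s0 \<le> p \<Longrightarrow> p - s0 < partial_sum bs k \<longleftrightarrow> p < L" using assms(1) by linarith
  ultimately show ?thesis unfolding dents_rblocks[OF assms(2)] by auto
qed

lemma ceiling_half: "nat (2 * \<lceil>(real m - 1) / 2\<rceil>) = 2 * (m div 2)"
proof (cases "even m")
  case True
  then obtain r where r: "m = 2 * r" by (elim evenE)
  have "\<lceil>(real m - 1) / 2\<rceil> = int r" unfolding r by (intro ceiling_unique) auto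
  then show ?thesis by (simp add: r)
next
  case False
  then obtain r where r: "m = 2 * r + 1" by (elim oddE)
  have "\<lceil>(real m - 1) / 2\<rceil> = int r" unfolding r by (intro ceiling_unique) auto
  then show ?thesis by (simp add: r)
qed

lemma floor_half: "nat (2 * \<lfloor>(real m + 1) / 2\<rfloor>) = 2 * ((m + 1) div 2)"
proof (cases "even m")
  case True
  then obtain r where r: "m = 2 * r" by (elim evenE)
  have "\<lfloor>(real m + 1) / 2\<rfloor> = int r" unfolding r by (intro floor_unique) auto
  then show ?thesis by (simp add: r)
next
  case False
  then obtain r where r: "m = 2 * r + 1" by (elim oddE)
  have "\<lfloor>(real m + 1) / 2\<rfloor> = int (r + 1)" unfolding r by (intro floor_unique) auto
  then show ?thesis by (simp add: r)
qed

text \<open>The even-numbered blocks of the sequence are the a_i with i even and the b_j with j odd,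
  just the triangles above the base line. The middle block has an odd number and swallows the free
  segment with the adjacent terms that belong below.\<close>

lemma Q'_t_plus:
  assumes "L = x + y + sum_list as + sum_list bs"
  shows "Q' (t_plus x y as bs) = dented (upper_dents L as bs)"
proof -
  define m n where "m = length (nonempty_seq as)" and "n = length (nonempty_seq bs)"
  have mn: "length as \<le> m" "length bs \<le> n" "1 \<le> m" "1 \<le> n"
    by (auto simp: m_def n_def nonempty_seq_def Suc_le_eq)
  define k where "k = m div 2"
  \<comment> \<open>An empty sequence counts as (0), so n is at least 1 and \<nu> = 2 l + 2 without
    truncation; the reversed part has \<nu> - 1 = 2 l + 1 terms.\<close>
  define l where "l = (n + 1) div 2 - 1"
  have l: "(n + 1) div 2 = l + 1" using mn(4) by (simp add: l_def)
  let ?c = "entry as (2 * k + 1) + x + y + entry bs (2 * l + 2)"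
  let ?pre = "map (entry as) [1..<2 * k + 1]" and ?suf = "map (entry bs) [1..<(2 * l + 1) + 1]"
  have t: "t_plus x y as bs = ?pre @ [?c] @ rev ?suf"
    unfolding t_plus_def Let_def m_def[symmetric] n_def[symmetric] ceiling_half floor_half
        k_def[symmetric] l by (simp del: upt_Suc)
  have km: "length as \<le> 2 * k + 1" and ln: "length bs \<le> 2 * l + 2" using mn l
      by (simp_all add: k_def)
  have sumL: "partial_sum as (2 * k) + ?c + partial_sum bs (2 * l + 1) = L"
    using partial_sum_ge[OF km] partial_sum_ge[OF ln] by (simp add: assms)
  have s1: "sum_list ?pre = partial_sum as (2 * k)" by (rule sum_list_map_entry)
  have len: "length ?pre = 2 * k" "length ?suf = 2 * l + 1" by simp_all
  have "p \<in> dents (blocks (t_plus x y as bs) even) \<longleftrightarrow> p \<in> upper_dents L as bs" for p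
  proof -
    have A: "dents (blocks ?pre even) = dents (blocks as even)"
    proof (rule dents_blocks_map_entry)
      fix i assume "2 * k < i" "i \<le> length as"
      then have "i = 2 * k + 1" using km by simp
      then show "odd i" by simp
    qed simp
    have B: "dents (blocks [?c] (\<lambda>i. even (i + 2 * k))) = {}"
      unfolding dents_blocks_single by simp
    have C: "partial_sum as (2 * k) + ?c \<le> p \<and> p - (partial_sum as (2 * k) + ?c) \<in> dents
        (blocks (rev ?suf) (\<lambda>i. even (i + 1 + 2 * k)))
       \<longleftrightarrow> p \<in> dents (rblocks L bs odd)"
    proof (rule dents_tail)
      show "partial_sum as (2 * k) + ?c + partial_sum bs (2 * l + 1) = L" by (rule sumL)
      show "sum_list bs \<le> L" by (simp add: assms)
      fix i assume "2 * l + 1 < i" "i \<le> length bs"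
      then have "i = 2 * l + 2" using ln by simp
      then show "\<not> odd i" by simp
    next
      fix i assume "1 \<le> i" "i \<le> 2 * l + 1"
      then show "even (2 * l + 1 + 1 - i + 1 + 2 * k) \<longleftrightarrow> odd i" by simp
    qed
    have "p \<in> dents (blocks (t_plus x y as bs) even) \<longleftrightarrow> p \<in> dents (blocks as even) \<or>
      (partial_sum as (2 * k) \<le> p \<and> (?c \<le> p - partial_sum as (2 * k) \<and>
         p - partial_sum as (2 * k) - ?c \<in> dents (blocks (rev ?suf) (\<lambda>i. even (i + 1 + 2 * k)))))"
      unfolding t dents_blocks_append len s1 A B
          by (simp only: empty_iff HOL.simp_thms sum_list_simps list.size add_0_right One_nat_def
              plus_1_eq_Suc add_Suc_right add_Suc)
    also have "\<dots> \<longleftrightarrow> p \<in> dents (blocks as even) \<or> p \<in> dents (rblocks L bs odd)"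
      unfolding C[symmetric] by (simp only: diff_diff_left) linarith
    finally show ?thesis unfolding upper_dents_def dents_Un by blast
  qed
  then have "dents (blocks (t_plus x y as bs) even) = upper_dents L as bs" by blast
  moreover have "even (length (t_plus x y as bs))" unfolding t by simp
  ultimately show ?thesis using Q'_dented by simp
qed

text \<open>The leading 0 shifts the numbering by one, so the even-numbered blocks are the a_i with
  i odd, the b_j with j even, and the final z.\<close>

lemma Q'_t_minus:
  assumes "L = x + y + sum_list as + sum_list bs"
  shows "Q' (t_minus x y z as bs) = dented (lower_dents L z as bs)"
proof -
  define m n where "m = length (nonempty_seq as)" and "n = length (nonempty_seq bs)"
  have mn: "length as \<le> m" "length bs \<le> n" "1 \<le> m" "1 \<le> n"
    by (auto simp: m_def n_def nonempty_seq_def Suc_le_eq)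
  define k where "k = (m + 1) div 2 - 1"
  define l where "l = n div 2"
  have k: "(m + 1) div 2 = k + 1" using mn(3) by (simp add: k_def)
  let ?c = "entry as (2 * k + 2) + x + y + entry bs (2 * l + 1)"
  let ?pre = "map (entry as) [1..<(2 * k + 1) + 1]" and ?suf = "map (entry bs) [1..<2 * l + 1]"
  have t: "t_minus x y z as bs = [0] @ ?pre @ [?c] @ rev ?suf @ [z]"
    unfolding t_minus_def Let_def m_def[symmetric] n_def[symmetric] ceiling_half floor_half
        l_def[symmetric] k by (simp del: upt_Suc)
  have km: "length as \<le> 2 * k + 2" and ln: "length bs \<le> 2 * l + 1" using mn k
      by (simp_all add: l_def)
  have sumL: "partial_sum as (2 * k + 1) + ?c + partial_sum bs (2 * l) = L"
    using partial_sum_ge[OF km] partial_sum_ge[OF ln] by (simp add: assms)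
  have s1: "sum_list ?pre = partial_sum as (2 * k + 1)" "sum_list (rev ?suf)
      = partial_sum bs (2 * l)"
    unfolding sum_list_rev by (rule sum_list_map_entry)+
  have len: "length ?pre = 2 * k + 1" "length (rev ?suf) = 2 * l" by simp_all
  have "p \<in> dents (blocks (t_minus x y z as bs) even) \<longleftrightarrow> p \<in> lower_dents L z as bs" for p
  proof -
    have Z: "dents (blocks [0] even) = {}" unfolding dents_blocks_single by simp
    have A: "dents (blocks ?pre (\<lambda>i. even (i + 1))) = dents (blocks as odd)"
    proof (rule dents_blocks_map_entry)
      fix i assume "2 * k + 1 < i" "i \<le> length as"
      then have "i = 2 * k + 2" using km by simp
      then show "\<not> odd i" by simp
    qed simp
    have B: "dents (blocks [?c] (\<lambda>i. even (i + (2 * k + 1) + 1))) = {}"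
      unfolding dents_blocks_single by simp
    have C: "partial_sum as (2 * k + 1) + ?c \<le> p \<and> p - (partial_sum as (2 * k + 1) + ?c) \<in> dents
        (blocks (rev ?suf) (\<lambda>i. even (i + 1 + (2 * k + 1) + 1)))
       \<longleftrightarrow> p \<in> dents (rblocks L bs even)"
    proof (rule dents_tail)
      show "partial_sum as (2 * k + 1) + ?c + partial_sum bs (2 * l) = L" by (rule sumL)
      show "sum_list bs \<le> L" by (simp add: assms)
      fix i assume "2 * l < i" "i \<le> length bs"
      then have "i = 2 * l + 1" using ln by simp
      then show "\<not> even i" by simp
    next
      fix i assume "1 \<le> i" "i \<le> 2 * l"
      then show "even (2 * l + 1 - i + 1 + (2 * k + 1) + 1) \<longleftrightarrow> even i" by simp
    qed
    have D: "dents (blocks [z] (\<lambda>i. even (i + 2 * l + 1 + (2 * k + 1) + 1))) = {..<z}"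
      unfolding dents_blocks_single by simp
    have "p \<in> dents (blocks (t_minus x y z as bs) even) \<longleftrightarrow> p \<in> dents (blocks as odd) \<or>
      (partial_sum as (2 * k + 1) \<le> p \<and> (?c \<le> p - partial_sum as (2 * k + 1) \<and>
        (p - partial_sum as (2 * k + 1) - ?c \<in> dents (blocks (rev ?suf)
            (\<lambda>i. even (i + 1 + (2 * k + 1) + 1)))
         \<or> (partial_sum bs (2 * l) \<le> p - partial_sum as (2 * k + 1) - ?c \<and>
           p - partial_sum as (2 * k + 1) - ?c - partial_sum bs (2 * l) \<in> {..<z}))))"
    proof -
      have l1: "length [u] = 1" "sum_list [u] = u" for u :: nat by simp_all
      show ?thesis
        unfolding t dents_blocks_append len s1 l1 Z A B D
            by (simp only: empty_iff HOL.simp_thms diff_zero le0)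
    qed
    also have "\<dots> \<longleftrightarrow> p \<in> dents (blocks as odd) \<or> p \<in> dents (rblocks L bs even) \<or> (L \<le> p \<and> p < L + z)"
    proof -
      have e: "p - partial_sum as (2 * k + 1) - ?c = p - (partial_sum as (2 * k + 1) + ?c)"
          by (rule diff_diff_left)
      show ?thesis unfolding C[symmetric] e lessThan_iff using sumL
          by (cases "partial_sum as (2 * k + 1) + ?c \<le> p") auto
    qed
    finally show ?thesis unfolding lower_dents_def dents_Un dents_single by auto
  qed
  then have "dents (blocks (t_minus x y z as bs) even) = lower_dents L z as bs" by blast
  moreover have "even (length (t_minus x y z as bs))" unfolding t by simp
  ultimately show ?thesis using Q'_dented by simp
qed

section \<open>The product formula\<close>

text \<open>The factorials of 2 n - 1, ..., 3, 1 are the normalising constants of n dents.\<close>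

lemma H2_odd: "H2 (2 * n + 1) = odd_facts n"
proof -
  have "H2 (2 * n + 1) = (\<Prod>i=1..n. fact (2 * n + 1 - 2 * i))" by (simp add: H2_def)
  also have "\<dots> = (\<Prod>j<n. fact (2 * j + 1))"
  proof (rule prod.reindex_bij_witness[of _ "\<lambda>j. n - j" "\<lambda>i. n - i"])
    fix i assume "i \<in> {1..n}"
    then have "2 * (n - i) + 1 = 2 * n + 1 - 2 * i" by auto
    then show "fact (2 * (n - i) + 1) = fact (2 * n + 1 - 2 * i)" by (simp only:)
  qed auto
  finally show ?thesis by (simp add: odd_facts_def)
qed

lemma odd_facts_pos: "odd_facts n > 0"
  unfolding odd_facts_def by (intro prod_pos) simp

lemma H_Suc: "H (Suc n) = H n * fact n"
  by (simp add: H_def)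

lemma H_pos: "H n > 0"
  unfolding H_def by (intro prod_pos) simp

lemma odd_dfact_eq: "odd_dfact (2 * int n - 1) = (\<Prod>i<n. 2 * real i + 1)"
  unfolding odd_dfact_def
  by (rule prod.reindex_bij_witness[of _ "\<lambda>i. 2 * int i + 1" "\<lambda>i. nat ((i - 1) div 2)"])
      (auto elim!: oddE)

lemma vpos_strict_mono: "strict_mono vpos"
  unfolding vpos_def by (intro strict_monoI power_strict_mono) auto

lemma vset_pos: "finite S \<Longrightarrow> vset vpos S > 0"
  unfolding vset_def by (intro prod_pos) (auto simp: strict_mono_less[OF vpos_strict_mono])

lemma dented_pos:
  assumes "finite P"
  shows "dented P > 0"
proof -
  have "(\<Prod>p\<in>P. real p + 1 / 2) > 0" by (intro prod_pos) (simp add: add_nonneg_pos)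
  then show ?thesis unfolding dented_def using vset_pos[OF assms] odd_facts_pos by simp
qed

text \<open>A mixed pair may occur in either order, and the absolute value removes the
  distinction.\<close>

lemma vset_union:
  assumes "finite E" "finite S" "E \<inter> S = {}"
  shows "vset vpos (E \<union> S) = vset vpos E * vset vpos S * (\<Prod>s\<in>S. \<Prod>e\<in>E. \<bar>vpos s - vpos e\<bar>)"
proof -
  let ?f = "\<lambda>(a, b). vpos b - vpos a"
  let ?P = "\<lambda>X. {(a, b) \<in> X \<times> X. a < b}"
  let ?Q = "{(a, b). a \<in> E \<and> b \<in> S \<and> a < b} \<union> {(a, b). a \<in> S \<and> b \<in> E \<and> a < b}"
  have fin: "finite (?P E)" "finite (?P S)" "finite ?Q"
    using assms(1,2) by (auto intro: finite_subset[of _ "(E \<union> S) \<times> (E \<union> S)"])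
  have "?P (E \<union> S) = ?P E \<union> ?P S \<union> ?Q" by auto
  moreover have "?P E \<inter> ?P S = {}" "(?P E \<union> ?P S) \<inter> ?Q = {}" using assms(3) by auto
  ultimately have "vset vpos (E \<union> S) = vset vpos E * vset vpos S * (\<Prod>p\<in>?Q. ?f p)"
    unfolding vset_def using fin by (simp add: prod.union_disjoint)
  also have "(\<Prod>p\<in>?Q. ?f p) = (\<Prod>(s, e)\<in>S \<times> E. \<bar>vpos s - vpos e\<bar>)"
  proof (rule prod.reindex_bij_witness[of _ "\<lambda>(s, e). if s < e then (s, e) else (e, s)" "\<lambda>(a, b).
      if a \<in> S then (a, b) else (b, a)"])
    fix p assume "p \<in> ?Q"
    then obtain a b where p: "p = (a, b)" "a < b" "a \<in> E \<and> b \<in> S \<or> a \<in> S \<and> b \<in> E" by auto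
    have lt: "vpos a < vpos b" using p(2) strict_mono_less[OF vpos_strict_mono] by blast
    have "a \<in> E \<Longrightarrow> a \<notin> S" using assms(3) by blast
    then show "(case case p of (a, b) \<Rightarrow> if a \<in> S then (a, b) else (b, a) of (s, e) \<Rightarrow>
        if s < e then (s, e) else (e, s)) = p"
      "(case p of (a, b) \<Rightarrow> if a \<in> S then (a, b) else (b, a)) \<in> S \<times> E"
      "(case case p of (a, b) \<Rightarrow> if a \<in> S then (a, b) else (b, a) of (s, e) \<Rightarrow> \<bar>vpos s - vpos e\<bar>)
          = ?f p"
      using p lt by auto
  next
    fix q assume "q \<in> S \<times> E"
    then obtain s e where q: "q = (s, e)" "s \<in> S" "e \<in> E" by auto
    then have "s \<noteq> e" "e \<notin> S" using assms(3) by blast+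
    then show "(case case q of (s, e) \<Rightarrow> if s < e then (s, e) else (e, s) of (a, b) \<Rightarrow>
        if a \<in> S then (a, b) else (b, a)) = q"
      "(case q of (s, e) \<Rightarrow> if s < e then (s, e) else (e, s)) \<in> ?Q" using q by auto
  qed
  also have "\<dots> = (\<Prod>s\<in>S. \<Prod>e\<in>E. \<bar>vpos s - vpos e\<bar>)"
    by (rule prod.cartesian_product[symmetric])
  finally show ?thesis .
qed

text \<open>Isolates what depends on \<open>S\<close> beyond its cardinality; E enters that part
  only through its distances to S.\<close>

lemma dented_union:
  assumes "finite E" "finite S" "E \<inter> S = {}"
  shows "dented (E \<union> S) = dented E * (odd_facts (card E) / odd_facts (card E + card S))
    * ((\<Prod>s\<in>S. (real s + 1 / 2) * (\<Prod>e\<in>E. \<bar>vpos s - vpos e\<bar>)) * vset vpos S)"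
  unfolding dented_def vset_union[OF assms] card_Un_disjoint[OF assms] prod.union_disjoint[OF
      assms] prod.distrib
  using odd_facts_pos[of "card E"] by simp

text \<open>The difference of squares is (s + a - e) (s + a + e + 1). The first factors run from s +
  1 to s + a, the second ones continue from s + a + 1 to s + 2 a.\<close>

lemma dist_left_prod:
  "(\<Prod>e<a. \<bar>vpos (a + s) - vpos e\<bar>) = pochhammer (real s + 1) (2 * a)"
proof -
  have "(\<Prod>e<a. \<bar>vpos (a + s) - vpos e\<bar>) = (\<Prod>e<a. (real s + real a - real e) * (real s + 1 + real a
      + real e))"
  proof (rule prod.cong[OF refl])
    fix e assume "e \<in> {..<a}"
    then have "vpos e < vpos (a + s)" by (simp add: strict_mono_less[OF vpos_strict_mono])
    then show "\<bar>vpos (a + s) - vpos e\<bar> = (real s + real a - real e) * (real s + 1 + real a + real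
        e)"
      by (simp add: vpos_def power2_eq_square algebra_simps)
  qed
  also have "\<dots> = (\<Prod>e<a. real s + real a - real e) * (\<Prod>e<a. real s + 1 + real a + real e)"
    by (rule prod.distrib)
  also have "(\<Prod>e<a. real s + real a - real e) = pochhammer (real s + 1) a"
    using pochhammer_prod_down[of "real s + 1 + real a" a] by simp
  also have "(\<Prod>e<a. real s + 1 + real a + real e) = pochhammer (real s + 1 + real a) a"
    by (simp add: pochhammer_prod atLeast0LessThan)
  finally show ?thesis by (simp add: pochhammer_product'[symmetric] mult_2)
qed

lemma dist_right_prod:
  assumes "s < N"
  shows "(\<Prod>e\<in>{a + N..<a + N + c}. \<bar>vpos (a + s) - vpos e\<bar>)
    = pochhammer (real N - real s) c * pochhammer (real N + real (2 * a) + real s + 1) c"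
proof -
  have "(\<Prod>e\<in>{a + N..<a + N + c}. \<bar>vpos (a + s) - vpos e\<bar>)
      = (\<Prod>j<c. \<bar>vpos (a + s) - vpos (a + N + j)\<bar>)"
    by (rule prod.reindex_bij_witness[of _ "\<lambda>j. a + N + j" "\<lambda>e. e - (a + N)"]) auto
  also have "\<dots> = (\<Prod>j<c. (real N - real s + real j) * (real N + real (2 * a) + real s + 1 + real j))"
  proof (rule prod.cong[OF refl])
    fix j
    have "vpos (a + s) < vpos (a + N + j)" using assms
        by (simp add: strict_mono_less[OF vpos_strict_mono])
    then show "\<bar>vpos (a + s) - vpos (a + N + j)\<bar> = (real N - real s + real j) * (real N + real
        (2 * a) + real s + 1 + real j)"
      by (simp add: vpos_def power2_eq_square algebra_simps)
  qed
  finally show ?thesis by (simp add: prod.distrib pochhammer_prod atLeast0LessThan)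
qed

definition selberg_sum :: "nat \<Rightarrow> nat \<Rightarrow> nat \<Rightarrow> nat \<Rightarrow> real" where
  "selberg_sum \<alpha> c y N = (\<Sum>S | S \<subseteq> {..<N} \<and> card S = y. (\<Prod>s\<in>S. sel_weight \<alpha> c N s)
      * (vset (\<lambda>s. sel_pos \<alpha> (real s)) S)\<^sup>2)"

text \<open>The distances from S to E and to F combine to those to the known set
  \<open>E \<union> F\<close>, and each part contributes one Vandermonde product of S. How the fixed
  dents are divided between E and F affects only the factor in front of the Selberg sum.\<close>

lemma sum_dented:
  assumes fin: "finite E" "finite F" and dj: "E \<inter> F = {}" and un: "E \<union> F = {..<a}
      \<union> {a + N..<a + N + c}"
  shows "(\<Sum>S | S \<subseteq> {a..<a + N} \<and> card S = y. dented (E \<union> S) * dented (F \<union> S))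
    = dented E * dented F * (odd_facts (card E) * odd_facts (card F) / (odd_facts (card E + y)
        * odd_facts (card F + y)))
      * (selberg_sum (2 * a) c y N / 4 ^ y)"
proof -
  let ?K = "dented E * dented F * (odd_facts (card E) * odd_facts (card F)
      / (odd_facts (card E + y) * odd_facts (card F + y)))"
  have "(\<Sum>S | S \<subseteq> {a..<a + N} \<and> card S = y. dented (E \<union> S) * dented (F \<union> S))
    = (\<Sum>S | S \<subseteq> {..<N} \<and> card S = y. dented (E \<union> (+) a ` S) * dented (F \<union> (+) a ` S))"
  proof (rule sum.reindex_bij_witness[of _ "(`) ((+) a)" "\<lambda>S. (+) a -` S"])
    fix S assume "S \<in> {S. S \<subseteq> {a..<a + N} \<and> card S = y}"
    then have S: "S \<subseteq> {a..<a + N}" "card S = y" by auto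
    show e: "(+) a ` ((+) a -` S) = S"
    proof -
      have "x \<in> range ((+) a)" if "x \<in> S" for x
      proof -
        have "x = a + (x - a)" using S(1) that by auto
        then show ?thesis by (rule range_eqI)
      qed
      then have "S \<subseteq> range ((+) a)" by blast
      then show ?thesis by (simp add: image_vimage_eq Int_absorb2)
    qed
    have "card ((+) a -` S) = card ((+) a ` ((+) a -` S))" by (rule card_image[symmetric]) simp
    then have "card ((+) a -` S) = y" unfolding e S(2) .
    then show "(+) a -` S \<in> {S. S \<subseteq> {..<N} \<and> card S = y}" using S(1) by auto
    show "dented (E \<union> (+) a ` ((+) a -` S)) * dented (F \<union> (+) a ` ((+) a -` S))
        = dented (E \<union> S) * dented (F \<union> S)" unfolding e ..
  next
    fix S assume "S \<in> {S. S \<subseteq> {..<N} \<and> card S = y}"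
    then show "(+) a ` S \<in> {S. S \<subseteq> {a..<a + N} \<and> card S = y}" by (auto simp: card_image)
    show "(+) a -` (+) a ` S = S" by (rule inj_vimage_image_eq) simp
  qed
  also have "\<dots> = (\<Sum>S | S \<subseteq> {..<N} \<and> card S = y. ?K / 4 ^ y * ((\<Prod>s\<in>S. sel_weight (2 * a) c N s)
      * (vset (\<lambda>s. sel_pos (2 * a) (real s)) S)\<^sup>2))"
  proof (rule sum.cong[OF refl])
    fix S assume "S \<in> {S. S \<subseteq> {..<N} \<and> card S = y}"
    then have S: "S \<subseteq> {..<N}" "card S = y" by auto
    have finS: "finite S" using S(1) finite_subset by blast
    let ?S = "(+) a ` S"
    have finS': "finite ?S" using finS by simp
    have card: "card ?S = y" by (simp add: card_image S(2))
    have djEF: "(E \<union> F) \<inter> ?S = {}" unfolding un using S(1) by auto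
    then have djE: "E \<inter> ?S = {}" and djF: "F \<inter> ?S = {}" by blast+
    have ve: "vset vpos ?S = vset (\<lambda>s. sel_pos (2 * a) (real s)) S"
    proof -
      have "strict_mono_on S ((+) a)" by (rule strict_mono_onI) simp
      then have "vset vpos ?S = vset (vpos \<circ> (+) a) S" by (rule vset_image)
      moreover have "(vpos \<circ> (+) a) = (\<lambda>s. sel_pos (2 * a) (real s))"
        by (rule ext) (simp add: vpos_def sel_pos_def field_simps)
      ultimately show ?thesis by simp
    qed
    have prods: "(\<Prod>s\<in>?S. (real s + 1 / 2) * (\<Prod>e\<in>E. \<bar>vpos s - vpos e\<bar>)) * (\<Prod>s\<in>?S. (real s + 1 / 2)
        * (\<Prod>e\<in>F. \<bar>vpos s - vpos e\<bar>))
       = (\<Prod>s\<in>S. sel_weight (2 * a) c N s) / 4 ^ y"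
    proof -
      have "(\<Prod>s\<in>?S. (real s + 1 / 2) * (\<Prod>e\<in>E. \<bar>vpos s - vpos e\<bar>)) * (\<Prod>s\<in>?S. (real s + 1 / 2)
          * (\<Prod>e\<in>F. \<bar>vpos s - vpos e\<bar>))
        = (\<Prod>s\<in>?S. (real s + 1 / 2)\<^sup>2 * (\<Prod>e\<in>E \<union> F. \<bar>vpos s - vpos e\<bar>))"
        unfolding prod.distrib[symmetric] prod.union_disjoint[OF fin dj] power2_eq_square
        by (intro prod.cong refl) (simp only: mult_ac)
      also have "\<dots> = (\<Prod>s\<in>S. (real (a + s) + 1 / 2)\<^sup>2 * (\<Prod>e\<in>E \<union> F. \<bar>vpos (a + s) - vpos e\<bar>))"
        by (subst prod.reindex) (simp_all add: comp_def)
      also have "\<dots> = (\<Prod>s\<in>S. sel_weight (2 * a) c N s / 4)"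
      proof (rule prod.cong[OF refl])
        fix s assume "s \<in> S"
        then have sN: "s < N" using S(1) by auto
        have "(\<Prod>e\<in>E \<union> F. \<bar>vpos (a + s) - vpos e\<bar>)
          = (\<Prod>e<a. \<bar>vpos (a + s) - vpos e\<bar>) * (\<Prod>e\<in>{a + N..<a + N + c}. \<bar>vpos (a + s) - vpos e\<bar>)"
          unfolding un by (rule prod.union_disjoint) auto
        moreover have "(real (a + s) + 1 / 2)\<^sup>2 = (2 * real s + real (2 * a) + 1)\<^sup>2 / 4"
          by (simp add: power2_eq_square field_simps)
        ultimately show "(real (a + s) + 1 / 2)\<^sup>2 * (\<Prod>e\<in>E \<union> F. \<bar>vpos (a + s) - vpos e\<bar>)
            = sel_weight (2 * a) c N s / 4"
          unfolding dist_left_prod dist_right_prod[OF sN] sel_weight_def by simp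
      qed
      finally show ?thesis by (simp add: prod_dividef S(2))
    qed
    have "dented (E \<union> ?S) * dented (F \<union> ?S)
        = ?K * (((\<Prod>s\<in>?S. (real s + 1 / 2) * (\<Prod>e\<in>E. \<bar>vpos s - vpos e\<bar>)) * (\<Prod>s\<in>?S. (real s + 1 / 2)
            * (\<Prod>e\<in>F. \<bar>vpos s - vpos e\<bar>)))
       * (vset vpos ?S)\<^sup>2)"
      unfolding dented_union[OF fin(1) finS' djE] dented_union[OF fin(2) finS' djF] card
          power2_eq_square
      by (simp only: times_divide_eq_left times_divide_eq_right divide_divide_eq_left mult_ac)
    then show "dented (E \<union> ?S) * dented (F \<union> ?S)
      = ?K / 4 ^ y * ((\<Prod>s\<in>S. sel_weight (2 * a) c N s) * (vset (\<lambda>s. sel_pos (2 * a) (real s)) S)\<^sup>2)"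
      unfolding prods ve by simp
  qed
  also have "\<dots> = ?K * (selberg_sum (2 * a) c y N / 4 ^ y)"
    unfolding sum_distrib_left[symmetric] selberg_sum_def by simp
  finally show ?thesis .
qed

section \<open>The Selberg sum with N = y and the final assembly\<close>

lemma selberg_sum_0: "selberg_sum \<alpha> c 0 N = 1"
proof -
  have "{S. S \<subseteq> {..<N} \<and> card S = 0} = {{}}" by (auto dest: finite_subset)
  then show ?thesis by (simp add: selberg_sum_def vset_def)
qed

lemma selberg_sum_full: "selberg_sum \<alpha> c y y = (\<Prod>s<y. sel_weight \<alpha> c y s)
    * (vand y (\<lambda>s. sel_pos \<alpha> (real s)))\<^sup>2"
proof -
  have "{S. S \<subseteq> {..<y} \<and> card S = y} = {{..<y}}"
  proof -
    have "S = {..<y}" if "S \<subseteq> {..<y}" "card S = y" for S by (rule card_subset_eq) (use that in auto)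
    then show ?thesis by auto
  qed
  then show ?thesis by (simp add: selberg_sum_def vset_lessThan)
qed

lemma pochhammer_fact_shift: "fact m * pochhammer (real m + 1) n = fact (m + n)"
  using pochhammer_product'[of "1 :: real" m n] by (simp add: pochhammer_fact[symmetric]
      add.commute)

text \<open>Raising N by 1 exchanges the first factor of each of the last two Pochhammer symbols for
  a new last one.\<close>

lemma sel_weight_Suc:
  "sel_weight \<alpha> c (Suc y) s * ((real y - real s) * (real y + real \<alpha> + real s + 1))
    = sel_weight \<alpha> c y s * ((real y - real s + real c) * (real y + real \<alpha> + real s + 1 + real c))"
proof -
  have 1: "pochhammer (real (Suc y) - real s) c * (real y - real s) = pochhammer (real y - real s)
      c * (real y - real s + real c)"
    using pochhammer_rec[of "real y - real s" c] pochhammer_Suc[of "real y - real s" c]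
        by (simp add: algebra_simps)
  have 2: "pochhammer (real (Suc y) + real \<alpha> + real s + 1) c * (real y + real \<alpha> + real s + 1)
     = pochhammer (real y + real \<alpha> + real s + 1) c * (real y + real \<alpha> + real s + 1 + real c)"
    using pochhammer_rec[of "real y + real \<alpha> + real s + 1" c] pochhammer_Suc[of "real y + real \<alpha>
        + real s + 1" c] by (simp add: algebra_simps)
  have "sel_weight \<alpha> c (Suc y) s * ((real y - real s) * (real y + real \<alpha> + real s + 1))
     = (2 * real s + real \<alpha> + 1)\<^sup>2 * pochhammer (real s + 1) \<alpha>
       * (pochhammer (real (Suc y) - real s) c * (real y - real s))
       * (pochhammer (real (Suc y) + real \<alpha> + real s + 1) c * (real y + real \<alpha> + real s + 1))"
    unfolding sel_weight_def by (simp only: mult_ac)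
  then show ?thesis unfolding 1 2 sel_weight_def by (simp only: mult_ac)
qed

text \<open>Passing to y + 1 points changes the old weights as in \<open>sel_weight_Suc\<close>,
  adds the weight of the new point, and adds the squared product \<open>?p\<close> of its
  distances.\<close>

lemma selberg_sum_full_Suc:
  "selberg_sum (2 * a) c (Suc y) (Suc y) * fact (2 * a + c + y)
    = selberg_sum (2 * a) c y y * ((2 * real a + 2 * real y + 1) * fact (c + y) * fact
        (2 * a + c + 2 * y) * fact (2 * a + c + 2 * y + 1))"
proof -
  let ?\<alpha> = "2 * a"
  let ?W = "\<Prod>s<y. sel_weight ?\<alpha> c y s" and ?W' = "\<Prod>s<y. sel_weight ?\<alpha> c (Suc y) s"
  let ?p = "\<Prod>s<y. (real y - real s) * (real y + real ?\<alpha> + real s + 1)"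
  let ?r = "\<Prod>s<y. (real y - real s + real c) * (real y + real ?\<alpha> + real s + 1 + real c)"
  have W: "?W' * ?p = ?W * ?r"
    unfolding prod.distrib[symmetric] by (rule prod.cong[OF refl sel_weight_Suc])
  have "vand (Suc y) (\<lambda>s. sel_pos ?\<alpha> (real s)) = vand y (\<lambda>s. sel_pos ?\<alpha> (real s)) * (\<Prod>s<y. sel_pos
      ?\<alpha> (real y) - sel_pos ?\<alpha> (real s))"
    by (simp add: vand_def)
  also have "(\<Prod>s<y. sel_pos ?\<alpha> (real y) - sel_pos ?\<alpha> (real s)) = ?p"
    by (rule prod.cong[OF refl]) (simp add: sel_pos_def power2_eq_square field_simps)
  finally have v: "vand (Suc y) (\<lambda>s. sel_pos ?\<alpha> (real s)) = vand y (\<lambda>s. sel_pos ?\<alpha> (real s)) * ?p" .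
  have d1: "(\<Prod>s<y. real y - real s) = fact y"
    using pochhammer_prod_down[of "real y + 1" y] by (simp add: pochhammer_fact add.commute)
  have d2: "fact c * (\<Prod>s<y. real y - real s + real c) = fact (c + y)"
  proof -
    have "(\<Prod>s<y. real y - real s + real c) = pochhammer (real c + 1) y"
      using pochhammer_prod_down[of "real c + 1 + real y" y] by (simp add: algebra_simps)
    then show ?thesis by (simp add: pochhammer_fact_shift)
  qed
  have d3: "fact (y + ?\<alpha>) * (\<Prod>s<y. real y + real ?\<alpha> + real s + 1) = fact (y + ?\<alpha> + y)"
  proof -
    have "(\<Prod>s<y. real y + real ?\<alpha> + real s + 1) = pochhammer (real (y + ?\<alpha>) + 1) y"
      by (simp add: pochhammer_prod atLeast0LessThan algebra_simps)
    then show ?thesis by (simp only: pochhammer_fact_shift)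
  qed
  have d4: "fact (y + ?\<alpha> + c) * (\<Prod>s<y. real y + real ?\<alpha> + real s + 1 + real c)
      = fact (y + ?\<alpha> + c + y)"
  proof -
    have "(\<Prod>s<y. real y + real ?\<alpha> + real s + 1 + real c) = pochhammer (real (y + ?\<alpha> + c) + 1) y"
      by (simp add: pochhammer_prod atLeast0LessThan algebra_simps)
    then show ?thesis by (simp only: pochhammer_fact_shift)
  qed
  have w1: "fact y * pochhammer (real y + 1) ?\<alpha> = fact (y + ?\<alpha>)" by (rule pochhammer_fact_shift)
  have w2: "pochhammer (real (Suc y) - real y) c = fact c" by (simp add: pochhammer_fact)
  have w3: "fact (2 * y + ?\<alpha> + 1) * pochhammer (real (Suc y) + real ?\<alpha> + real y + 1) c
      = fact (2 * y + ?\<alpha> + 1 + c)"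
  proof -
    have e: "real (Suc y) + real ?\<alpha> + real y + 1 = real (2 * y + ?\<alpha> + 1) + 1" by simp
    show ?thesis unfolding e by (rule pochhammer_fact_shift)
  qed
  have w4: "fact (2 * y + ?\<alpha> + 1) = (2 * real y + real ?\<alpha> + 1) * fact (y + ?\<alpha> + y)"
  proof -
    have e: "2 * y + ?\<alpha> + 1 = Suc (y + ?\<alpha> + y)" and "real (Suc (y + ?\<alpha> + y))
        = 2 * real y + real ?\<alpha> + 1" by simp_all
    then show ?thesis unfolding e fact_Suc by simp
  qed
  define X where "X = 2 * real y + real ?\<alpha> + 1"
  define P1 P2 where "P1 = pochhammer (real y + 1) ?\<alpha>" and "P2
      = pochhammer (real (Suc y) + real ?\<alpha> + real y + 1) c"
  have last: "sel_weight ?\<alpha> c (Suc y) y = X\<^sup>2 * P1 * fact c * P2"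
    unfolding sel_weight_def w2 X_def P1_def P2_def ..
  define R1 R2 R3 where "R1 = (\<Prod>s<y. real y - real s + real c)" and "R2
      = (\<Prod>s<y. real y + real ?\<alpha> + real s + 1)"
    and "R3 = (\<Prod>s<y. real y + real ?\<alpha> + real s + 1 + real c)"
  have p: "?p = fact y * R2" unfolding R2_def prod.distrib d1 ..
  have r: "?r = R1 * R3" unfolding R1_def R3_def by (rule prod.distrib)
  define f1 :: real where "f1 = fact (y + ?\<alpha>)"
  define f2 :: real where "f2 = fact (y + ?\<alpha> + y)"
  have X: "X > 0" unfolding X_def by (simp add: add_nonneg_pos)
  have nz: "f1 > 0" "f2 > 0" by (simp_all add: f1_def f2_def)
  have key: "P1 * fact y * R2 = f2"
    using w1 d3 nz unfolding P1_def[symmetric] R2_def[symmetric] f1_def[symmetric]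
        f2_def[symmetric] by (simp add: mult.commute)
  have w3': "X * f2 * P2 = fact (?\<alpha> + c + 2 * y + 1)"
    using w3 unfolding P2_def[symmetric] w4 X_def[symmetric] f2_def[symmetric] by (simp add: add_ac)
  have d4': "fact (?\<alpha> + c + y) * R3 = fact (?\<alpha> + c + 2 * y)"
    using d4 unfolding R3_def[symmetric] by (simp add: mult_2 add_ac)
  have d2': "fact c * R1 = fact (c + y)" using d2 unfolding R1_def .
  define VV where "VV = vand y (\<lambda>s. sel_pos ?\<alpha> (real s))"
  have "selberg_sum ?\<alpha> c (Suc y) (Suc y) * fact (?\<alpha> + c + y)
     = (?W' * ?p) * sel_weight ?\<alpha> c (Suc y) y * VV\<^sup>2 * ?p * fact (?\<alpha> + c + y)"
    unfolding selberg_sum_full v VV_def by (simp add: power2_eq_square mult_ac)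
  \<comment> \<open>One copy of \<open>?p\<close> cancels the denominators of the changed weights;
    the other completes the factorials.\<close>
  also have "\<dots> = ?W * VV\<^sup>2 * (X * (fact c * R1) * (fact (?\<alpha> + c + y) * R3)
      * (X * (P1 * fact y * R2) * P2))"
    unfolding W unfolding r last p by (simp add: power2_eq_square mult_ac)
  also have "\<dots> = ?W * VV\<^sup>2 * (X * fact (c + y) * fact (?\<alpha> + c + 2 * y) * fact (?\<alpha> + c + 2 * y + 1))"
    unfolding d2' d4' key w3' ..
  also have "\<dots> = selberg_sum ?\<alpha> c y y * (X * fact (c + y) * fact (?\<alpha> + c + 2 * y) * fact
      (?\<alpha> + c + 2 * y + 1))"
    unfolding selberg_sum_full VV_def ..
  also have "X = 2 * real a + 2 * real y + 1" by (simp add: X_def)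
  finally show ?thesis .
qed

text \<open>Telescopes \<open>selberg_sum_full_Suc\<close>: quotients of successive values of H are
  factorials, and the linear factor extends the double factorial.\<close>

lemma selberg_sum_full_closed:
  "selberg_sum (2 * a) c y y = (odd_dfact (2 * int a + 2 * int y - 1) / odd_dfact (2 * int a - 1))
     * ((H (2 * a + c + 2 * y) * H (c + y)) / (H (2 * a + c + y) * H c))"
proof (induction y)
  case 0
  have "odd_dfact (2 * int a - 1) > 0" unfolding odd_dfact_eq
      by (intro prod_pos) (simp add: add_nonneg_pos)
  then show ?case using H_pos[of "2 * a + c"] H_pos[of c] by (simp add: selberg_sum_0)
next
  case (Suc y)
  have d: "odd_dfact (2 * int a + 2 * int (Suc y) - 1) = odd_dfact (2 * int a + 2 * int y - 1)
      * (2 * real a + 2 * real y + 1)"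
    using odd_dfact_eq[of "a + Suc y"] odd_dfact_eq[of "a + y"] by (simp add: algebra_simps)
  have h1: "H (2 * a + c + 2 * Suc y) = H (2 * a + c + 2 * y) * fact (2 * a + c + 2 * y) * fact
      (2 * a + c + 2 * y + 1)"
    using H_Suc[of "2 * a + c + 2 * y"] H_Suc[of "Suc (2 * a + c + 2 * y)"] by simp
  have h2: "H (c + Suc y) = H (c + y) * fact (c + y)" using H_Suc[of "c + y"] by simp
  have h3: "H (2 * a + c + Suc y) = H (2 * a + c + y) * fact (2 * a + c + y)"
      using H_Suc[of "2 * a + c + y"] by simp
  define F0 F1 F2 F3 :: real where "F0 = fact (2 * a + c + y)" and "F1 = fact (c + y)"
    and "F2 = fact (2 * a + c + 2 * y)" and "F3 = fact (2 * a + c + 2 * y + 1)"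
  have nz: "F0 > 0" by (simp add: F0_def)
  have "selberg_sum (2 * a) c (Suc y) (Suc y) = selberg_sum (2 * a) c y y
      * ((2 * real a + 2 * real y + 1) * F1 * F2 * F3) / F0"
    using selberg_sum_full_Suc[of a c y] nz unfolding F0_def[symmetric] F1_def[symmetric]
        F2_def[symmetric] F3_def[symmetric]
    by (simp add: field_simps)
  then show ?case
    unfolding d h1 h2 h3 Suc.IH F0_def[symmetric] F1_def[symmetric] F2_def[symmetric]
        F3_def[symmetric]
    by (simp only: times_divide_eq_left times_divide_eq_right divide_divide_eq_left mult_ac)
qed

lemma V_pos: "x > 0 \<Longrightarrow> V x n m > 0"
  unfolding V_def by (intro prod_pos pochhammer2_pos) (simp add: add_pos_nonneg)

lemma T_pos: "x > 0 \<Longrightarrow> T x n m > 0"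
  unfolding T_def by (intro prod_pos pochhammer_pos) (simp add: add_pos_nonneg)

text \<open>The unknown constant of \<open>discrete_selberg\<close> cancels between N = x + y and N
  = y.\<close>

lemma selberg_sum_ratio:
  "selberg_sum (2 * a) c y (x + y) = selberg_sum (2 * a) c y y *
     ((T (real x + 1) (2 * a + c + 2 * y - 1) y * V (2 * real x + 2 * real a + 1) (c + 2 * y) y)
       / (T 1 (2 * a + c + 2 * y - 1) y * V (2 * real a + 1) (c + 2 * y) y))"
proof -
  obtain K where K: "\<And>N. selberg_sum (2 * a) c y N
     = K * (T (real N - real y + 1) (2 * a + c + 2 * y - 1) y * V (2 * real N - 2 * real y + real
         (2 * a) + 1) (c + 2 * y) y)"
    using discrete_selberg[where y = y and \<alpha> = "2 * a" and c = c] unfolding selberg_sum_def by blast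
  have "T 1 (2 * a + c + 2 * y - 1) y > 0" "V (2 * real a + 1) (c + 2 * y) y > 0"
    by (simp_all add: T_pos V_pos add_nonneg_pos)
  then show ?thesis using K[of "x + y"] K[of y] by simp
qed

lemma M_RW1_closed:
  fixes x y z :: nat and as bs :: "nat list"
  defines "L \<equiv> x + y + sum_list as + sum_list bs"
    and "e \<equiv> even_sum as + odd_sum bs" and "f \<equiv> odd_sum as + even_sum bs + z"
  shows "M (RW1 x y z as bs) = 2 ^ entry as 1 * dented (upper_dents L as bs) * dented
      (lower_dents L z as bs)
    * (odd_facts e * odd_facts f / (odd_facts (e + y) * odd_facts (f + y)))
    * (selberg_sum (2 * sum_list as) (sum_list bs + z) y (x + y) / 4 ^ y)"
proof -
  have le: "sum_list as + sum_list bs \<le> L" by (simp add: L_def)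
  have un: "upper_dents L as bs \<union> lower_dents L z as bs
     = {..<sum_list as} \<union> {sum_list as + (x + y)..<sum_list as + (x + y) + (sum_list bs + z)}"
    unfolding dents_split(2)[OF le] by (simp add: L_def add_ac)
  show ?thesis
    unfolding M_RW1 L_def[symmetric]
      sum_dented[OF finite_dents(1)[OF le] finite_dents(2)[OF le] dents_split(1)[OF le] un]
          card_dents[OF le] e_def f_def
    by (simp only: mult.assoc)
qed

theorem theorem2p10:
  fixes x y z :: nat and as bs :: "nat list"
  shows
    "let a = sum_list as; b = sum_list bs;
         o\<^sub>a = odd_sum as; e\<^sub>a = even_sum as; o\<^sub>b = odd_sum bs; e\<^sub>b = even_sum bs;
         G = (T (real x + 1) (2 * a + b + 2 * y + z - 1) y
                * V (2 * real x + 2 * real a + 1) (b + 2 * y + z) y)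
             / (T 1 (2 * a + b + 2 * y + z - 1) y * V (2 * real a + 1) (b + 2 * y + z) y)
     in
       M (RW1 y 0 z as bs) \<noteq> 0 \<and>
       M (RW1 x y z as bs)
         = M (RW1 (x + y) 0 z as bs) * M (RW1 0 y z as bs) / M (RW1 y 0 z as bs) * G \<and>
       M (RW1 x y z as bs)
         = 2 powi (int (entry as 1) - 2 * int y)
           * Q' (t_plus x y as bs) * Q' (t_minus x y z as bs)
           * (odd_dfact (2 * int a + 2 * int y - 1) / odd_dfact (2 * int a - 1))
           * ((H2 (2 * e\<^sub>a + 2 * o\<^sub>b + 1) * H2 (2 * o\<^sub>a + 2 * e\<^sub>b + 2 * z + 1))
              / (H2 (2 * e\<^sub>a + 2 * o\<^sub>b + 2 * y + 1) * H2 (2 * o\<^sub>a + 2 * e\<^sub>b + 2 * y + 2 * z + 1)))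
           * ((H (2 * a + b + 2 * y + z) * H (b + y + z))
              / (H (2 * a + b + y + z) * H (b + z)))
           * G"
proof -
  define a b where "a = sum_list as" and "b = sum_list bs"
  define e f where "e = even_sum as + odd_sum bs" and "f = odd_sum as + even_sum bs + z"
  define G where "G = (T (real x + 1) (2 * a + b + 2 * y + z - 1) y * V (2 * real x + 2 * real a
      + 1) (b + 2 * y + z) y)
             / (T 1 (2 * a + b + 2 * y + z - 1) y * V (2 * real a + 1) (b + 2 * y + z) y)"
  \<comment> \<open>Among x and y, only their sum enters here, through L. The regions with
    parameters (x, y) and (x + y, 0) share this factor, and so do those with (0, y) and (y, 0); this
    yields the first equation.\<close>
  define \<Delta> where "\<Delta> = (\<lambda>L. 2 ^ entry as 1 * dented (upper_dents L as bs) * dented (lower_dents L z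
      as bs))"
  define \<rho> where "\<rho> = odd_facts e * odd_facts f / (odd_facts (e + y) * odd_facts (f + y))"
  define \<Sigma> where "\<Sigma> = selberg_sum (2 * a) (b + z) y y / 4 ^ y"
  have of: "odd_facts n \<noteq> 0" for n using odd_facts_pos[of n] by simp
  have G: "selberg_sum (2 * a) (b + z) y (x + y) / 4 ^ y = \<Sigma> * G"
    unfolding selberg_sum_ratio \<Sigma>_def G_def by (simp add: add_ac)
  have M1: "M (RW1 x y z as bs) = \<Delta> (x + y + a + b) * \<rho> * (\<Sigma> * G)"
    unfolding M_RW1_closed \<Delta>_def \<rho>_def e_def f_def G[symmetric] a_def b_def ..
  \<comment> \<open>For y = 0 the quotient of factorial products and the Selberg sum are both
    1.\<close>
  have M2: "M (RW1 n 0 z as bs) = \<Delta> (n + a + b)" for n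
    unfolding M_RW1_closed \<Delta>_def a_def b_def by (simp add: selberg_sum_0 of)
  have M3: "M (RW1 0 y z as bs) = \<Delta> (y + a + b) * \<rho> * \<Sigma>"
    unfolding M_RW1_closed \<Delta>_def \<rho>_def \<Sigma>_def e_def f_def a_def b_def by simp
  have \<Delta>: "\<Delta> L \<noteq> 0" if "a + b \<le> L" for L
  proof -
    have "dented (upper_dents L as bs) > 0" "dented (lower_dents L z as bs) > 0"
      using that finite_dents[of as bs L] unfolding a_def b_def by (auto intro: dented_pos)
    then show ?thesis unfolding \<Delta>_def by simp
  qed
  have 1: "M (RW1 y 0 z as bs) \<noteq> 0" unfolding M2 by (rule \<Delta>) simp
  have 2: "M (RW1 x y z as bs) = M (RW1 (x + y) 0 z as bs) * M (RW1 0 y z as bs) / M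
      (RW1 y 0 z as bs) * G"
    using 1 unfolding M1 M2 M3 by simp
  have L: "x + y + a + b = x + y + sum_list as + sum_list bs" by (simp add: a_def b_def)
  have Q: "\<Delta> (x + y + a + b) = 2 ^ entry as 1 * Q' (t_plus x y as bs) * Q' (t_minus x y z as bs)"
    unfolding \<Delta>_def Q'_t_plus[OF L] Q'_t_minus[OF L] ..
  \<comment> \<open>The exponent may be negative; 4 ^ y is the denominator left by
    \<open>sum_dented\<close>.\<close>
  have powi: "(2 :: real) powi (int (entry as 1) - 2 * int y) = 2 ^ entry as 1 / 4 ^ y"
  proof -
    have "(2 :: real) powi (int (entry as 1) - int (2 * y)) = 2 powi int (entry as 1) / 2 powi int
        (2 * y)"
      by (rule power_int_diff) simp
    also have "(2 :: real) powi int (2 * y) = 2 ^ (2 * y)" by (rule power_int_of_nat)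
    also have "\<dots> = 4 ^ y" by (simp add: power_mult)
    finally show ?thesis by simp
  qed
  have \<rho>': "(H2 (2 * even_sum as + 2 * odd_sum bs + 1) * H2 (2 * odd_sum as + 2 * even_sum bs + 2
      * z + 1))
      / (H2 (2 * even_sum as + 2 * odd_sum bs + 2 * y + 1) * H2 (2 * odd_sum as + 2 * even_sum bs
          + 2 * y + 2 * z + 1)) = \<rho>"
    unfolding \<rho>_def H2_odd[symmetric] e_def f_def by (simp add: algebra_simps)
  define D where "D = odd_dfact (2 * int a + 2 * int y - 1) / odd_dfact (2 * int a - 1)"
  define R where "R = (H (2 * a + b + 2 * y + z) * H (b + y + z)) / (H (2 * a + b + y + z) * H
      (b + z))"
  have \<Sigma>': "\<Sigma> = D * R / 4 ^ y"
    unfolding \<Sigma>_def selberg_sum_full_closed D_def R_def by (simp add: add_ac)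
  have 3: "M (RW1 x y z as bs)
         = 2 powi (int (entry as 1) - 2 * int y)
           * Q' (t_plus x y as bs) * Q' (t_minus x y z as bs)
           * (odd_dfact (2 * int a + 2 * int y - 1) / odd_dfact (2 * int a - 1))
           * ((H2 (2 * even_sum as + 2 * odd_sum bs + 1) * H2 (2 * odd_sum as + 2 * even_sum bs
               + 2 * z + 1))
              / (H2 (2 * even_sum as + 2 * odd_sum bs + 2 * y + 1) * H2 (2 * odd_sum as + 2
                  * even_sum bs + 2 * y + 2 * z + 1)))
           * ((H (2 * a + b + 2 * y + z) * H (b + y + z))
              / (H (2 * a + b + y + z) * H (b + z)))
           * G"
    unfolding M1 Q powi \<rho>' \<Sigma>' D_def[symmetric] R_def[symmetric]
    by (simp only: times_divide_eq_left times_divide_eq_right mult_ac)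
  show ?thesis
    unfolding Let_def a_def[symmetric] b_def[symmetric] G_def[symmetric] using 1 2 3 by blast
qed

end
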